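(* Let $\mathcal D^{\lambda,\omega}$ be a lax-oplax duoidal category. Then the lax structure $\lambda$ induces a lax monoidal 2-category structure $\times_\lambda$ on the 2-category $\mathsf{Cat}_{\mathcal D}$ of categories enriched over the oplax monoidal category $\mathcal D^\omega$ (that is, $\mathsf{Cat}_{\mathcal D}$ becomes a lax monoid in the 2-category $\mathsf{2}\text{-}\mathsf{Cat}$ with its cartesian product), with structure 2-functors $$\times_\lambda^n=(\lambda^n)_*\circ\boxtimes^n:\ \mathsf{Cat}_{\mathcal D}\times\cdots\times\mathsf{Cat}_{\mathcal D}\to\mathsf{Cat}_{\mathcal D\times\cdots\times\mathcal D}\to\mathsf{Cat}_{\mathcal D}\qquad(n\ge-1).$$
   Context: **Oplax / lax monoidal categories.** $\mathcal V^\omega$ oplax monoidal: a category $\mathcal V$ with functors $\omega^n:\mathcal V^{n+1}\to\mathcal V$ ($n\ge-1$), natural transformations $\omega^{p+q}\to\omega^p(-,\omega^q,-)$ for $p\ge0,q\ge-1$ and each of the $p+1$ insertion positions, and a counit $\omega^0\to\mathrm{Id}$, such that: $\omega^p\to\omega^0\omega^p\to\omega^p$ and $\omega^p\to\omega^p(-,\omega^0,-)\to\omega^p$ are identities; the two composites $\omega^{p+q+r}\to\omega^p(-,\omega^q,-,\omega^r,-)$ agree; the two composites $\omega^{p+q+r}\to\omega^p(-,\omega^q(-,\omega^r,-),-)$ agree. A lax monoidal structure on $\mathcal V$ is an oplax monoidal structure on $\mathcal V^{\mathrm{op}}$: functors $\lambda^n$, transformations $\lambda^p(-,\lambda^q,-)\to\lambda^{p+q}$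 and unit $\mathrm{Id}\to\lambda^0$ with the dual axioms. Write $1_\omega=\omega^{-1}$, $\otimes_\omega=\omega^1$. Products of oplax (lax) monoidal categories are formed componentwise. **Lax functor between oplax monoidal categories** $(F,\{l^n\}):\mathcal U^\psi\to\mathcal V^\omega$: natural $l^n:\omega^nF\to F\psi^n$ ($n\ge-1$) such that $\omega^0F\xrightarrow{l^0}F\psi^0\to F$ is the counit, and $\omega^{p+q}F\xrightarrow{l^{p+q}}F\psi^{p+q}\to F\psi^p(-,\psi^q,-)$ equals $\omega^{p+q}F\to\omega^p(-,\omega^q,-)F\xrightarrow{l^q}\omega^pF(-,\psi^q,-)\xrightarrow{l^p}F\psi^p(-,\psi^q,-)$. **Oplax functor between lax monoidal categories**: the dual notion (a lax functor between the opposite categories). **Lax-oplax duoidal category** $\mathcal D^{\lambda,\omega}$: a category with a lax monoidal structure $\lambda$, an oplax monoidal structure $\omega$, and natural transformations, for $p,q\ge-1$ and objects $x_{ij}$ ($0\le i\le p$, $0\le j\le q$), $$\chi^{p,q}:\omega^p\big(\lambda^q(x_{0\bullet}),\dots,\lambda^q(x_{p\bullet})\big)\to\lambda^q\big(\omega^p(x_{\bullet0}),\dots,\omega^p(x_{\bullet q})\big),$$ such that for each $q$ the family $\{\chi^{p,q}\}_p$ makes $\lambda^q:(\mathcal D^{q+1})^\omega\to\mathcal D^\omega$ a lax functor, and for each $p$ the family $\{\chi^{p,q}\}_q$ makes $\omega^p:(\mathcal D^{p+1})^\lambda\to\mathcal D^\lambda$ an oplax functor. **The 2-category $\mathsf{Cat}_{\mathcal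 V}$.** An object is a category $\mathcal C$ with a functor $[-,-]:\mathcal C^{\mathrm{op}}\times\mathcal C\to\mathcal V$, maps $\eta_x:1_\omega\to[x,x]$ extranatural in $x$, and $\mu_{x,y,z}:[y,z]\otimes_\omega[x,y]\to[x,z]$ natural in $x,z$, extranatural in $y$, such that the two composites $\omega^2([y,z],[x,y],[w,x])\to[w,z]$, through $([y,z]\otimes_\omega[x,y])\otimes_\omega[w,x]$ and through $[y,z]\otimes_\omega([x,y]\otimes_\omega[w,x])$, agree, and the composites $\omega^0([x,y])\to1_\omega\otimes_\omega[x,y]\to[y,y]\otimes_\omega[x,y]\to[x,y]$ and $\omega^0([x,y])\to[x,y]\otimes_\omega1_\omega\to[x,y]\otimes_\omega[x,x]\to[x,y]$ both equal the counit. A 1-morphism $(\mathcal B,[-,-],\eta,\mu)\to(\mathcal C,\langle-,-\rangle,\theta,\nu)$ is a functor $F$ with a natural family $F_{x,y}:[x,y]\to\langle Fx,Fy\rangle$ such that $F_{x,x}\eta_x=\theta_{Fx}$ and $F_{x,z}\mu_{x,y,z}=\nu_{Fx,Fy,Fz}(F_{y,z}\otimes_\omega F_{x,y})$. A 2-morphism $F\Rightarrow G$ is a natural transformation $\alpha$ with $\langle-,\alpha_y\rangle F_{x,y}=\langle\alpha_x,-\rangle G_{x,y}$. **Pushforward.** For a lax functor $(f,\{l^n\}):\mathcal U^\psi\to\mathcal V^\omega$, $f_*:\mathsf{Cat}_{\mathcal U}\to\mathsf{Cat}_{\mathcal V}$ keeps the underlying category, functors and natural transformations, replaces $[-,-]$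 by $f\circ[-,-]$, $\eta_x$ by $f(\eta_x)\circ l^{-1}$, $\mu$ by $f(\mu)\circ l^1$, and $F_{x,y}$ by $f(F_{x,y})$. A natural transformation $t:f\Rightarrow g$ compatible with the lax structures gives $t_*:f_*\Rightarrow g_*$, with component at $\mathcal C$ the identity functor with structure maps $t_{[x,y]}$. **External product.** $\boxtimes:\mathsf{Cat}_{\mathcal U}\times\mathsf{Cat}_{\mathcal V}\to\mathsf{Cat}_{\mathcal U\times\mathcal V}$ sends $(\mathcal B,[-,-])$, $(\mathcal C,\langle-,-\rangle)$ to $\mathcal B\times\mathcal C$ with hom bifunctor $((b,c),(b',c'))\mapsto([b,b'],\langle c,c'\rangle)$ and componentwise structure (similarly on functors and transformations); $\boxtimes^n$ is its $(n+1)$-ary version, and $\boxtimes^{-1}$ picks the terminal category in $\mathsf{Cat}_{*}$ ($*$ the terminal oplax monoidal category). **Lax monoidal 2-category** (lax monoid in $\mathsf{2}\text{-}\mathsf{Cat}$): a 2-category $\mathcal K$ with 2-functors $T^n:\mathcal K^{n+1}\to\mathcal K$ ($n\ge-1$), 2-natural transformations $T^p(-,T^q,-)\to T^{p+q}$ and $\mathrm{Id}\to T^0$ satisfying the axioms of a lax monoidal category. Here the structure transformations of $\times_\lambda$ are those induced by pushing forward the structure transformations $\lambda^p(-,\lambda^q,-)\to\lambda^{p+q}$ and $\mathrm{Id}\to\lambda^0$. *)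

theory Defs
  imports "HOL-Library.FuncSet"
begin

section \<open>Categories, functors, natural transformations\<close>

record ('o, 'a) cat =
  Obj :: "'o set"
  Arr :: "'a set"
  Dom :: "'a \<Rightarrow> 'o"
  Cod :: "'a \<Rightarrow> 'o"
  Id :: "'o \<Rightarrow> 'a"
  Comp :: "'a \<Rightarrow> 'a \<Rightarrow> 'a" (infixr "\<cdot>\<index>" 70)

definition hom :: "('o, 'a) cat \<Rightarrow> 'o \<Rightarrow> 'o \<Rightarrow> 'a set" where
  "hom C x y = {f \<in> Arr C. Dom C f = x \<and> Cod C f = y}"

locale category =
  fixes C :: "('o, 'a) cat" (structure)
  assumes dom_obj: "f \<in> Arr C \<Longrightarrow> Dom C f \<in> Obj C"
    and cod_obj: "f \<in> Arr C \<Longrightarrow> Cod C f \<in> Obj C"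
    and id_hom: "x \<in> Obj C \<Longrightarrow> Id C x \<in> hom C x x"
    and comp_hom: "\<lbrakk>f \<in> hom C x y; g \<in> hom C y z\<rbrakk> \<Longrightarrow> g \<cdot> f \<in> hom C x z"
    and id_left: "f \<in> hom C x y \<Longrightarrow> Id C y \<cdot> f = f"
    and id_right: "f \<in> hom C x y \<Longrightarrow> f \<cdot> Id C x = f"
    and comp_assoc: "\<lbrakk>f \<in> hom C w x; g \<in> hom C x y; h \<in> hom C y z\<rbrakk>
      \<Longrightarrow> (h \<cdot> g) \<cdot> f = h \<cdot> (g \<cdot> f)"

definition op_cat :: "('o, 'a) cat \<Rightarrow> ('o, 'a) cat" where
  "op_cat C = \<lparr>Obj = Obj C, Arr = Arr C, Dom = Cod C, Cod = Dom C, Id = Id C,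
     Comp = (\<lambda>g f. Comp C f g)\<rparr>"

definition prod_cat :: "('o, 'a) cat \<Rightarrow> ('p, 'b) cat \<Rightarrow> ('o \<times> 'p, 'a \<times> 'b) cat" where
  "prod_cat A B = \<lparr>Obj = Obj A \<times> Obj B, Arr = Arr A \<times> Arr B,
     Dom = map_prod (Dom A) (Dom B), Cod = map_prod (Cod A) (Cod B),
     Id = map_prod (Id A) (Id B),
     Comp = (\<lambda>g f. (Comp A (fst g) (fst f), Comp B (snd g) (snd f)))\<rparr>"

definition lists_of :: "nat \<Rightarrow> 'x set \<Rightarrow> 'x list set" where
  "lists_of n A = {xs. length xs = n \<and> set xs \<subseteq> A}"

text \<open>The \<open>n\<close>-fold cartesian power; objects and arrows are lists of length \<open>n\<close>.\<close>

definition pow_cat :: "nat \<Rightarrow> ('o, 'a) cat \<Rightarrow> ('o list, 'a list) cat" where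
  "pow_cat n C = \<lparr>Obj = lists_of n (Obj C), Arr = lists_of n (Arr C),
     Dom = map (Dom C), Cod = map (Cod C), Id = map (Id C), Comp = map2 (Comp C)\<rparr>"

record ('o, 'a, 'p, 'b) ftr =
  FO :: "'o \<Rightarrow> 'p"
  FA :: "'a \<Rightarrow> 'b"

locale cat_functor = A: category A + B: category B
  for A :: "('o, 'a) cat" and B :: "('p, 'b) cat" +
  fixes F :: "('o, 'a, 'p, 'b) ftr"
  assumes obj: "x \<in> Obj A \<Longrightarrow> FO F x \<in> Obj B"
    and arr: "f \<in> hom A x y \<Longrightarrow> FA F f \<in> hom B (FO F x) (FO F y)"
    and pres_id: "x \<in> Obj A \<Longrightarrow> FA F (Id A x) = Id B (FO F x)"
    and pres_comp: "\<lbrakk>f \<in> hom A x y; g \<in> hom A y z\<rbrakk>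
      \<Longrightarrow> FA F (Comp A g f) = Comp B (FA F g) (FA F f)"

definition ftr_comp :: "('p, 'b, 'q, 'c) ftr \<Rightarrow> ('o, 'a, 'p, 'b) ftr \<Rightarrow> ('o, 'a, 'q, 'c) ftr" where
  "ftr_comp G F = \<lparr>FO = FO G \<circ> FO F, FA = FA G \<circ> FA F\<rparr>"

definition ftr_pow :: "('o, 'a, 'p, 'b) ftr \<Rightarrow> ('o list, 'a list, 'p list, 'b list) ftr" where
  "ftr_pow F = \<lparr>FO = map (FO F), FA = map (FA F)\<rparr>"

locale nat_trans = S: cat_functor A B F + T: cat_functor A B G
  for A :: "('o, 'a) cat" and B :: "('p, 'b) cat"
    and F G :: "('o, 'a, 'p, 'b) ftr" +
  fixes t :: "'o \<Rightarrow> 'b"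
  assumes component: "x \<in> Obj A \<Longrightarrow> t x \<in> hom B (FO F x) (FO G x)"
    and naturality: "f \<in> hom A x y \<Longrightarrow> Comp B (FA G f) (t x) = Comp B (t y) (FA F f)"


section \<open>Oplax and lax monoidal categories\<close>

text \<open>
  The functors \<open>\<omega>\<^sup>n : V\<^sup>n\<^sup>+\<^sup>1 \<rightarrow> V\<close> (\<open>n \<ge> -1\<close>) are packaged as one pair of functions on lists,
  a list of length \<open>n + 1\<close> being an argument of \<open>\<omega>\<^sup>n\<close>.  In the oplax case \<open>dlt M xs ys zs\<close> is
  the component \<open>\<omega>(xs @ ys @ zs) \<rightarrow> \<omega>(xs @ [\<omega> ys] @ zs)\<close> and \<open>cnt M x\<close> is \<open>\<omega>[x] \<rightarrow> x\<close>; so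
  \<open>q + 1\<close> is the length of \<open>ys\<close> and \<open>xs, zs\<close> determine \<open>p\<close> and the insertion position.
  In the lax case the same data are arrows in the opposite direction.
\<close>

record ('o, 'a) mon =
  tens :: "('o list, 'a list, 'o, 'a) ftr"
  dlt :: "'o list \<Rightarrow> 'o list \<Rightarrow> 'o list \<Rightarrow> 'a"
  cnt :: "'o \<Rightarrow> 'a"

abbreviation tO :: "('o, 'a) mon \<Rightarrow> 'o list \<Rightarrow> 'o" where "tO M \<equiv> FO (tens M)"
abbreviation tA :: "('o, 'a) mon \<Rightarrow> 'a list \<Rightarrow> 'a" where "tA M \<equiv> FA (tens M)"

text \<open>\<open>blocks i k h\<close> cuts a list after \<open>i\<close> and after \<open>i + k\<close> entries and feeds \<open>h\<close> the pieces.\<close>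

definition blocks :: "nat \<Rightarrow> nat \<Rightarrow> ('x list \<Rightarrow> 'x list \<Rightarrow> 'x list \<Rightarrow> 'y) \<Rightarrow> 'x list \<Rightarrow> 'y" where
  "blocks i k h xs = h (take i xs) (take k (drop i xs)) (drop (i + k) xs)"

definition nest :: "nat \<Rightarrow> nat \<Rightarrow> ('o, 'a) mon \<Rightarrow> ('o list, 'a list, 'o, 'a) ftr" where
  "nest i k M = \<lparr>FO = blocks i k (\<lambda>xs ys zs. tO M (xs @ [tO M ys] @ zs)),
                 FA = blocks i k (\<lambda>fs gs hs. tA M (fs @ [tA M gs] @ hs))\<rparr>"

locale oplax_monoidal = category C
  for C :: "('o, 'a) cat" (structure) +
  fixes M :: "('o, 'a) mon"
  assumes tens_functor: "cat_functor (pow_cat n C) C (tens M)"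
    and dlt_natural: "nat_trans (pow_cat (i + k + j) C) C (tens M) (nest i k M) (blocks i k (dlt M))"
    and cnt_natural: "nat_trans C C \<lparr>FO = (\<lambda>x. tO M [x]), FA = (\<lambda>f. tA M [f])\<rparr>
      \<lparr>FO = id, FA = id\<rparr> (cnt M)"
    and counit_outer: "set xs \<subseteq> Obj C \<Longrightarrow> cnt M (tO M xs) \<cdot> dlt M [] xs [] = Id C (tO M xs)"
    and counit_inner: "set (xs @ [y] @ zs) \<subseteq> Obj C \<Longrightarrow>
      tA M (map (Id C) xs @ [cnt M y] @ map (Id C) zs) \<cdot> dlt M xs [y] zs = Id C (tO M (xs @ [y] @ zs))"
    and coassoc_parallel: "set (xs @ us @ ys @ vs @ zs) \<subseteq> Obj C \<Longrightarrow>
      dlt M (xs @ [tO M us] @ ys) vs zs \<cdot> dlt M xs us (ys @ vs @ zs)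
      = dlt M xs us (ys @ [tO M vs] @ zs) \<cdot> dlt M (xs @ us @ ys) vs zs"
    and coassoc_nested: "set (xs @ us @ vs @ ws @ zs) \<subseteq> Obj C \<Longrightarrow>
      tA M (map (Id C) xs @ [dlt M us vs ws] @ map (Id C) zs) \<cdot> dlt M xs (us @ vs @ ws) zs
      = dlt M xs (us @ [tO M vs] @ ws) zs \<cdot> dlt M (xs @ us) vs (ws @ zs)"

abbreviation lax_monoidal :: "('o, 'a) cat \<Rightarrow> ('o, 'a) mon \<Rightarrow> bool" where
  "lax_monoidal C L \<equiv> oplax_monoidal (op_cat C) L"

text \<open>
  \<open>columns n\<close> transposes a list of rows of length \<open>n\<close>.  (The number of columns has to be
  given, since the list of rows may be empty.)
\<close>

definition columns :: "nat \<Rightarrow> 'x list list \<Rightarrow> 'x list list" where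
  "columns n xss = map (\<lambda>j. map (\<lambda>xs. xs ! j) xss) [0..<n]"

text \<open>The componentwise structure on the \<open>n\<close>-fold power.\<close>

definition pow_mon :: "nat \<Rightarrow> ('o, 'a) mon \<Rightarrow> ('o list, 'a list) mon" where
  "pow_mon n M =
     \<lparr>tens = \<lparr>FO = (\<lambda>xss. map (tO M) (columns n xss)), FA = (\<lambda>fss. map (tA M) (columns n fss))\<rparr>,
      dlt = (\<lambda>xss yss zss. map (\<lambda>j. dlt M (columns n xss ! j) (columns n yss ! j) (columns n zss ! j)) [0..<n]),
      cnt = map (cnt M)\<rparr>"

locale lax_functor = S: oplax_monoidal A M + T: oplax_monoidal B N + cat_functor A B F
  for A :: "('o, 'a) cat" and M and B :: "('p, 'b) cat" and N
    and F :: "('o, 'a, 'p, 'b) ftr" +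
  fixes l :: "'o list \<Rightarrow> 'b"
  assumes lax_natural:
      "nat_trans (pow_cat n A) B (ftr_comp (tens N) (ftr_pow F)) (ftr_comp F (tens M)) l"
    and lax_counit: "x \<in> Obj A \<Longrightarrow> Comp B (FA F (cnt M x)) (l [x]) = cnt N (FO F x)"
    and lax_comult: "set (xs @ ys @ zs) \<subseteq> Obj A \<Longrightarrow>
      Comp B (FA F (dlt M xs ys zs)) (l (xs @ ys @ zs))
      = Comp B (l (xs @ [tO M ys] @ zs))
          (Comp B (tA N (map (\<lambda>x. Id B (FO F x)) xs @ [l ys] @ map (\<lambda>x. Id B (FO F x)) zs))
                  (dlt N (map (FO F) xs) (map (FO F) ys) (map (FO F) zs)))"

abbreviation oplax_functor where
  "oplax_functor A L B L' F l \<equiv> lax_functor (op_cat A) L (op_cat B) L' F l"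

text \<open>
  For a list \<open>xss\<close> of \<open>p + 1\<close> rows of length \<open>n = q + 1\<close>, \<open>\<chi> n xss\<close> is the component
  \<open>\<omega>(map \<lambda> xss) \<rightarrow> \<lambda>(map \<omega> (columns n xss))\<close> of \<open>\<chi>\<^sup>p\<^sup>,\<^sup>q\<close>.  In \<open>omega_oplax\<close> the argument
  \<open>css\<close> is a list of \<open>q + 1\<close> columns of length \<open>m = p + 1\<close>.
\<close>

locale duoidal =
  fixes D :: "('p, 'b) cat" and lam om :: "('p, 'b) mon"
    and chi :: "nat \<Rightarrow> 'p list list \<Rightarrow> 'b"
  assumes lax: "lax_monoidal D lam"
    and oplax: "oplax_monoidal D om"
    and lambda_lax: "lax_functor (pow_cat n D) (pow_mon n om) D om (tens lam) (chi n)"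
    and omega_oplax: "oplax_functor (pow_cat m D) (pow_mon m lam) D lam (tens om)
      (\<lambda>css. chi (length css) (columns m css))"


section \<open>Strict 2-categories and lax monoidal 2-categories\<close>

record ('x, 'f, 't) two_cat =
  Cell0 :: "'x set"
  Cell1 :: "'f set"
  Cell2 :: "'t set"
  Src1 :: "'f \<Rightarrow> 'x"
  Tgt1 :: "'f \<Rightarrow> 'x"
  Id1 :: "'x \<Rightarrow> 'f"
  Comp1 :: "'f \<Rightarrow> 'f \<Rightarrow> 'f"
  Src2 :: "'t \<Rightarrow> 'f"
  Tgt2 :: "'t \<Rightarrow> 'f"
  Id2 :: "'f \<Rightarrow> 't"
  VComp :: "'t \<Rightarrow> 't \<Rightarrow> 't"
  HComp :: "'t \<Rightarrow> 't \<Rightarrow> 't"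

definition cat01 :: "('x, 'f, 't) two_cat \<Rightarrow> ('x, 'f) cat" where
  "cat01 K = \<lparr>Obj = Cell0 K, Arr = Cell1 K, Dom = Src1 K, Cod = Tgt1 K, Id = Id1 K, Comp = Comp1 K\<rparr>"

definition cat12 :: "('x, 'f, 't) two_cat \<Rightarrow> ('f, 't) cat" where
  "cat12 K = \<lparr>Obj = Cell1 K, Arr = Cell2 K, Dom = Src2 K, Cod = Tgt2 K, Id = Id2 K, Comp = VComp K\<rparr>"

definition cat02 :: "('x, 'f, 't) two_cat \<Rightarrow> ('x, 't) cat" where
  "cat02 K = \<lparr>Obj = Cell0 K, Arr = Cell2 K, Dom = Src1 K \<circ> Src2 K, Cod = Tgt1 K \<circ> Src2 K,
     Id = Id2 K \<circ> Id1 K, Comp = HComp K\<rparr>"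

locale two_category =
  C01: category "cat01 K" + C12: category "cat12 K" + C02: category "cat02 K"
  for K :: "('x, 'f, 't) two_cat" +
  assumes globular: "a \<in> Cell2 K \<Longrightarrow>
      Src1 K (Src2 K a) = Src1 K (Tgt2 K a) \<and> Tgt1 K (Src2 K a) = Tgt1 K (Tgt2 K a)"
    and hcomp_bounds: "\<lbrakk>a \<in> Cell2 K; b \<in> Cell2 K; Src1 K (Src2 K b) = Tgt1 K (Src2 K a)\<rbrakk> \<Longrightarrow>
      Src2 K (HComp K b a) = Comp1 K (Src2 K b) (Src2 K a) \<and>
      Tgt2 K (HComp K b a) = Comp1 K (Tgt2 K b) (Tgt2 K a)"
    and hcomp_id: "\<lbrakk>f \<in> Cell1 K; g \<in> Cell1 K; Src1 K g = Tgt1 K f\<rbrakk> \<Longrightarrow>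
      HComp K (Id2 K g) (Id2 K f) = Id2 K (Comp1 K g f)"
    and interchange: "\<lbrakk>a \<in> Cell2 K; a' \<in> Cell2 K; b \<in> Cell2 K; b' \<in> Cell2 K;
        Src2 K a' = Tgt2 K a; Src2 K b' = Tgt2 K b; Src1 K (Src2 K b) = Tgt1 K (Src2 K a)\<rbrakk> \<Longrightarrow>
      HComp K (VComp K b' b) (VComp K a' a) = VComp K (HComp K b' a') (HComp K b a)"

definition pow_two_cat :: "nat \<Rightarrow> ('x, 'f, 't) two_cat \<Rightarrow> ('x list, 'f list, 't list) two_cat" where
  "pow_two_cat n K = \<lparr>Cell0 = lists_of n (Cell0 K), Cell1 = lists_of n (Cell1 K),
     Cell2 = lists_of n (Cell2 K), Src1 = map (Src1 K), Tgt1 = map (Tgt1 K), Id1 = map (Id1 K),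
     Comp1 = map2 (Comp1 K), Src2 = map (Src2 K), Tgt2 = map (Tgt2 K), Id2 = map (Id2 K),
     VComp = map2 (VComp K), HComp = map2 (HComp K)\<rparr>"

record ('x, 'f, 't, 'y, 'g, 's) two_ftr =
  F0 :: "'x \<Rightarrow> 'y"
  F1 :: "'f \<Rightarrow> 'g"
  F2 :: "'t \<Rightarrow> 's"

definition two_id :: "('x, 'f, 't, 'x, 'f, 't) two_ftr" where
  "two_id = \<lparr>F0 = id, F1 = id, F2 = id\<rparr>"

definition two_comp :: "('y, 'g, 's, 'z, 'h, 'r) two_ftr \<Rightarrow> ('x, 'f, 't, 'y, 'g, 's) two_ftr
    \<Rightarrow> ('x, 'f, 't, 'z, 'h, 'r) two_ftr" (infixr "\<circ>\<^sub>2" 55) where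
  "G \<circ>\<^sub>2 F = \<lparr>F0 = F0 G \<circ> F0 F, F1 = F1 G \<circ> F1 F, F2 = F2 G \<circ> F2 F\<rparr>"

locale two_functor = S: two_category K + T: two_category L +
    F01: cat_functor "cat01 K" "cat01 L" "\<lparr>FO = F0 F, FA = F1 F\<rparr>" +
    F12: cat_functor "cat12 K" "cat12 L" "\<lparr>FO = F1 F, FA = F2 F\<rparr>" +
    F02: cat_functor "cat02 K" "cat02 L" "\<lparr>FO = F0 F, FA = F2 F\<rparr>"
  for K :: "('x, 'f, 't) two_cat" and L :: "('y, 'g, 's) two_cat"
    and F :: "('x, 'f, 't, 'y, 'g, 's) two_ftr"

locale two_natural = S: two_functor K L F + T: two_functor K L G
  for K :: "('x, 'f, 't) two_cat" and L :: "('y, 'g, 's) two_cat"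
    and F G :: "('x, 'f, 't, 'y, 'g, 's) two_ftr" +
  fixes t :: "'x \<Rightarrow> 'g"
  assumes natural1: "nat_trans (cat01 K) (cat01 L)
      \<lparr>FO = F0 F, FA = F1 F\<rparr> \<lparr>FO = F0 G, FA = F1 G\<rparr> t"
    and natural2: "a \<in> Cell2 K \<Longrightarrow>
      HComp L (F2 G a) (Id2 L (t (Src1 K (Src2 K a))))
      = HComp L (Id2 L (t (Tgt1 K (Src2 K a)))) (F2 F a)"

text \<open>
  In a lax monoidal 2-category, \<open>T (n + 1)\<close> is the 2-functor \<open>T\<^sup>n : K\<^sup>n\<^sup>+\<^sup>1 \<rightarrow> K\<close> (\<open>n \<ge> -1\<close>),
  \<open>gam xs ys zs\<close> is the 1-cell \<open>T(xs @ [T ys] @ zs) \<rightarrow> T(xs @ ys @ zs)\<close>, and \<open>iot x\<close> is \<open>x \<rightarrow> T[x]\<close>.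
\<close>

definition two_nest :: "nat \<Rightarrow> nat \<Rightarrow> nat
    \<Rightarrow> (nat \<Rightarrow> ('x list, 'f list, 't list, 'x, 'f, 't) two_ftr)
    \<Rightarrow> ('x list, 'f list, 't list, 'x, 'f, 't) two_ftr" where
  "two_nest i k j T =
     \<lparr>F0 = blocks i k (\<lambda>xs ys zs. F0 (T (i + 1 + j)) (xs @ [F0 (T k) ys] @ zs)),
      F1 = blocks i k (\<lambda>fs gs hs. F1 (T (i + 1 + j)) (fs @ [F1 (T k) gs] @ hs)),
      F2 = blocks i k (\<lambda>as bs cs. F2 (T (i + 1 + j)) (as @ [F2 (T k) bs] @ cs))\<rparr>"

locale lax_monoidal_two_category = two_category K
  for K :: "('x, 'f, 't) two_cat" +
  fixes T :: "nat \<Rightarrow> ('x list, 'f list, 't list, 'x, 'f, 't) two_ftr"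
    and gam :: "'x list \<Rightarrow> 'x list \<Rightarrow> 'x list \<Rightarrow> 'f"
    and iot :: "'x \<Rightarrow> 'f"
  assumes T_functor: "two_functor (pow_two_cat n K) K (T n)"
    and gam_natural: "two_natural (pow_two_cat (i + k + j) K) K
      (two_nest i k j T) (T (i + k + j)) (blocks i k gam)"
    and iot_natural: "two_natural K K two_id
      \<lparr>F0 = (\<lambda>x. F0 (T 1) [x]), F1 = (\<lambda>f. F1 (T 1) [f]), F2 = (\<lambda>a. F2 (T 1) [a])\<rparr> iot"
    and unit_outer: "set xs \<subseteq> Cell0 K \<Longrightarrow>
      Comp1 K (gam [] xs []) (iot (F0 (T (length xs)) xs)) = Id1 K (F0 (T (length xs)) xs)"
    and unit_inner: "\<lbrakk>set (xs @ [y] @ zs) \<subseteq> Cell0 K; n = length (xs @ [y] @ zs)\<rbrakk> \<Longrightarrow>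
      Comp1 K (gam xs [y] zs) (F1 (T n) (map (Id1 K) xs @ [iot y] @ map (Id1 K) zs))
      = Id1 K (F0 (T n) (xs @ [y] @ zs))"
    and assoc_parallel: "set (xs @ us @ ys @ vs @ zs) \<subseteq> Cell0 K \<Longrightarrow>
      Comp1 K (gam xs us (ys @ vs @ zs)) (gam (xs @ [F0 (T (length us)) us] @ ys) vs zs)
      = Comp1 K (gam (xs @ us @ ys) vs zs) (gam xs us (ys @ [F0 (T (length vs)) vs] @ zs))"
    and assoc_nested: "\<lbrakk>set (xs @ us @ vs @ ws @ zs) \<subseteq> Cell0 K; n = length xs + 1 + length zs\<rbrakk> \<Longrightarrow>
      Comp1 K (gam xs (us @ vs @ ws) zs)
        (F1 (T n) (map (Id1 K) xs @ [gam us vs ws] @ map (Id1 K) zs))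
      = Comp1 K (gam (xs @ us) vs (ws @ zs)) (gam xs (us @ [F0 (T (length vs)) vs] @ ws) zs)"


section \<open>The 2-category of categories enriched over an oplax monoidal category\<close>

record ('o, 'a, 'p, 'b) ecat =
  ucat :: "('o, 'a) cat"
  ehom :: "('o \<times> 'o, 'a \<times> 'a, 'p, 'b) ftr"
  eta :: "'o \<Rightarrow> 'b"
  mu :: "'o \<times> 'o \<times> 'o \<Rightarrow> 'b"

abbreviation eobj :: "('o, 'a, 'p, 'b) ecat \<Rightarrow> 'o set" where "eobj E \<equiv> Obj (ucat E)"
abbreviation earr :: "('o, 'a, 'p, 'b) ecat \<Rightarrow> 'a set" where "earr E \<equiv> Arr (ucat E)"
abbreviation hO :: "('o, 'a, 'p, 'b) ecat \<Rightarrow> 'o \<Rightarrow> 'o \<Rightarrow> 'p" where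
  "hO E x y \<equiv> FO (ehom E) (x, y)"
abbreviation hA :: "('o, 'a, 'p, 'b) ecat \<Rightarrow> 'a \<Rightarrow> 'a \<Rightarrow> 'b" where
  "hA E f g \<equiv> FA (ehom E) (f, g)"
abbreviation eid :: "('o, 'a, 'p, 'b) ecat \<Rightarrow> 'o \<Rightarrow> 'a" where "eid E \<equiv> Id (ucat E)"

locale enriched_category = oplax_monoidal V M
  for V :: "('p, 'b) cat" (structure) and M :: "('p, 'b) mon" +
  fixes E :: "('o, 'a, 'p, 'b) ecat"
  assumes hom_functor: "cat_functor (prod_cat (op_cat (ucat E)) (ucat E)) V (ehom E)"
    and ucat_category: "category (ucat E)"
    and eta_hom: "x \<in> eobj E \<Longrightarrow> eta E x \<in> hom V (tO M []) (hO E x x)"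
    and eta_extranatural: "f \<in> hom (ucat E) x y \<Longrightarrow>
      hA E (eid E x) f \<cdot> eta E x = hA E f (eid E y) \<cdot> eta E y"
    and mu_hom: "\<lbrakk>x \<in> eobj E; y \<in> eobj E; z \<in> eobj E\<rbrakk> \<Longrightarrow>
      mu E (x, y, z) \<in> hom V (tO M [hO E y z, hO E x y]) (hO E x z)"
    and mu_natural: "\<lbrakk>f \<in> hom (ucat E) x' x; y \<in> eobj E; h \<in> hom (ucat E) z z'\<rbrakk> \<Longrightarrow>
      hA E f h \<cdot> mu E (x, y, z) = mu E (x', y, z') \<cdot> tA M [hA E (eid E y) h, hA E f (eid E y)]"
    and mu_extranatural: "\<lbrakk>x \<in> eobj E; g \<in> hom (ucat E) y y'; z \<in> eobj E\<rbrakk> \<Longrightarrow>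
      mu E (x, y, z) \<cdot> tA M [hA E g (eid E z), Id V (hO E x y)]
      = mu E (x, y', z) \<cdot> tA M [Id V (hO E y' z), hA E (eid E x) g]"
    and mu_assoc: "\<lbrakk>w \<in> eobj E; x \<in> eobj E; y \<in> eobj E; z \<in> eobj E\<rbrakk> \<Longrightarrow>
      mu E (w, x, z) \<cdot> tA M [mu E (x, y, z), Id V (hO E w x)]
        \<cdot> dlt M [] [hO E y z, hO E x y] [hO E w x]
      = mu E (w, y, z) \<cdot> tA M [Id V (hO E y z), mu E (w, x, y)]
        \<cdot> dlt M [hO E y z] [hO E x y, hO E w x] []"
    and mu_unit_left: "\<lbrakk>x \<in> eobj E; y \<in> eobj E\<rbrakk> \<Longrightarrow>
      mu E (x, y, y) \<cdot> tA M [eta E y, Id V (hO E x y)] \<cdot> dlt M [] [] [hO E x y] = cnt M (hO E x y)"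
    and mu_unit_right: "\<lbrakk>x \<in> eobj E; y \<in> eobj E\<rbrakk> \<Longrightarrow>
      mu E (x, x, y) \<cdot> tA M [Id V (hO E x y), eta E x] \<cdot> dlt M [hO E x y] [] [] = cnt M (hO E x y)"

text \<open>
  All functions belonging to a cell of the 2-category below are required to be \<open>undefined\<close>
  off their intended domain, so that HOL equality of cells is the mathematical equality.
\<close>

definition ecat_normal :: "('o, 'a, 'p, 'b) ecat \<Rightarrow> bool" where
  "ecat_normal E \<longleftrightarrow>
     Dom (ucat E) \<in> extensional (earr E) \<and> Cod (ucat E) \<in> extensional (earr E) \<and>
     Id (ucat E) \<in> extensional (eobj E) \<and>
     (\<forall>g f. \<not> (f \<in> earr E \<and> g \<in> earr E \<and> Dom (ucat E) g = Cod (ucat E) f)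
        \<longrightarrow> Comp (ucat E) g f = undefined) \<and>
     FO (ehom E) \<in> extensional (eobj E \<times> eobj E) \<and>
     FA (ehom E) \<in> extensional (earr E \<times> earr E) \<and>
     eta E \<in> extensional (eobj E) \<and>
     mu E \<in> extensional (eobj E \<times> eobj E \<times> eobj E)"

record ('o, 'a, 'p, 'b) emor =
  msrc :: "('o, 'a, 'p, 'b) ecat"
  mtgt :: "('o, 'a, 'p, 'b) ecat"
  mfun :: "('o, 'a, 'o, 'a) ftr"
  mstr :: "'o \<times> 'o \<Rightarrow> 'b"

locale enriched_functor =
  S: enriched_category V M "msrc F" + T: enriched_category V M "mtgt F" +
  U: cat_functor "ucat (msrc F)" "ucat (mtgt F)" "mfun F"
  for V :: "('p, 'b) cat" (structure) and M :: "('p, 'b) mon"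
    and F :: "('o, 'a, 'p, 'b) emor" +
  assumes str_natural: "nat_trans (prod_cat (op_cat (ucat (msrc F))) (ucat (msrc F))) V
      (ehom (msrc F))
      (ftr_comp (ehom (mtgt F)) \<lparr>FO = map_prod (FO (mfun F)) (FO (mfun F)),
                                 FA = map_prod (FA (mfun F)) (FA (mfun F))\<rparr>)
      (mstr F)"
    and str_eta: "x \<in> eobj (msrc F) \<Longrightarrow>
      mstr F (x, x) \<cdot> eta (msrc F) x = eta (mtgt F) (FO (mfun F) x)"
    and str_mu: "\<lbrakk>x \<in> eobj (msrc F); y \<in> eobj (msrc F); z \<in> eobj (msrc F)\<rbrakk> \<Longrightarrow>
      mstr F (x, z) \<cdot> mu (msrc F) (x, y, z)
      = mu (mtgt F) (FO (mfun F) x, FO (mfun F) y, FO (mfun F) z) \<cdot> tA M [mstr F (y, z), mstr F (x, y)]"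

definition emor_normal :: "('o, 'a, 'p, 'b) emor \<Rightarrow> bool" where
  "emor_normal F \<longleftrightarrow> ecat_normal (msrc F) \<and> ecat_normal (mtgt F) \<and>
     FO (mfun F) \<in> extensional (eobj (msrc F)) \<and> FA (mfun F) \<in> extensional (earr (msrc F)) \<and>
     mstr F \<in> extensional (eobj (msrc F) \<times> eobj (msrc F))"

record ('o, 'a, 'p, 'b) etrans =
  tsrc :: "('o, 'a, 'p, 'b) emor"
  ttgt :: "('o, 'a, 'p, 'b) emor"
  tcomp :: "'o \<Rightarrow> 'a"

locale enriched_trans =
  S: enriched_functor V M "tsrc a" + T: enriched_functor V M "ttgt a" +
  nat_trans "ucat (msrc (tsrc a))" "ucat (mtgt (tsrc a))" "mfun (tsrc a)" "mfun (ttgt a)" "tcomp a"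
  for V :: "('p, 'b) cat" (structure) and M :: "('p, 'b) mon"
    and a :: "('o, 'a, 'p, 'b) etrans" +
  assumes parallel: "msrc (ttgt a) = msrc (tsrc a)" "mtgt (ttgt a) = mtgt (tsrc a)"
    and compat: "\<lbrakk>x \<in> eobj (msrc (tsrc a)); y \<in> eobj (msrc (tsrc a))\<rbrakk> \<Longrightarrow>
      hA (mtgt (tsrc a)) (eid (mtgt (tsrc a)) (FO (mfun (tsrc a)) x)) (tcomp a y) \<cdot> mstr (tsrc a) (x, y)
      = hA (mtgt (tsrc a)) (tcomp a x) (eid (mtgt (tsrc a)) (FO (mfun (ttgt a)) y)) \<cdot> mstr (ttgt a) (x, y)"

definition etrans_normal :: "('o, 'a, 'p, 'b) etrans \<Rightarrow> bool" where
  "etrans_normal a \<longleftrightarrow> emor_normal (tsrc a) \<and> emor_normal (ttgt a) \<and>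
     tcomp a \<in> extensional (eobj (msrc (tsrc a)))"

definition emor_id :: "('p, 'b) cat \<Rightarrow> ('o, 'a, 'p, 'b) ecat \<Rightarrow> ('o, 'a, 'p, 'b) emor" where
  "emor_id V E = \<lparr>msrc = E, mtgt = E,
     mfun = \<lparr>FO = (\<lambda>x\<in>eobj E. x), FA = (\<lambda>f\<in>earr E. f)\<rparr>,
     mstr = (\<lambda>(x, y)\<in>eobj E \<times> eobj E. Id V (hO E x y))\<rparr>"

definition emor_comp :: "('p, 'b) cat \<Rightarrow> ('o, 'a, 'p, 'b) emor \<Rightarrow> ('o, 'a, 'p, 'b) emor
    \<Rightarrow> ('o, 'a, 'p, 'b) emor" where
  "emor_comp V G F = \<lparr>msrc = msrc F, mtgt = mtgt G,
     mfun = \<lparr>FO = (\<lambda>x\<in>eobj (msrc F). FO (mfun G) (FO (mfun F) x)),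
             FA = (\<lambda>f\<in>earr (msrc F). FA (mfun G) (FA (mfun F) f))\<rparr>,
     mstr = (\<lambda>(x, y)\<in>eobj (msrc F) \<times> eobj (msrc F).
       Comp V (mstr G (FO (mfun F) x, FO (mfun F) y)) (mstr F (x, y)))\<rparr>"

definition etrans_id :: "('o, 'a, 'p, 'b) emor \<Rightarrow> ('o, 'a, 'p, 'b) etrans" where
  "etrans_id F = \<lparr>tsrc = F, ttgt = F, tcomp = (\<lambda>x\<in>eobj (msrc F). eid (mtgt F) (FO (mfun F) x))\<rparr>"

definition etrans_vcomp :: "('o, 'a, 'p, 'b) etrans \<Rightarrow> ('o, 'a, 'p, 'b) etrans
    \<Rightarrow> ('o, 'a, 'p, 'b) etrans" where
  "etrans_vcomp b a = \<lparr>tsrc = tsrc a, ttgt = ttgt b,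
     tcomp = (\<lambda>x\<in>eobj (msrc (tsrc a)). Comp (ucat (mtgt (tsrc a))) (tcomp b x) (tcomp a x))\<rparr>"

definition etrans_hcomp :: "('p, 'b) cat \<Rightarrow> ('o, 'a, 'p, 'b) etrans \<Rightarrow> ('o, 'a, 'p, 'b) etrans
    \<Rightarrow> ('o, 'a, 'p, 'b) etrans" where
  "etrans_hcomp V b a = \<lparr>tsrc = emor_comp V (tsrc b) (tsrc a), ttgt = emor_comp V (ttgt b) (ttgt a),
     tcomp = (\<lambda>x\<in>eobj (msrc (tsrc a)). Comp (ucat (mtgt (tsrc b)))
       (FA (mfun (ttgt b)) (tcomp a x)) (tcomp b (FO (mfun (tsrc a)) x)))\<rparr>"

definition Cat_enriched :: "('p, 'b) cat \<Rightarrow> ('p, 'b) mon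
    \<Rightarrow> (('o, 'a, 'p, 'b) ecat, ('o, 'a, 'p, 'b) emor, ('o, 'a, 'p, 'b) etrans) two_cat" where
  "Cat_enriched V M =
     \<lparr>Cell0 = {E. enriched_category V M E \<and> ecat_normal E},
      Cell1 = {F. enriched_functor V M F \<and> emor_normal F},
      Cell2 = {a. enriched_trans V M a \<and> etrans_normal a},
      Src1 = msrc, Tgt1 = mtgt, Id1 = emor_id V, Comp1 = emor_comp V,
      Src2 = tsrc, Tgt2 = ttgt, Id2 = etrans_id,
      VComp = etrans_vcomp, HComp = etrans_hcomp V\<rparr>"


section \<open>Pushforward along a lax functor\<close>

text \<open>\<open>f\<close> is the lax functor with structure maps \<open>l\<close>, and \<open>V\<close> its target category.\<close>

definition push0 :: "('p, 'b, 'q, 'c) ftr \<Rightarrow> ('p list \<Rightarrow> 'c) \<Rightarrow> ('q, 'c) cat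
    \<Rightarrow> ('o, 'a, 'p, 'b) ecat \<Rightarrow> ('o, 'a, 'q, 'c) ecat" where
  "push0 f l V E = \<lparr>ucat = ucat E,
     ehom = \<lparr>FO = (\<lambda>(x, y)\<in>eobj E \<times> eobj E. FO f (hO E x y)),
             FA = (\<lambda>(g, h)\<in>earr E \<times> earr E. FA f (hA E g h))\<rparr>,
     eta = (\<lambda>x\<in>eobj E. Comp V (FA f (eta E x)) (l [])),
     mu = (\<lambda>(x, y, z)\<in>eobj E \<times> eobj E \<times> eobj E.
       Comp V (FA f (mu E (x, y, z))) (l [hO E y z, hO E x y]))\<rparr>"

definition push1 :: "('p, 'b, 'q, 'c) ftr \<Rightarrow> ('p list \<Rightarrow> 'c) \<Rightarrow> ('q, 'c) cat
    \<Rightarrow> ('o, 'a, 'p, 'b) emor \<Rightarrow> ('o, 'a, 'q, 'c) emor" where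
  "push1 f l V F = \<lparr>msrc = push0 f l V (msrc F), mtgt = push0 f l V (mtgt F), mfun = mfun F,
     mstr = (\<lambda>(x, y)\<in>eobj (msrc F) \<times> eobj (msrc F). FA f (mstr F (x, y)))\<rparr>"

definition push2 :: "('p, 'b, 'q, 'c) ftr \<Rightarrow> ('p list \<Rightarrow> 'c) \<Rightarrow> ('q, 'c) cat
    \<Rightarrow> ('o, 'a, 'p, 'b) etrans \<Rightarrow> ('o, 'a, 'q, 'c) etrans" where
  "push2 f l V a = \<lparr>tsrc = push1 f l V (tsrc a), ttgt = push1 f l V (ttgt a), tcomp = tcomp a\<rparr>"

definition pushforward where
  "pushforward f l V = \<lparr>F0 = push0 f l V, F1 = push1 f l V, F2 = push2 f l V\<rparr>"


section \<open>External product\<close>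

text \<open>
  The underlying categories of all objects of \<open>Cat_enriched V M\<close> live in a fixed pair of types
  \<open>'o, 'a\<close>, which play the role of a universe of small categories.  To form finite products
  inside this universe one fixes injections \<open>tupO :: 'o list \<Rightarrow> 'o\<close> and \<open>tupA :: 'a list \<Rightarrow> 'a\<close>
  encoding tuples (they exist precisely on infinite types).
\<close>

definition small_prod :: "('o list \<Rightarrow> 'o) \<Rightarrow> ('a list \<Rightarrow> 'a) \<Rightarrow> ('o, 'a) cat list \<Rightarrow> ('o, 'a) cat" where
  "small_prod tupO tupA Cs =
     (let Os = tupO ` {xs. list_all2 (\<lambda>C x. x \<in> Obj C) Cs xs};
          As = tupA ` {fs. list_all2 (\<lambda>C f. f \<in> Arr C) Cs fs};
          D = (\<lambda>f\<in>As. tupO (map2 Dom Cs (inv tupA f)));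
          R = (\<lambda>f\<in>As. tupO (map2 Cod Cs (inv tupA f)))
      in \<lparr>Obj = Os, Arr = As, Dom = D, Cod = R,
          Id = (\<lambda>x\<in>Os. tupA (map2 Id Cs (inv tupO x))),
          Comp = (\<lambda>g f. if f \<in> As \<and> g \<in> As \<and> D g = R f
             then tupA (map (\<lambda>i. Comp (Cs ! i) (inv tupA g ! i) (inv tupA f ! i)) [0..<length Cs])
             else undefined)\<rparr>)"

definition box0 :: "('o list \<Rightarrow> 'o) \<Rightarrow> ('a list \<Rightarrow> 'a)
    \<Rightarrow> ('o, 'a, 'p, 'b) ecat list \<Rightarrow> ('o, 'a, 'p list, 'b list) ecat" where
  "box0 tupO tupA Es =
     (let P = small_prod tupO tupA (map ucat Es);
          pr = (\<lambda>x i. inv tupO x ! i);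
          prA = (\<lambda>f i. inv tupA f ! i)
      in \<lparr>ucat = P,
          ehom = \<lparr>FO = (\<lambda>(x, y)\<in>Obj P \<times> Obj P. map (\<lambda>i. hO (Es ! i) (pr x i) (pr y i)) [0..<length Es]),
                  FA = (\<lambda>(f, g)\<in>Arr P \<times> Arr P. map (\<lambda>i. hA (Es ! i) (prA f i) (prA g i)) [0..<length Es])\<rparr>,
          eta = (\<lambda>x\<in>Obj P. map (\<lambda>i. eta (Es ! i) (pr x i)) [0..<length Es]),
          mu = (\<lambda>(x, y, z)\<in>Obj P \<times> Obj P \<times> Obj P.
            map (\<lambda>i. mu (Es ! i) (pr x i, pr y i, pr z i)) [0..<length Es])\<rparr>)"

definition box1 :: "('o list \<Rightarrow> 'o) \<Rightarrow> ('a list \<Rightarrow> 'a)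
    \<Rightarrow> ('o, 'a, 'p, 'b) emor list \<Rightarrow> ('o, 'a, 'p list, 'b list) emor" where
  "box1 tupO tupA Fs =
     (let S = box0 tupO tupA (map msrc Fs)
      in \<lparr>msrc = S, mtgt = box0 tupO tupA (map mtgt Fs),
          mfun = \<lparr>FO = (\<lambda>x\<in>eobj S. tupO (map2 (\<lambda>F. FO (mfun F)) Fs (inv tupO x))),
                  FA = (\<lambda>f\<in>earr S. tupA (map2 (\<lambda>F. FA (mfun F)) Fs (inv tupA f)))\<rparr>,
          mstr = (\<lambda>(x, y)\<in>eobj S \<times> eobj S.
            map (\<lambda>i. mstr (Fs ! i) (inv tupO x ! i, inv tupO y ! i)) [0..<length Fs])\<rparr>)"

definition box2 :: "('o list \<Rightarrow> 'o) \<Rightarrow> ('a list \<Rightarrow> 'a)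
    \<Rightarrow> ('o, 'a, 'p, 'b) etrans list \<Rightarrow> ('o, 'a, 'p list, 'b list) etrans" where
  "box2 tupO tupA as =
     (let S = box1 tupO tupA (map tsrc as)
      in \<lparr>tsrc = S, ttgt = box1 tupO tupA (map ttgt as),
          tcomp = (\<lambda>x\<in>eobj (msrc S). tupA (map2 tcomp as (inv tupO x)))\<rparr>)"

definition boxprod where
  "boxprod tupO tupA = \<lparr>F0 = box0 tupO tupA, F1 = box1 tupO tupA, F2 = box2 tupO tupA\<rparr>"


section \<open>The lax monoidal structure on enriched categories\<close>

definition times_lam where
  "times_lam tupO tupA D lam chi n = pushforward (tens lam) (chi n) D \<circ>\<^sub>2 boxprod tupO tupA"

text \<open>
  The rebracketing identification
  \<open>\<Prod>(Xs @ [\<Prod>Ys] @ Zs) \<cong> \<Prod>(Xs @ Ys @ Zs)\<close>, on encoded tuples; \<open>i\<close> is the position of the inner tuple.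
\<close>

definition flatten :: "('x list \<Rightarrow> 'x) \<Rightarrow> nat \<Rightarrow> 'x \<Rightarrow> 'x" where
  "flatten tup i x = (let xs = inv tup x
     in tup (take i xs @ inv tup (xs ! i) @ drop (Suc i) xs))"

text \<open>
  Modulo rebracketing this is \<open>t\<^sub>*\<close> at \<open>\<boxtimes>(Xs @ Ys @ Zs)\<close> for the structure transformation
  \<open>t : \<lambda>\<^sup>p(-, \<lambda>\<^sup>q, -) \<rightarrow> \<lambda>\<^sup>p\<^sup>+\<^sup>q\<close>: its structure maps are \<open>t\<close> at the hom objects of
  \<open>\<boxtimes>(Xs @ Ys @ Zs)\<close>.
\<close>

definition times_mult :: "('o list \<Rightarrow> 'o) \<Rightarrow> ('a list \<Rightarrow> 'a) \<Rightarrow> ('p, 'b) cat \<Rightarrow> ('p, 'b) mon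
    \<Rightarrow> (nat \<Rightarrow> 'p list list \<Rightarrow> 'b) \<Rightarrow> ('o, 'a, 'p, 'b) ecat list \<Rightarrow> ('o, 'a, 'p, 'b) ecat list
    \<Rightarrow> ('o, 'a, 'p, 'b) ecat list \<Rightarrow> ('o, 'a, 'p, 'b) emor" where
  "times_mult tupO tupA D lam chi Xs Ys Zs =
     (let T = (\<lambda>Es. F0 (times_lam tupO tupA D lam chi (length Es)) Es);
          i = length Xs;
          S = T (Xs @ [T Ys] @ Zs)
      in \<lparr>msrc = S, mtgt = T (Xs @ Ys @ Zs),
          mfun = \<lparr>FO = (\<lambda>x\<in>eobj S. flatten tupO i x), FA = (\<lambda>f\<in>earr S. flatten tupA i f)\<rparr>,
          mstr = (\<lambda>(x, y)\<in>eobj S \<times> eobj S. blocks i (length Ys) (dlt lam)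
            (hO (box0 tupO tupA (Xs @ Ys @ Zs)) (flatten tupO i x) (flatten tupO i y)))\<rparr>)"

text \<open>Likewise for \<open>Id \<rightarrow> \<lambda>\<^sup>0\<close>, modulo the identification of \<open>X\<close> with its 1-ary product.\<close>

definition times_unit :: "('o list \<Rightarrow> 'o) \<Rightarrow> ('a list \<Rightarrow> 'a) \<Rightarrow> ('p, 'b) cat \<Rightarrow> ('p, 'b) mon
    \<Rightarrow> (nat \<Rightarrow> 'p list list \<Rightarrow> 'b) \<Rightarrow> ('o, 'a, 'p, 'b) ecat \<Rightarrow> ('o, 'a, 'p, 'b) emor" where
  "times_unit tupO tupA D lam chi X =
     \<lparr>msrc = X, mtgt = F0 (times_lam tupO tupA D lam chi 1) [X],
      mfun = \<lparr>FO = (\<lambda>x\<in>eobj X. tupO [x]), FA = (\<lambda>f\<in>earr X. tupA [f])\<rparr>,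
      mstr = (\<lambda>(x, y)\<in>eobj X \<times> eobj X. cnt lam (hO X x y))\<rparr>"

end

(* The lax functors lambda^n : D^n -> D, with structure maps chi, push the external product of
   D-enriched categories forward to a D-enriched category, so each operation is a composite of two
   2-functors.  A structure transformation of lambda acts on hom objects; it is compatible with the
   units and the compositions exactly because omega^(-1) and omega^1 are oplax functors for lambda,
   i.e. by the axioms for chi with zero and with two rows.  All remaining axioms hold componentwise,
   by those of lambda on hom objects and by concatenation of tuples on the underlying categories. *)

theory Submission
  imports Defs
begin

section \<open>Categories and functors in terms of domains and codomains\<close>

text \<open>The axioms of a lax monoid are strict equations, whereas an encoded tuple with an inner
  tuple and the concatenated tuple are different elements of one type. Hence the comparison 1-cells
  cannot be identities on underlying categories: they flatten codes, and their coherence on objects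
  and arrows is associativity of concatenation. Strict equality is also why every cell is kept
  undefined off its domain: equality of 1-cells then reduces to agreement on objects, arrows and
  pairs of objects, and each pair contributes one equation between structure maps in
  \<open>D\<close>. Units and compositions need the same compatibility, so it is proved once for
  columns of arbitrary height \<open>m\<close> (\<open>chi_nested\<close>): naturality of the
  multiplication of \<open>lam\<close> moves it past a list of arrows, and the comultiplication
  axiom of the oplax functor \<open>om\<close> on \<open>m\<close>-tuples moves it past
  \<open>chi\<close>. Likewise one identity for a lax functor (\<open>l_nested\<close>) serves
  associativity and both unit laws of a pushforward. The componentwise structure on
  \<open>D^n\<close> is not constructed anew: it is known to be oplax monoidal as the source of the
  lax functor given by \<open>chi n\<close>.\<close>

lemma homI: "\<lbrakk>f \<in> Arr C; Dom C f = x; Cod C f = y\<rbrakk> \<Longrightarrow> f \<in>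
    hom C x y"
  by (simp add: hom_def)

context category
begin

lemmas dom_obj [simp] and cod_obj [simp]

text \<open>Membership in \<open>Arr C\<close> together with equations for \<open>Dom\<close> and
  \<open>Cod\<close> replaces \<open>hom\<close>, whose two endpoints would have to be guessed
  whenever a typing condition is discharged.\<close>

lemma id_arr [simp]: "x \<in> Obj C \<Longrightarrow> Id C x \<in> Arr C"
  and id_dom [simp]: "x \<in> Obj C \<Longrightarrow> Dom C (Id C x) = x"
  and id_cod [simp]: "x \<in> Obj C \<Longrightarrow> Cod C (Id C x) = x"
  using id_hom by (auto simp: hom_def)

lemma comp_arr [simp]: "\<lbrakk>f \<in> Arr C; g \<in> Arr C; Dom C g = Cod C f\<rbrakk>
    \<Longrightarrow> g \<cdot> f \<in> Arr C"
  and comp_dom [simp]: "\<lbrakk>f \<in> Arr C; g \<in> Arr C; Dom C g = Cod C f\<rbrakk>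
      \<Longrightarrow> Dom C (g \<cdot> f) = Dom C f"
  and comp_cod [simp]: "\<lbrakk>f \<in> Arr C; g \<in> Arr C; Dom C g = Cod C f\<rbrakk>
      \<Longrightarrow> Cod C (g \<cdot> f) = Cod C g"
  using comp_hom[of f "Dom C f" "Cod C f" g "Cod C g"] by (auto simp: hom_def)

lemma comp_id_left [simp]: "\<lbrakk>f \<in> Arr C; Cod C f = y\<rbrakk> \<Longrightarrow> Id C y
    \<cdot> f = f"
  and comp_id_right [simp]: "\<lbrakk>f \<in> Arr C; Dom C f = x\<rbrakk> \<Longrightarrow> f
      \<cdot> Id C x = f"
  using id_left[of f] id_right[of f] by (auto simp: hom_def)

lemma assoc [simp]: "\<lbrakk>f \<in> Arr C; g \<in> Arr C; h \<in> Arr C; Dom C g = Cod C f; Dom C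
    h = Cod C g\<rbrakk>
    \<Longrightarrow> (h \<cdot> g) \<cdot> f = h \<cdot> (g \<cdot> f)"
  using comp_assoc[of f "Dom C f" "Cod C f" g "Cod C g" h "Cod C h"] by (auto simp: hom_def)

text \<open>Composites are normalised to right-nested form, where a known equation for
  \<open>g\<close> after \<open>f\<close> is hidden by the remaining factor \<open>k\<close>; this
  version rewrites the head of such a chain.\<close>

lemma comp_extend: "\<lbrakk>g \<cdot> f = h; f \<in> Arr C; g \<in> Arr C; k \<in> Arr C; Dom C g
    = Cod C f; Dom C f = Cod C k\<rbrakk>
    \<Longrightarrow> g \<cdot> (f \<cdot> k) = h \<cdot> k"
  using assoc[of k f g] by simp

lemma category: "category C" ..

end

lemma categoryI:
  assumes "\<And>f. f \<in> Arr C \<Longrightarrow> Dom C f \<in> Obj C" "\<And>f. f \<in> Arr C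
      \<Longrightarrow> Cod C f \<in> Obj C"
    and "\<And>x. x \<in> Obj C \<Longrightarrow> Id C x \<in> Arr C \<and> Dom C (Id C x) = x
        \<and> Cod C (Id C x) = x"
    and "\<And>f g. \<lbrakk>f \<in> Arr C; g \<in> Arr C; Dom C g = Cod C f\<rbrakk>
        \<Longrightarrow>
      Comp C g f \<in> Arr C \<and> Dom C (Comp C g f) = Dom C f \<and> Cod C (Comp C g f) = Cod C
          g"
    and "\<And>f. f \<in> Arr C \<Longrightarrow> Comp C (Id C (Cod C f)) f = f"
    and "\<And>f. f \<in> Arr C \<Longrightarrow> Comp C f (Id C (Dom C f)) = f"
    and "\<And>f g h. \<lbrakk>f \<in> Arr C; g \<in> Arr C; h \<in> Arr C; Dom C g = Cod C f; Dom
        C h = Cod C g\<rbrakk> \<Longrightarrow>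
      Comp C (Comp C h g) f = Comp C h (Comp C g f)"
  shows "category C"
  using assms by unfold_locales (auto simp: hom_def)

section \<open>Opposite, product and power categories\<close>

lemma op_cat_simps [simp]:
  "Obj (op_cat C) = Obj C" "Arr (op_cat C) = Arr C" "Dom (op_cat C) = Cod C"
  "Cod (op_cat C) = Dom C" "Id (op_cat C) = Id C" "Comp (op_cat C) g f = Comp C f g"
  by (simp_all add: op_cat_def)

lemma op_op_cat [simp]: "op_cat (op_cat C) = C"
  by (simp add: op_cat_def)

lemma hom_op [simp]: "hom (op_cat C) x y = hom C y x"
  by (auto simp: hom_def)

lemma category_op: "category C \<Longrightarrow> category (op_cat C)"
proof -
  assume "category C"
  then interpret category C .
  show ?thesis by (rule categoryI) auto
qed

lemma prod_cat_simps [simp]: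
  "Obj (prod_cat A B) = Obj A \<times> Obj B" "Arr (prod_cat A B) = Arr A \<times> Arr B"
  "Dom (prod_cat A B) = map_prod (Dom A) (Dom B)" "Cod (prod_cat A B) = map_prod (Cod A) (Cod B)"
  "Id (prod_cat A B) = map_prod (Id A) (Id B)"
  "Comp (prod_cat A B) (g, g') (f, f') = (Comp A g f, Comp B g' f')"
  by (simp_all add: prod_cat_def)

lemma category_prod: "category A \<Longrightarrow> category B \<Longrightarrow> category (prod_cat
    A B)"
proof -
  assume "category A" "category B"
  then interpret A: category A + B: category B .
  show ?thesis by (rule categoryI) auto
qed

lemma pow_cat_simps [simp]:
  "Obj (pow_cat n C) = lists_of n (Obj C)" "Arr (pow_cat n C) = lists_of n (Arr C)"
  "Dom (pow_cat n C) = map (Dom C)" "Cod (pow_cat n C) = map (Cod C)" "Id (pow_cat n C) = map (Id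
      C)"
  "Comp (pow_cat n C) = map2 (Comp C)"
  by (simp_all add: pow_cat_def)

lemma lists_of_iff [simp]: "xs \<in> lists_of n A \<longleftrightarrow> length xs = n \<and> set xs
    \<subseteq> A"
  by (simp add: lists_of_def)

lemma set_subset_nth: "set xs \<subseteq> A \<longleftrightarrow> (\<forall>i<length xs. xs ! i
    \<in> A)"
  by (auto simp: in_set_conv_nth subset_iff)

lemma lists_of_nth: "xs \<in> lists_of n A \<longleftrightarrow> length xs = n \<and>
    (\<forall>i<n. xs ! i \<in> A)"
  using set_subset_nth[of xs A] by auto

lemma map_eq_nth: "map f xs = map g ys \<longleftrightarrow> length xs = length ys \<and>
    (\<forall>i<length xs. f (xs ! i) = g (ys ! i))"
  by (auto simp: list_eq_iff_nth_eq)

lemma category_pow: "category C \<Longrightarrow> category (pow_cat n C)"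
proof -
  assume "category C"
  then interpret category C .
  show ?thesis
    by (rule categoryI) (auto simp: lists_of_nth map_eq_nth list_eq_iff_nth_eq simp del:
        lists_of_iff)
qed

section \<open>Functors and natural transformations, with the cutting of lists into three
  pieces\<close>

context cat_functor
begin

lemma FO_obj [simp]: "x \<in> Obj A \<Longrightarrow> FO F x \<in> Obj B"
  by (rule obj)

lemma FA_arr [simp]: "f \<in> Arr A \<Longrightarrow> FA F f \<in> Arr B"
  and FA_dom [simp]: "f \<in> Arr A \<Longrightarrow> Dom B (FA F f) = FO F (Dom A f)"
  and FA_cod [simp]: "f \<in> Arr A \<Longrightarrow> Cod B (FA F f) = FO F (Cod A f)"
  using arr[of f "Dom A f" "Cod A f"] by (auto simp: hom_def)

lemmas FA_id [simp] = pres_id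

lemma FA_comp: "\<lbrakk>f \<in> Arr A; g \<in> Arr A; Dom A g = Cod A f\<rbrakk>
    \<Longrightarrow> FA F (Comp A g f) = Comp B (FA F g) (FA F f)"
  using pres_comp[of f "Dom A f" "Cod A f" g "Cod A g"] by (auto simp: hom_def)

lemma cat_functor: "cat_functor A B F" ..

end

lemma cat_functorI:
  assumes "category A" "category B"
    and "\<And>x. x \<in> Obj A \<Longrightarrow> FO F x \<in> Obj B"
    and "\<And>f. f \<in> Arr A \<Longrightarrow> FA F f \<in> hom B (FO F (Dom A f)) (FO F (Cod A
        f))"
    and "\<And>x. x \<in> Obj A \<Longrightarrow> FA F (Id A x) = Id B (FO F x)"
    and "\<And>f g. \<lbrakk>f \<in> Arr A; g \<in> Arr A; Dom A g = Cod A f\<rbrakk>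
      \<Longrightarrow> FA F (Comp A g f) = Comp B (FA F g) (FA F f)"
  shows "cat_functor A B F"
  using assms by (auto intro!: cat_functor.intro cat_functor_axioms.intro simp: hom_def)

lemma nat_transI:
  assumes "cat_functor A B F" "cat_functor A B G"
    and "\<And>x. x \<in> Obj A \<Longrightarrow> t x \<in> hom B (FO F x) (FO G x)"
    and "\<And>f. f \<in> Arr A \<Longrightarrow> Comp B (FA G f) (t (Dom A f)) = Comp B (t (Cod A
        f)) (FA F f)"
  shows "nat_trans A B F G t"
  using assms by (auto intro!: nat_trans.intro nat_trans_axioms.intro simp: hom_def)

context nat_trans
begin

lemma t_arr [simp]: "x \<in> Obj A \<Longrightarrow> t x \<in> Arr B"
  and t_dom [simp]: "x \<in> Obj A \<Longrightarrow> Dom B (t x) = FO F x"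
  and t_cod [simp]: "x \<in> Obj A \<Longrightarrow> Cod B (t x) = FO G x"
  using component by (auto simp: hom_def)

lemma natural: "f \<in> Arr A \<Longrightarrow> Comp B (FA G f) (t (Dom A f)) = Comp B (t (Cod A
    f)) (FA F f)"
  using naturality[of f] by (auto simp: hom_def)

end

lemma ftr_comp_simps [simp]: "FO (ftr_comp G F) x = FO G (FO F x)" "FA (ftr_comp G F) f = FA G (FA
    F f)"
  by (simp_all add: ftr_comp_def)

lemma ftr_pow_simps [simp]: "FO (ftr_pow F) = map (FO F)" "FA (ftr_pow F) = map (FA F)"
  by (simp_all add: ftr_pow_def)

lemma cat_functor_comp:
  "cat_functor A B F \<Longrightarrow> cat_functor B C G \<Longrightarrow> cat_functor A C
      (ftr_comp G F)"
proof -
  assume "cat_functor A B F" "cat_functor B C G"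
  then interpret F: cat_functor A B F + G: cat_functor B C G .
  show ?thesis
    by (rule cat_functorI) (auto simp: F.FA_comp G.FA_comp intro: homI F.A.category G.B.category)
qed

lemma blocks_append [simp]: "length xs = i \<Longrightarrow> length ys = k \<Longrightarrow> blocks
    i k h (xs @ ys @ zs) = h xs ys zs"
  by (simp add: blocks_def)

text \<open>Every argument of the right length is a concatenation of three pieces, so a function
  built with \<open>blocks\<close> can be treated as a function of three lists through
  \<open>blocks_append\<close>.\<close>

lemma list_blocks:
  assumes "length ws = i + k + j"
  obtains xs ys zs where "ws = xs @ ys @ zs" "length xs = i" "length ys = k" "length zs = j"
proof
  show "ws = take i ws @ take k (drop i ws) @ drop (i + k) ws"
    by (metis append_take_drop_id drop_drop add.commute)
qed (use assms in auto)

lemma map2_append [simp]: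
  "length xs = length ys \<Longrightarrow> map2 f (xs @ xs') (ys @ ys') = map2 f xs ys @ map2 f xs'
      ys'"
  by simp

section \<open>Oplax and lax monoidal categories\<close>

context oplax_monoidal
begin

lemma tO_obj [simp]: "set xs \<subseteq> Obj C \<Longrightarrow> tO M xs \<in> Obj C"
  using cat_functor.FO_obj[OF tens_functor, of xs "length xs"] by simp

lemma tA_arr [simp]: "set fs \<subseteq> Arr C \<Longrightarrow> tA M fs \<in> Arr C"
  and tA_dom [simp]: "set fs \<subseteq> Arr C \<Longrightarrow> Dom C (tA M fs) = tO M (map (Dom
      C) fs)"
  and tA_cod [simp]: "set fs \<subseteq> Arr C \<Longrightarrow> Cod C (tA M fs) = tO M (map (Cod
      C) fs)"
  using cat_functor.FA_arr[OF tens_functor, of fs "length fs"]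
    cat_functor.FA_dom[OF tens_functor, of fs "length fs"]
    cat_functor.FA_cod[OF tens_functor, of fs "length fs"] by auto

lemma tA_id: "set xs \<subseteq> Obj C \<Longrightarrow> tA M (map (Id C) xs) = Id C (tO M xs)"
  using cat_functor.FA_id[OF tens_functor, of xs "length xs"] by auto

lemma tA_comp: "\<lbrakk>set fs \<subseteq> Arr C; set gs \<subseteq> Arr C; map (Dom C) gs = map
    (Cod C) fs\<rbrakk>
    \<Longrightarrow> tA M gs \<cdot> tA M fs = tA M (map2 (Comp C) gs fs)"
  using cat_functor.FA_comp[OF tens_functor, of fs "length fs" gs]
    map_eq_imp_length_eq[of "Dom C" gs "Cod C" fs] by simp

lemma dlt_arr [simp]: "set (xs @ ys @ zs) \<subseteq> Obj C \<Longrightarrow> dlt M xs ys zs \<in>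
    Arr C"
  and dlt_dom [simp]: "set (xs @ ys @ zs) \<subseteq> Obj C \<Longrightarrow> Dom C (dlt M xs ys
      zs) = tO M (xs @ ys @ zs)"
  and dlt_cod [simp]: "set (xs @ ys @ zs) \<subseteq> Obj C \<Longrightarrow> Cod C (dlt M xs ys
      zs) = tO M (xs @ [tO M ys] @ zs)"
  using nat_trans.component[OF dlt_natural, of "xs @ ys @ zs" "length xs" "length ys" "length zs"]
  by (auto simp: nest_def hom_def)

lemma dlt_nat: "set (fs @ gs @ hs) \<subseteq> Arr C \<Longrightarrow>
    tA M (fs @ [tA M gs] @ hs) \<cdot> dlt M (map (Dom C) fs) (map (Dom C) gs) (map (Dom C) hs)
    = dlt M (map (Cod C) fs) (map (Cod C) gs) (map (Cod C) hs) \<cdot> tA M (fs @ gs @ hs)"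
  using nat_trans.natural[OF dlt_natural, of "fs @ gs @ hs" "length fs" "length gs" "length hs"]
  by (simp add: nest_def)

lemma cnt_arr [simp]: "x \<in> Obj C \<Longrightarrow> cnt M x \<in> Arr C"
  and cnt_dom [simp]: "x \<in> Obj C \<Longrightarrow> Dom C (cnt M x) = tO M [x]"
  and cnt_cod [simp]: "x \<in> Obj C \<Longrightarrow> Cod C (cnt M x) = x"
  using nat_trans.component[OF cnt_natural, of x] by (auto simp: hom_def)

lemma cnt_nat: "f \<in> Arr C \<Longrightarrow> f \<cdot> cnt M (Dom C f) = cnt M (Cod C f) \<cdot>
    tA M [f]"
  using nat_trans.natural[OF cnt_natural, of f] by simp

lemma tA_comp2: "\<lbrakk>f \<in> Arr C; g \<in> Arr C; f' \<in> Arr C; g' \<in> Arr C; Dom C g =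
    Cod C f; Dom C g' = Cod C f'\<rbrakk>
    \<Longrightarrow> tA M [g, g'] \<cdot> tA M [f, f'] = tA M [g \<cdot> f, g' \<cdot> f']"
  using tA_comp[of "[f, f']" "[g, g']"] by simp

lemma tA_id2: "x \<in> Obj C \<Longrightarrow> y \<in> Obj C \<Longrightarrow> tA M [Id C x, Id C
    y] = Id C (tO M [x, y])"
  using tA_id[of "[x, y]"] by simp

lemma oplax_monoidal: "oplax_monoidal C M" ..

end

text \<open>A lax structure is defined on \<open>op_cat C\<close>, where endpoints and composites
  are reversed. The rules below restate it with the composition of \<open>C\<close>:
  \<open>dlt L\<close> goes from the nested to the flat product, and \<open>cnt L\<close> from
  \<open>x\<close> to the unary product.\<close>

locale lax_monoidal_category = category C + op: oplax_monoidal "op_cat C" L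
  for C :: "('o, 'a) cat" (structure) and L :: "('o, 'a) mon"
begin

lemma tO_obj [simp]: "set xs \<subseteq> Obj C \<Longrightarrow> tO L xs \<in> Obj C"
  using op.tO_obj by simp

lemma tA_arr [simp]: "set fs \<subseteq> Arr C \<Longrightarrow> tA L fs \<in> Arr C"
  and tA_dom [simp]: "set fs \<subseteq> Arr C \<Longrightarrow> Dom C (tA L fs) = tO L (map (Dom
      C) fs)"
  and tA_cod [simp]: "set fs \<subseteq> Arr C \<Longrightarrow> Cod C (tA L fs) = tO L (map (Cod
      C) fs)"
  using op.tA_arr op.tA_dom op.tA_cod by simp_all

lemma tA_id: "set xs \<subseteq> Obj C \<Longrightarrow> tA L (map (Id C) xs) = Id C (tO L xs)"
  using op.tA_id by simp

lemma tA_comp: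
  assumes "set fs \<subseteq> Arr C" "set gs \<subseteq> Arr C" "map (Dom C) gs = map (Cod C) fs"
  shows "tA L gs \<cdot> tA L fs = tA L (map2 (Comp C) gs fs)"
proof -
  have "length gs = length fs" using assms(3) by (rule map_eq_imp_length_eq)
  \<comment> \<open>Composition in \<open>op_cat C\<close> takes its arguments in the other order,
    so the two lists change places.\<close>
  then have "map2 (Comp (op_cat C)) fs gs = map2 (Comp C) gs fs"
    by (auto simp: list_eq_iff_nth_eq)
  then show ?thesis using op.tA_comp[of gs fs] assms by simp
qed

lemma dlt_arr [simp]: "set (xs @ ys @ zs) \<subseteq> Obj C \<Longrightarrow> dlt L xs ys zs \<in>
    Arr C"
  and dlt_dom [simp]: "set (xs @ ys @ zs) \<subseteq> Obj C \<Longrightarrow> Dom C (dlt L xs ys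
      zs) = tO L (xs @ [tO L ys] @ zs)"
  and dlt_cod [simp]: "set (xs @ ys @ zs) \<subseteq> Obj C \<Longrightarrow> Cod C (dlt L xs ys
      zs) = tO L (xs @ ys @ zs)"
  using op.dlt_arr op.dlt_dom op.dlt_cod by simp_all

lemma dlt_nat: "set (fs @ gs @ hs) \<subseteq> Arr C \<Longrightarrow>
    tA L (fs @ gs @ hs) \<cdot> dlt L (map (Dom C) fs) (map (Dom C) gs) (map (Dom C) hs)
    = dlt L (map (Cod C) fs) (map (Cod C) gs) (map (Cod C) hs) \<cdot> tA L (fs @ [tA L gs] @ hs)"
  using op.dlt_nat[of fs gs hs] by simp

lemma cnt_arr [simp]: "x \<in> Obj C \<Longrightarrow> cnt L x \<in> Arr C"
  and cnt_dom [simp]: "x \<in> Obj C \<Longrightarrow> Dom C (cnt L x) = x"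
  and cnt_cod [simp]: "x \<in> Obj C \<Longrightarrow> Cod C (cnt L x) = tO L [x]"
  using op.cnt_arr op.cnt_dom op.cnt_cod by simp_all

lemma cnt_nat: "f \<in> Arr C \<Longrightarrow> tA L [f] \<cdot> cnt L (Dom C f) = cnt L (Cod C f)
    \<cdot> f"
  using op.cnt_nat[of f] by simp

lemma unit_outer: "set xs \<subseteq> Obj C \<Longrightarrow> dlt L [] xs [] \<cdot> cnt L (tO L
    xs) = Id C (tO L xs)"
  using op.counit_outer[of xs] by simp

lemma unit_inner: "set (xs @ [y] @ zs) \<subseteq> Obj C \<Longrightarrow>
    dlt L xs [y] zs \<cdot> tA L (map (Id C) xs @ [cnt L y] @ map (Id C) zs) = Id C (tO L (xs @ [y]
        @ zs))"
  using op.counit_inner[of xs y zs] by simp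

lemma assoc_parallel: "set (xs @ us @ ys @ vs @ zs) \<subseteq> Obj C \<Longrightarrow>
    dlt L xs us (ys @ vs @ zs) \<cdot> dlt L (xs @ [tO L us] @ ys) vs zs
    = dlt L (xs @ us @ ys) vs zs \<cdot> dlt L xs us (ys @ [tO L vs] @ zs)"
  using op.coassoc_parallel[of xs us ys vs zs] by simp

lemma assoc_nested: "set (xs @ us @ vs @ ws @ zs) \<subseteq> Obj C \<Longrightarrow>
    dlt L xs (us @ vs @ ws) zs \<cdot> tA L (map (Id C) xs @ [dlt L us vs ws] @ map (Id C) zs)
    = dlt L (xs @ us) vs (ws @ zs) \<cdot> dlt L xs (us @ [tO L vs] @ ws) zs"
  using op.coassoc_nested[of xs us vs ws zs] by simp

end

lemma lax_monoidal_categoryI: "lax_monoidal C L \<Longrightarrow> lax_monoidal_category C L"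
proof (rule lax_monoidal_category.intro)
  assume "lax_monoidal C L"
  then interpret oplax_monoidal "op_cat C" L .
  show "category C" using category_op[OF category] by simp
qed

context lax_functor
begin

lemma l_arr [simp]: "set xs \<subseteq> Obj A \<Longrightarrow> l xs \<in> Arr B"
  and l_dom [simp]: "set xs \<subseteq> Obj A \<Longrightarrow> Dom B (l xs) = tO N (map (FO F) xs)"
  and l_cod [simp]: "set xs \<subseteq> Obj A \<Longrightarrow> Cod B (l xs) = FO F (tO M xs)"
  using nat_trans.component[OF lax_natural, of xs "length xs"] by (auto simp: hom_def)

lemma l_nat: "set fs \<subseteq> Arr A \<Longrightarrow>
    Comp B (FA F (tA M fs)) (l (map (Dom A) fs)) = Comp B (l (map (Cod A) fs)) (tA N (map (FA F)
        fs))"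
  using nat_trans.natural[OF lax_natural, of fs "length fs"] by simp

end

section \<open>Enriched categories, functors and transformations\<close>

context enriched_category
begin

lemma hO_obj [simp]: "x \<in> eobj E \<Longrightarrow> y \<in> eobj E \<Longrightarrow> hO E x y
    \<in> Obj V"
  using cat_functor.FO_obj[OF hom_functor, of "(x, y)"] by simp

lemma hA_arr [simp]: "f \<in> earr E \<Longrightarrow> h \<in> earr E \<Longrightarrow> hA E f h
    \<in> Arr V"
  and hA_dom [simp]: "f \<in> earr E \<Longrightarrow> h \<in> earr E \<Longrightarrow>
    Dom V (hA E f h) = hO E (Cod (ucat E) f) (Dom (ucat E) h)"
  and hA_cod [simp]: "f \<in> earr E \<Longrightarrow> h \<in> earr E \<Longrightarrow>
    Cod V (hA E f h) = hO E (Dom (ucat E) f) (Cod (ucat E) h)"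
  using cat_functor.FA_arr[OF hom_functor, of "(f, h)"] cat_functor.FA_dom[OF hom_functor, of "(f,
      h)"]
    cat_functor.FA_cod[OF hom_functor, of "(f, h)"] by simp_all

lemma hA_id [simp]: "x \<in> eobj E \<Longrightarrow> y \<in> eobj E \<Longrightarrow> hA E (eid E
    x) (eid E y) = Id V (hO E x y)"
  using cat_functor.FA_id[OF hom_functor, of "(x, y)"] by simp

text \<open>The first variable is contravariant, so \<open>f'\<close> acts before \<open>f\<close>,
  while \<open>h\<close> acts before \<open>h'\<close>.\<close>

lemma hA_comp: "\<lbrakk>f \<in> earr E; h \<in> earr E; f' \<in> earr E; h' \<in> earr E;
    Dom (ucat E) f' = Cod (ucat E) f; Dom (ucat E) h' = Cod (ucat E) h\<rbrakk> \<Longrightarrow>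
    hA E (Comp (ucat E) f' f) (Comp (ucat E) h' h) = hA E f h' \<cdot> hA E f' h"
  using cat_functor.FA_comp[OF hom_functor, of "(f', h)" "(f, h')"] by simp

lemma hA_comp_left: "\<lbrakk>f \<in> earr E; f' \<in> earr E; y \<in> eobj E; Dom (ucat E) f' =
    Cod (ucat E) f\<rbrakk> \<Longrightarrow>
    hA E (Comp (ucat E) f' f) (eid E y) = hA E f (eid E y) \<cdot> hA E f' (eid E y)"
  using hA_comp[of f "eid E y" f' "eid E y"] ucat_category by (simp add: category.comp_id_left
    category.id_arr category.id_dom category.id_cod)

lemma hA_comp_right: "\<lbrakk>h \<in> earr E; h' \<in> earr E; x \<in> eobj E; Dom (ucat E) h' =
    Cod (ucat E) h\<rbrakk> \<Longrightarrow>
    hA E (eid E x) (Comp (ucat E) h' h) = hA E (eid E x) h' \<cdot> hA E (eid E x) h"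
  using hA_comp[of "eid E x" h "eid E x" h'] ucat_category by (simp add: category.comp_id_left
    category.id_arr category.id_dom category.id_cod)

text \<open>Both sides are \<open>hA E f h\<close>: the hom bifunctor may act in its two variables
  in either order.\<close>

lemma hA_swap: "\<lbrakk>f \<in> hom (ucat E) x' x; h \<in> hom (ucat E) y y'\<rbrakk>
    \<Longrightarrow>
    hA E f (eid E y') \<cdot> hA E (eid E x) h = hA E (eid E x') h \<cdot> hA E f (eid E y)"
  using hA_comp[of f h "eid E x" "eid E y'"] hA_comp[of "eid E x'" "eid E y" f h] ucat_category
  by (auto simp: hom_def category.comp_id_left category.comp_id_right category.dom_obj
    category.cod_obj category.id_arr category.id_dom category.id_cod)

lemma eta_arr [simp]: "x \<in> eobj E \<Longrightarrow> eta E x \<in> Arr V"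
  and eta_dom [simp]: "x \<in> eobj E \<Longrightarrow> Dom V (eta E x) = tO M []"
  and eta_cod [simp]: "x \<in> eobj E \<Longrightarrow> Cod V (eta E x) = hO E x x"
  using eta_hom by (auto simp: hom_def)

lemma mu_arr [simp]: "\<lbrakk>x \<in> eobj E; y \<in> eobj E; z \<in> eobj E\<rbrakk>
    \<Longrightarrow> mu E (x, y, z) \<in> Arr V"
  and mu_dom [simp]: "\<lbrakk>x \<in> eobj E; y \<in> eobj E; z \<in> eobj E\<rbrakk>
      \<Longrightarrow>
    Dom V (mu E (x, y, z)) = tO M [hO E y z, hO E x y]"
  and mu_cod [simp]: "\<lbrakk>x \<in> eobj E; y \<in> eobj E; z \<in> eobj E\<rbrakk>
      \<Longrightarrow> Cod V (mu E (x, y, z)) = hO E x z"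
  using mu_hom by (auto simp: hom_def)

lemma enriched_category: "enriched_category V M E" ..

end

context enriched_functor
begin

lemma str_arr [simp]: "\<lbrakk>x \<in> eobj (msrc F); y \<in> eobj (msrc F)\<rbrakk>
    \<Longrightarrow> mstr F (x, y) \<in> Arr V"
  and str_dom [simp]: "\<lbrakk>x \<in> eobj (msrc F); y \<in> eobj (msrc F)\<rbrakk>
      \<Longrightarrow>
    Dom V (mstr F (x, y)) = hO (msrc F) x y"
  and str_cod [simp]: "\<lbrakk>x \<in> eobj (msrc F); y \<in> eobj (msrc F)\<rbrakk>
      \<Longrightarrow>
    Cod V (mstr F (x, y)) = hO (mtgt F) (FO (mfun F) x) (FO (mfun F) y)"
  using nat_trans.component[OF str_natural, of "(x, y)"] by (auto simp: hom_def)

lemma str_nat: "\<lbrakk>f \<in> hom (ucat (msrc F)) x' x; h \<in> hom (ucat (msrc F)) y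
    y'\<rbrakk> \<Longrightarrow>
    hA (mtgt F) (FA (mfun F) f) (FA (mfun F) h) \<cdot> mstr F (x, y) = mstr F (x', y') \<cdot> hA
        (msrc F) f h"
  using nat_trans.natural[OF str_natural, of "(f, h)"] by (simp add: hom_def)

lemma enriched_functor: "enriched_functor V M F" ..

end

text \<open>Naturality over the product of the opposite category with the category is replaced by
  its squares for single pairs of arrows, the form in which it is checked for concrete
  families.\<close>

lemma enriched_functorI:
  assumes "enriched_category V M (msrc F)" "enriched_category V M (mtgt F)"
    and F: "cat_functor (ucat (msrc F)) (ucat (mtgt F)) (mfun F)"
    and "\<And>x y. \<lbrakk>x \<in> eobj (msrc F); y \<in> eobj (msrc F)\<rbrakk> \<Longrightarrow>
      mstr F (x, y) \<in> hom V (hO (msrc F) x y) (hO (mtgt F) (FO (mfun F) x) (FO (mfun F) y))"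
    and "\<And>f h x x' y y'. \<lbrakk>f \<in> hom (ucat (msrc F)) x' x; h \<in> hom (ucat (msrc
        F)) y y'\<rbrakk> \<Longrightarrow>
      Comp V (hA (mtgt F) (FA (mfun F) f) (FA (mfun F) h)) (mstr F (x, y))
      = Comp V (mstr F (x', y')) (hA (msrc F) f h)"
    and "\<And>x. x \<in> eobj (msrc F) \<Longrightarrow>
      Comp V (mstr F (x, x)) (eta (msrc F) x) = eta (mtgt F) (FO (mfun F) x)"
    and "\<And>x y z. \<lbrakk>x \<in> eobj (msrc F); y \<in> eobj (msrc F); z \<in> eobj (msrc
        F)\<rbrakk> \<Longrightarrow>
      Comp V (mstr F (x, z)) (mu (msrc F) (x, y, z))
      = Comp V (mu (mtgt F) (FO (mfun F) x, FO (mfun F) y, FO (mfun F) z))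
          (tA M [mstr F (y, z), mstr F (x, y)])"
  shows "enriched_functor V M F"
proof -
  interpret S: enriched_category V M "msrc F" by fact
  interpret T: enriched_category V M "mtgt F" by fact
  interpret F: cat_functor "ucat (msrc F)" "ucat (mtgt F)" "mfun F" by fact
  let ?P = "prod_cat (op_cat (ucat (msrc F))) (ucat (msrc F))"
  let ?FF = "\<lparr>FO = map_prod (FO (mfun F)) (FO (mfun F)), FA = map_prod (FA (mfun F)) (FA
      (mfun F))\<rparr>"
  have FF: "cat_functor ?P (prod_cat (op_cat (ucat (mtgt F))) (ucat (mtgt F))) ?FF"
    by (rule cat_functorI) (auto simp: F.FA_comp intro!: homI category_prod category_op
        F.A.category F.B.category)
  have "nat_trans ?P V (ehom (msrc F)) (ftr_comp (ehom (mtgt F)) ?FF) (mstr F)"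
    using assms(4,5)
    by (intro nat_transI S.hom_functor cat_functor_comp[OF FF T.hom_functor]) (auto simp: hom_def)
  then show ?thesis
    by (intro enriched_functor.intro enriched_functor_axioms.intro assms)
qed

context enriched_trans
begin

lemma tcomp_hom: "x \<in> eobj (msrc (tsrc a)) \<Longrightarrow>
    tcomp a x \<in> hom (ucat (mtgt (tsrc a))) (FO (mfun (tsrc a)) x) (FO (mfun (ttgt a)) x)"
  by (rule component)

lemma enriched_trans: "enriched_trans V M a" ..

end

lemma enriched_transI:
  assumes S: "enriched_functor V M (tsrc a)" and T: "enriched_functor V M (ttgt a)"
    and par: "msrc (ttgt a) = msrc (tsrc a)" "mtgt (ttgt a) = mtgt (tsrc a)"
    and comp: "\<And>x. x \<in> eobj (msrc (tsrc a)) \<Longrightarrow>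
      tcomp a x \<in> hom (ucat (mtgt (tsrc a))) (FO (mfun (tsrc a)) x) (FO (mfun (ttgt a)) x)"
    and nat: "\<And>f x y. f \<in> hom (ucat (msrc (tsrc a))) x y \<Longrightarrow>
      Comp (ucat (mtgt (tsrc a))) (FA (mfun (ttgt a)) f) (tcomp a x)
      = Comp (ucat (mtgt (tsrc a))) (tcomp a y) (FA (mfun (tsrc a)) f)"
    and compat: "\<And>x y. \<lbrakk>x \<in> eobj (msrc (tsrc a)); y \<in> eobj (msrc (tsrc
        a))\<rbrakk> \<Longrightarrow>
      Comp V (hA (mtgt (tsrc a)) (eid (mtgt (tsrc a)) (FO (mfun (tsrc a)) x)) (tcomp a y))
        (mstr (tsrc a) (x, y))
      = Comp V (hA (mtgt (tsrc a)) (tcomp a x) (eid (mtgt (tsrc a)) (FO (mfun (ttgt a)) y)))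
        (mstr (ttgt a) (x, y))"
  shows "enriched_trans V M a"
proof -
  interpret S: enriched_functor V M "tsrc a" by fact
  interpret T: enriched_functor V M "ttgt a" by fact
  have T': "cat_functor (ucat (msrc (tsrc a))) (ucat (mtgt (tsrc a))) (mfun (ttgt a))"
    using T.U.cat_functor by (simp add: par)
  show ?thesis
    by (intro enriched_trans.intro enriched_trans_axioms.intro nat_trans.intro
        nat_trans_axioms.intro
        S T T' S.U.cat_functor par comp nat compat)
qed

lemma etrans_components:
  assumes "enriched_trans V M a"
  shows "enriched_functor V M (tsrc a)" "enriched_functor V M (ttgt a)"
    "msrc (ttgt a) = msrc (tsrc a)" "mtgt (ttgt a) = mtgt (tsrc a)"
  using assms by (auto simp: enriched_trans_def enriched_trans_axioms_def)

text \<open>Normality makes all components undefined off the domain, so agreement on the domain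
  gives equality of the functions and then of the records.\<close>

lemma emor_eqI:
  assumes "emor_normal F" "emor_normal G" "msrc F = msrc G" "mtgt F = mtgt G"
    and "\<And>x. x \<in> eobj (msrc G) \<Longrightarrow> FO (mfun F) x = FO (mfun G) x"
    and "\<And>f. f \<in> earr (msrc G) \<Longrightarrow> FA (mfun F) f = FA (mfun G) f"
    and "\<And>x y. \<lbrakk>x \<in> eobj (msrc G); y \<in> eobj (msrc G)\<rbrakk>
        \<Longrightarrow> mstr F (x, y) = mstr G (x, y)"
  shows "F = G"
proof -
  have "FO (mfun F) = FO (mfun G)" "FA (mfun F) = FA (mfun G)"
    using assms by (auto simp: emor_normal_def intro: extensionalityI)
  moreover have "mstr F = mstr G"
    using assms by (intro extensionalityI[of _ "eobj (msrc G) \<times> eobj (msrc G)"]) (auto simp: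
        emor_normal_def)
  ultimately show ?thesis
    using assms by (auto intro!: emor.equality ftr.equality)
qed

lemma etrans_eqI:
  assumes "etrans_normal a" "etrans_normal b" "tsrc a = tsrc b" "ttgt a = ttgt b"
    and "\<And>x. x \<in> eobj (msrc (tsrc b)) \<Longrightarrow> tcomp a x = tcomp b x"
  shows "a = b"
  using assms
  by (auto simp: etrans_normal_def intro!: etrans.equality intro: extensionalityI)

section \<open>Identities and composites of enriched functors and transformations\<close>

lemma emor_id_simps [simp]:
  "msrc (emor_id V E) = E" "mtgt (emor_id V E) = E"
  "x \<in> eobj E \<Longrightarrow> FO (mfun (emor_id V E)) x = x"
  "f \<in> earr E \<Longrightarrow> FA (mfun (emor_id V E)) f = f"
  "x \<in> eobj E \<Longrightarrow> y \<in> eobj E \<Longrightarrow> mstr (emor_id V E) (x, y) = Id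
      V (hO E x y)"
  by (simp_all add: emor_id_def)

lemma emor_comp_simps [simp]:
  "msrc (emor_comp V G F) = msrc F" "mtgt (emor_comp V G F) = mtgt G"
  "x \<in> eobj (msrc F) \<Longrightarrow> FO (mfun (emor_comp V G F)) x = FO (mfun G) (FO (mfun F)
      x)"
  "f \<in> earr (msrc F) \<Longrightarrow> FA (mfun (emor_comp V G F)) f = FA (mfun G) (FA (mfun F)
      f)"
  "x \<in> eobj (msrc F) \<Longrightarrow> y \<in> eobj (msrc F) \<Longrightarrow> mstr (emor_comp
      V G F) (x, y)
    = Comp V (mstr G (FO (mfun F) x, FO (mfun F) y)) (mstr F (x, y))"
  by (simp_all add: emor_comp_def)

lemma etrans_id_simps [simp]:
  "tsrc (etrans_id F) = F" "ttgt (etrans_id F) = F"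
  "x \<in> eobj (msrc F) \<Longrightarrow> tcomp (etrans_id F) x = eid (mtgt F) (FO (mfun F) x)"
  by (simp_all add: etrans_id_def)

lemma etrans_vcomp_simps [simp]:
  "tsrc (etrans_vcomp b a) = tsrc a" "ttgt (etrans_vcomp b a) = ttgt b"
  "x \<in> eobj (msrc (tsrc a)) \<Longrightarrow>
    tcomp (etrans_vcomp b a) x = Comp (ucat (mtgt (tsrc a))) (tcomp b x) (tcomp a x)"
  by (simp_all add: etrans_vcomp_def)

lemma etrans_hcomp_simps [simp]:
  "tsrc (etrans_hcomp V b a) = emor_comp V (tsrc b) (tsrc a)"
  "ttgt (etrans_hcomp V b a) = emor_comp V (ttgt b) (ttgt a)"
  "x \<in> eobj (msrc (tsrc a)) \<Longrightarrow> tcomp (etrans_hcomp V b a) x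
    = Comp (ucat (mtgt (tsrc b))) (FA (mfun (ttgt b)) (tcomp a x)) (tcomp b (FO (mfun (tsrc a)) x))"
  by (simp_all add: etrans_hcomp_def)

lemma emor_id_normal: "ecat_normal E \<Longrightarrow> emor_normal (emor_id V E)"
  by (simp add: emor_normal_def emor_id_def)

lemma emor_comp_normal: "emor_normal F \<Longrightarrow> emor_normal G \<Longrightarrow>
    emor_normal (emor_comp V G F)"
  by (simp add: emor_normal_def emor_comp_def)

lemma etrans_id_normal: "emor_normal F \<Longrightarrow> etrans_normal (etrans_id F)"
  by (simp add: etrans_normal_def etrans_id_def)

lemma etrans_vcomp_normal: "etrans_normal a \<Longrightarrow> etrans_normal b \<Longrightarrow>
    etrans_normal (etrans_vcomp b a)"
  by (simp add: etrans_normal_def etrans_vcomp_def)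

lemma etrans_hcomp_normal: "etrans_normal a \<Longrightarrow> etrans_normal b \<Longrightarrow>
    etrans_normal (etrans_hcomp V b a)"
  by (simp add: etrans_normal_def etrans_hcomp_def emor_comp_normal)

lemma enriched_functor_id:
  assumes "enriched_category V M E"
  shows "enriched_functor V M (emor_id V E)"
proof -
  interpret E: enriched_category V M E by fact
  interpret U: category "ucat E" by (rule E.ucat_category)
  have "cat_functor (ucat E) (ucat E) (mfun (emor_id V E))"
    by (rule cat_functorI) (auto intro: homI U.category)
  then show ?thesis
    by (intro enriched_functorI) (auto simp: assms E.tA_id2 hom_def)
qed

text \<open>Each condition is pasted from the one for \<open>F\<close> and the one for
  \<open>G\<close> at images under \<open>F\<close>. For the composition maps, functoriality of the
  binary tensor merges the two pairs of structure maps.\<close>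

lemma enriched_functor_comp:
  assumes "enriched_functor V M F" "enriched_functor V M G" "msrc G = mtgt F"
  shows "enriched_functor V M (emor_comp V G F)"
proof -
  interpret F: enriched_functor V M F by fact
  interpret G: enriched_functor V M G by fact
  note [simp] = assms(3)
  have FG[simp]: "FO (mfun F) x \<in> eobj (mtgt F)" if "x \<in> eobj (msrc F)" for x
    using that by simp
  have "cat_functor (ucat (msrc F)) (ucat (mtgt G)) (mfun (emor_comp V G F))"
    using G.U.FA_arr G.U.FA_dom G.U.FA_cod G.U.FA_id G.U.FO_obj G.U.FA_comp
    by (intro cat_functorI) (auto intro!: homI F.U.A.category G.U.B.category simp: F.U.FA_comp)
  then show ?thesis
  proof (intro enriched_functorI, goal_cases)
    case (4 x y)
    then show ?case using G.str_arr G.str_cod G.str_dom by (auto intro!: homI)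
  next
    case (5 f h x x' y y')
    then have *: "f \<in> earr (msrc F)" "h \<in> earr (msrc F)"
      "x \<in> eobj (msrc F)" "x' \<in> eobj (msrc F)" "y \<in> eobj (msrc F)" "y' \<in> eobj (msrc
          F)"
      and d: "Dom (ucat (msrc F)) f = x'" "Cod (ucat (msrc F)) f = x"
        "Dom (ucat (msrc F)) h = y" "Cod (ucat (msrc F)) h = y'"
      by (auto simp: hom_def)
    let ?Ff = "FA (mfun F) f" and ?Fh = "FA (mfun F) h"
    have "hA (mtgt G) (FA (mfun G) ?Ff) (FA (mfun G) ?Fh) \<cdot>\<^bsub>V\<^esub> mstr G (FO (mfun
        F) x, FO (mfun F) y)
       = mstr G (FO (mfun F) x', FO (mfun F) y') \<cdot>\<^bsub>V\<^esub> hA (mtgt F) ?Ff ?Fh"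
      using * d G.str_nat[of ?Ff "FO (mfun F) x'" "FO (mfun F) x" ?Fh "FO (mfun F) y" "FO (mfun F)
          y'"]
      by (simp add: hom_def)
    then show ?case
      using 5 * d F.str_nat[of f x' x h y y'] G.U.FA_arr[of ?Ff] G.U.FA_arr[of ?Fh] G.str_arr
          G.str_cod G.str_dom
      apply (simp)
      apply (subst F.S.comp_extend, assumption)
      apply simp_all
      done
  next
    case (6 x)
    then show ?case
      using F.str_eta[of x] G.str_eta[of "FO (mfun F) x"] G.str_arr G.str_cod G.str_dom by simp
  next
    case (7 x y z)
    have G: "mstr G (FO (mfun F) x, FO (mfun F) z) \<cdot>\<^bsub>V\<^esub> mu (mtgt F) (FO (mfun
        F) x, FO (mfun F) y, FO (mfun F) z)
     = mu (mtgt G) (FO (mfun G) (FO (mfun F) x), FO (mfun G) (FO (mfun F) y), FO (mfun G) (FO (mfun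
         F) z))
       \<cdot>\<^bsub>V\<^esub> tA M [mstr G (FO (mfun F) y, FO (mfun F) z), mstr G (FO (mfun F) x,
           FO (mfun F) y)]"
      using 7 G.str_mu[of "FO (mfun F) x" "FO (mfun F) y" "FO (mfun F) z"] by simp
    show ?case
      using 7 F.str_mu[of x y z] F.S.comp_extend[OF G, of "tA M [mstr F (y, z), mstr F (x, y)]"]
          G.str_arr G.str_cod G.str_dom
      by (simp add: F.S.tA_comp2 G.U.FO_obj)
  qed (simp_all add: F.S.enriched_category G.T.enriched_category)
qed

lemma enriched_trans_id:
  assumes "enriched_functor V M F"
  shows "enriched_trans V M (etrans_id F)"
proof -
  interpret F: enriched_functor V M F by fact
  show ?thesis
    by (rule enriched_transI) (auto simp: assms hom_def)
qed

text \<open>Compatibility first uses the condition for \<open>a\<close>; then precomposition with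
  \<open>tcomp a x\<close> and postcomposition with \<open>tcomp b y\<close> are exchanged by
  \<open>hA_swap\<close>, which makes the condition for \<open>b\<close> applicable.\<close>

lemma enriched_trans_vcomp:
  assumes "enriched_trans V M a" "enriched_trans V M b" "tsrc b = ttgt a"
  shows "enriched_trans V M (etrans_vcomp b a)"
proof -
  interpret a: enriched_trans V M a by fact
  interpret b: enriched_trans V M b by fact
  let ?A = "msrc (tsrc a)" and ?B = "mtgt (tsrc a)"
  let ?F = "tsrc a" and ?G = "ttgt a" and ?H = "ttgt b"
  note par [simp] = assms(3) a.parallel b.parallel
  show ?thesis
  proof (rule enriched_transI, goal_cases)
    case (5 x)
    then show ?case using a.t_arr[of x] a.t_dom[of x] a.t_cod[of x] b.t_arr[of x] b.t_dom[of x]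
        b.t_cod[of x]
      by (auto intro!: homI)
  next
    case (6 f x y)
    then have "x \<in> eobj ?A" "y \<in> eobj ?A" "f \<in> earr ?A" "Dom (ucat ?A) f = x" "Cod
        (ucat ?A) f = y"
      by (auto simp: hom_def)
    then show ?case
      using a.t_arr[of x] a.t_dom[of x] a.t_cod[of x] b.t_arr[of x] b.t_dom[of x] b.t_cod[of x]
        a.t_arr[of y] a.t_dom[of y] a.t_cod[of y] b.t_arr[of y] b.t_dom[of y] b.t_cod[of y]
        a.natural[of f] b.S.U.B.comp_extend[OF b.natural[of f], of "tcomp a x"]
        a.T.U.FA_arr[of f] a.T.U.FA_dom[of f] a.T.U.FA_cod[of f] b.T.U.FA_arr[of f] b.T.U.FA_dom[of
            f] b.T.U.FA_cod[of f]
      by simp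
  next
    case (7 x y)
    then have x: "x \<in> eobj ?A" "y \<in> eobj ?A" by simp_all
    have o: "FO (mfun ?G) x \<in> eobj ?B" "FO (mfun ?G) y \<in> eobj ?B"
      "FO (mfun ?H) x \<in> eobj ?B" "FO (mfun ?H) y \<in> eobj ?B"
      using x a.T.U.FO_obj b.T.U.FO_obj by simp_all
    note t = a.t_arr[of x] a.t_dom[of x] a.t_cod[of x] b.t_arr[of x] b.t_dom[of x] b.t_cod[of x]
        a.t_arr[of y] a.t_dom[of y] a.t_cod[of y] b.t_arr[of y] b.t_dom[of y] b.t_cod[of y]
    note s = a.T.str_arr[of x y] a.T.str_dom[of x y] a.T.str_cod[of x y] b.T.str_arr[of x y]
        b.T.str_dom[of x y] b.T.str_cod[of x y]
    let ?Fx = "FO (mfun ?F) x" and ?Gx = "FO (mfun ?G) x" and ?Gy = "FO (mfun ?G) y" and ?Hy = "FO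
        (mfun ?H) y"
    have "hA ?B (eid ?B ?Fx) (tcomp (etrans_vcomp b a) y) \<cdot>\<^bsub>V\<^esub> mstr ?F (x, y)
      = hA ?B (eid ?B ?Fx) (tcomp b y) \<cdot>\<^bsub>V\<^esub> hA ?B (eid ?B ?Fx) (tcomp a y)
          \<cdot>\<^bsub>V\<^esub> mstr ?F (x, y)"
      using x o t s by (simp add: a.S.T.hA_comp_right)
    also have "\<dots> = hA ?B (eid ?B ?Fx) (tcomp b y) \<cdot>\<^bsub>V\<^esub> hA ?B (tcomp a x)
        (eid ?B ?Gy) \<cdot>\<^bsub>V\<^esub> mstr ?G (x, y)"
      using a.compat[of x y] x by simp
    also have "\<dots> = hA ?B (tcomp a x) (eid ?B ?Hy) \<cdot>\<^bsub>V\<^esub> hA ?B (eid ?B ?Gx)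
        (tcomp b y) \<cdot>\<^bsub>V\<^esub> mstr ?G (x, y)"
      using x o t s a.S.S.comp_extend[OF a.S.T.hA_swap[symmetric, of "tcomp a x" ?Fx ?Gx "tcomp b
          y" ?Gy ?Hy], of "mstr ?G (x, y)"]
      by (simp add: hom_def)
    also have "\<dots> = hA ?B (tcomp a x) (eid ?B ?Hy) \<cdot>\<^bsub>V\<^esub> hA ?B (tcomp b x)
        (eid ?B ?Hy) \<cdot>\<^bsub>V\<^esub> mstr ?H (x, y)"
      using b.compat[of x y] x by simp
    also have "\<dots> = hA ?B (tcomp (etrans_vcomp b a) x) (eid ?B ?Hy) \<cdot>\<^bsub>V\<^esub>
        mstr ?H (x, y)"
      using x o t s by (simp add: a.S.T.hA_comp_left)
    finally show ?case by simp
  qed (simp_all add: a.S.enriched_functor b.T.enriched_functor)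
qed

text \<open>Compatibility uses the condition for \<open>b\<close> at the images of \<open>x\<close>
  and \<open>y\<close>, then the condition for \<open>a\<close> between two applications of
  naturality of the structure maps of \<open>ttgt b\<close>, the first along
  \<open>tcomp a y\<close> and the second along \<open>tcomp a x\<close>.\<close>

lemma enriched_trans_hcomp:
  assumes "enriched_trans V M a" "enriched_trans V M b" "msrc (tsrc b) = mtgt (tsrc a)"
  shows "enriched_trans V M (etrans_hcomp V b a)"
proof -
  interpret a: enriched_trans V M a by fact
  interpret b: enriched_trans V M b by fact
  let ?A = "msrc (tsrc a)" and ?B = "mtgt (tsrc a)" and ?C = "mtgt (tsrc b)"
  let ?F = "tsrc a" and ?F' = "ttgt a" and ?G = "tsrc b" and ?G' = "ttgt b"
  note par [simp] = assms(3) a.parallel b.parallel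
  let ?f = "FO (mfun ?F)" and ?f' = "FO (mfun ?F')" and ?g = "FO (mfun ?G)" and ?g' = "FO (mfun
      ?G')"
  let ?gA = "FA (mfun ?G)" and ?g'A = "FA (mfun ?G')"
  \<comment> \<open>Rewriting with \<open>par\<close> identifies endpoints of \<open>a\<close> and
    \<open>b\<close>, after which typing rules of the interpreted locales no longer match; they are
    restated here for the rewritten endpoints.\<close>
  have fo [simp]: "?f x \<in> eobj ?B" "?f' x \<in> eobj ?B" if "x \<in> eobj ?A" for x
    using that a.S.U.FO_obj a.T.U.FO_obj by simp_all
  have go [simp]: "?g x \<in> eobj ?C" "?g' x \<in> eobj ?C" if "x \<in> eobj ?B" for x
    using that b.S.U.FO_obj b.T.U.FO_obj by simp_all
  have ta [simp]: "tcomp a x \<in> earr ?B" "Dom (ucat ?B) (tcomp a x) = ?f x" "Cod (ucat ?B)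
      (tcomp a x) = ?f' x"
    if "x \<in> eobj ?A" for x
    using that by simp_all
  have tb [simp]: "tcomp b x \<in> earr ?C" "Dom (ucat ?C) (tcomp b x) = ?g x" "Cod (ucat ?C)
      (tcomp b x) = ?g' x"
    if "x \<in> eobj ?B" for x
    using that b.t_arr b.t_dom b.t_cod by simp_all
  have gA [simp]: "?g'A f \<in> earr ?C" "Dom (ucat ?C) (?g'A f) = ?g' (Dom (ucat ?B) f)"
    "Cod (ucat ?C) (?g'A f) = ?g' (Cod (ucat ?B) f)" if "f \<in> earr ?B" for f
    using that b.T.U.FA_arr b.T.U.FA_dom b.T.U.FA_cod by simp_all
  have gA' [simp]: "?gA f \<in> earr ?C" "Dom (ucat ?C) (?gA f) = ?g (Dom (ucat ?B) f)"
    "Cod (ucat ?C) (?gA f) = ?g (Cod (ucat ?B) f)" if "f \<in> earr ?B" for f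
    using that b.S.U.FA_arr b.S.U.FA_dom b.S.U.FA_cod by simp_all
  have fA [simp]: "FA (mfun ?F) f \<in> earr ?B" "Dom (ucat ?B) (FA (mfun ?F) f) = ?f (Dom (ucat
      ?A) f)"
    "Cod (ucat ?B) (FA (mfun ?F) f) = ?f (Cod (ucat ?A) f)"
    "FA (mfun ?F') f \<in> earr ?B" "Dom (ucat ?B) (FA (mfun ?F') f) = ?f' (Dom (ucat ?A) f)"
    "Cod (ucat ?B) (FA (mfun ?F') f) = ?f' (Cod (ucat ?A) f)"if "f \<in> earr ?A" for f
    using that a.S.U.FA_arr a.S.U.FA_dom a.S.U.FA_cod a.T.U.FA_arr a.T.U.FA_dom a.T.U.FA_cod by
        simp_all
  have s' [simp]: "mstr ?F' (x, y) \<in> Arr V" "Dom V (mstr ?F' (x, y)) = hO ?A x y"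
      "Cod V (mstr ?F' (x, y)) = hO ?B (?f' x) (?f' y)"
    if "x \<in> eobj ?A" "y \<in> eobj ?A" for x y
    using that a.T.str_arr a.T.str_dom a.T.str_cod by simp_all
  have s [simp]: "mstr ?G (x, y) \<in> Arr V" "Dom V (mstr ?G (x, y)) = hO ?B x y"
      "Cod V (mstr ?G (x, y)) = hO ?C (?g x) (?g y)"
      "mstr ?G' (x, y) \<in> Arr V" "Dom V (mstr ?G' (x, y)) = hO ?B x y"
      "Cod V (mstr ?G' (x, y)) = hO ?C (?g' x) (?g' y)"
    if "x \<in> eobj ?B" "y \<in> eobj ?B" for x y
    using that b.S.str_arr b.S.str_dom b.S.str_cod b.T.str_arr b.T.str_dom b.T.str_cod by simp_all
  show ?thesis
  proof (rule enriched_transI, goal_cases)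
    case 1
    then show ?case by (simp add: enriched_functor_comp a.S.enriched_functor b.S.enriched_functor)
  next
    case 2
    then show ?case by (simp add: enriched_functor_comp a.T.enriched_functor b.T.enriched_functor)
  next
    case (5 x)
    then show ?case by (auto intro!: homI)
  next
    case (6 f x y)
    then have x: "x \<in> eobj ?A" "y \<in> eobj ?A" "f \<in> earr ?A" "Dom (ucat ?A) f = x" "Cod
        (ucat ?A) f = y"
      by (auto simp: hom_def)
    let ?K = "Comp (ucat ?C)"
    let ?Ff = "FA (mfun ?F) f" and ?F'f = "FA (mfun ?F') f"
    have "?K (?g'A ?F'f) (?K (?g'A (tcomp a x)) (tcomp b (?f x)))
        = ?K (?g'A (Comp (ucat ?B) ?F'f (tcomp a x))) (tcomp b (?f x))"
      using x b.T.U.FA_comp[of "tcomp a x" ?F'f] by simp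
    also have "\<dots> = ?K (?g'A (tcomp a y)) (?K (?g'A ?Ff) (tcomp b (?f x)))"
      using x b.T.U.FA_comp[of ?Ff "tcomp a y"] a.natural[of f] by simp
    also have "\<dots> = ?K (?g'A (tcomp a y)) (?K (tcomp b (?f y)) (?gA ?Ff))"
      using x b.natural[of ?Ff] by simp
    finally show ?case using x by simp
  next
    case (7 x y)
    then have x: "x \<in> eobj ?A" "y \<in> eobj ?A" by simp_all
    let ?FS = "mstr ?F (x, y)" and ?FS' = "mstr ?F' (x, y)"
    have "hA ?C (eid ?C (?g (?f x))) (tcomp (etrans_hcomp V b a) y) \<cdot>\<^bsub>V\<^esub> mstr
        ?G (?f x, ?f y) \<cdot>\<^bsub>V\<^esub> ?FS
       = hA ?C (eid ?C (?g (?f x))) (?g'A (tcomp a y)) \<cdot>\<^bsub>V\<^esub> (hA ?C (eid ?C (?g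
           (?f x))) (tcomp b (?f y))
          \<cdot>\<^bsub>V\<^esub> mstr ?G (?f x, ?f y)) \<cdot>\<^bsub>V\<^esub> ?FS"
      using x by (simp add: b.S.T.hA_comp_right)
    also have "\<dots> = hA ?C (eid ?C (?g (?f x))) (?g'A (tcomp a y)) \<cdot>\<^bsub>V\<^esub> (hA
        ?C (tcomp b (?f x)) (eid ?C (?g' (?f y)))
          \<cdot>\<^bsub>V\<^esub> mstr ?G' (?f x, ?f y)) \<cdot>\<^bsub>V\<^esub> ?FS"
      using b.compat[of "?f x" "?f y"] x by simp
    also have "\<dots> = (hA ?C (eid ?C (?g (?f x))) (?g'A (tcomp a y)) \<cdot>\<^bsub>V\<^esub> hA
        ?C (tcomp b (?f x)) (eid ?C (?g' (?f y))))
          \<cdot>\<^bsub>V\<^esub> mstr ?G' (?f x, ?f y) \<cdot>\<^bsub>V\<^esub> ?FS"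
      using x by simp
    also have "\<dots> = (hA ?C (tcomp b (?f x)) (eid ?C (?g' (?f' y))) \<cdot>\<^bsub>V\<^esub> hA
        ?C (eid ?C (?g' (?f x))) (?g'A (tcomp a y)))
          \<cdot>\<^bsub>V\<^esub> mstr ?G' (?f x, ?f y) \<cdot>\<^bsub>V\<^esub> ?FS"
      using x b.S.T.hA_swap[of "tcomp b (?f x)" "?g (?f x)" "?g' (?f x)" "?g'A (tcomp a y)" "?g'
          (?f y)" "?g' (?f' y)"]
      by (simp add: hom_def)
    also have "\<dots> = hA ?C (tcomp b (?f x)) (eid ?C (?g' (?f' y))) \<cdot>\<^bsub>V\<^esub> (hA
        ?C (eid ?C (?g' (?f x))) (?g'A (tcomp a y))
          \<cdot>\<^bsub>V\<^esub> mstr ?G' (?f x, ?f y)) \<cdot>\<^bsub>V\<^esub> ?FS"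
      using x by simp
    also have "\<dots> = hA ?C (tcomp b (?f x)) (eid ?C (?g' (?f' y))) \<cdot>\<^bsub>V\<^esub>
        mstr ?G' (?f x, ?f' y) \<cdot>\<^bsub>V\<^esub>
          hA ?B (eid ?B (?f x)) (tcomp a y) \<cdot>\<^bsub>V\<^esub> ?FS"
      \<comment> \<open>Naturality in the second variable only: the first arrow is an identity,
        which the functor preserves.\<close>
      using x b.T.str_nat[of "eid ?B (?f x)" "?f x" "?f x" "tcomp a y" "?f y" "?f' y"]
          b.T.U.FA_id[of "?f x"]
      by (simp add: hom_def)
    also have "\<dots> = hA ?C (tcomp b (?f x)) (eid ?C (?g' (?f' y))) \<cdot>\<^bsub>V\<^esub>
        (mstr ?G' (?f x, ?f' y) \<cdot>\<^bsub>V\<^esub>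
          hA ?B (tcomp a x) (eid ?B (?f' y))) \<cdot>\<^bsub>V\<^esub> ?FS'"
      using a.compat[of x y] x by simp
    also have "\<dots> = hA ?C (tcomp b (?f x)) (eid ?C (?g' (?f' y))) \<cdot>\<^bsub>V\<^esub> hA
        ?C (?g'A (tcomp a x)) (eid ?C (?g' (?f' y)))
         \<cdot>\<^bsub>V\<^esub> mstr ?G' (?f' x, ?f' y) \<cdot>\<^bsub>V\<^esub> ?FS'"
      using x b.T.str_nat[of "tcomp a x" "?f x" "?f' x" "eid ?B (?f' y)" "?f' y" "?f' y",
          symmetric] b.T.U.FA_id[of "?f' y"]
      by (simp add: hom_def)
    also have "\<dots> = hA ?C (tcomp (etrans_hcomp V b a) x) (eid ?C (?g' (?f' y)))
        \<cdot>\<^bsub>V\<^esub> mstr ?G' (?f' x, ?f' y) \<cdot>\<^bsub>V\<^esub> ?FS'"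
      using x by (simp add: b.S.T.hA_comp_left)
    finally show ?case using x by simp
  qed simp_all
qed

section \<open>The 2-category of enriched categories\<close>

lemma Cat_enriched_simps [simp]:
  "Cell0 (Cat_enriched V M) = {E. enriched_category V M E \<and> ecat_normal E}"
  "Cell1 (Cat_enriched V M) = {F. enriched_functor V M F \<and> emor_normal F}"
  "Cell2 (Cat_enriched V M) = {a. enriched_trans V M a \<and> etrans_normal a}"
  "Src1 (Cat_enriched V M) = msrc" "Tgt1 (Cat_enriched V M) = mtgt" "Id1 (Cat_enriched V M) =
      emor_id V"
  "Comp1 (Cat_enriched V M) = emor_comp V" "Src2 (Cat_enriched V M) = tsrc"
  "Tgt2 (Cat_enriched V M) = ttgt" "Id2 (Cat_enriched V M) = etrans_id"
  "VComp (Cat_enriched V M) = etrans_vcomp" "HComp (Cat_enriched V M) = etrans_hcomp V"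
  by (simp_all add: Cat_enriched_def)

lemma cat01_simps [simp]:
  "Obj (cat01 K) = Cell0 K" "Arr (cat01 K) = Cell1 K" "Dom (cat01 K) = Src1 K" "Cod (cat01 K) =
      Tgt1 K"
  "Id (cat01 K) = Id1 K" "Comp (cat01 K) = Comp1 K"
  by (simp_all add: cat01_def)

lemma cat12_simps [simp]:
  "Obj (cat12 K) = Cell1 K" "Arr (cat12 K) = Cell2 K" "Dom (cat12 K) = Src2 K" "Cod (cat12 K) =
      Tgt2 K"
  "Id (cat12 K) = Id2 K" "Comp (cat12 K) = VComp K"
  by (simp_all add: cat12_def)

lemma cat02_simps [simp]:
  "Obj (cat02 K) = Cell0 K" "Arr (cat02 K) = Cell2 K" "Dom (cat02 K) = Src1 K \<circ> Src2 K"
  "Cod (cat02 K) = Tgt1 K \<circ> Src2 K" "Id (cat02 K) = Id2 K \<circ> Id1 K" "Comp (cat02 K) =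
      HComp K"
  by (simp_all add: cat02_def)

lemma enriched_functor_components:
  assumes "enriched_functor V M F"
  shows "enriched_category V M (msrc F)" "enriched_category V M (mtgt F)"
    "cat_functor (ucat (msrc F)) (ucat (mtgt F)) (mfun F)"
  using assms by (auto simp: enriched_functor_def)

lemma emor_normal_components: "emor_normal F \<Longrightarrow> ecat_normal (msrc F)" "emor_normal F
    \<Longrightarrow> ecat_normal (mtgt F)"
  by (auto simp: emor_normal_def)

lemma etrans_normal_components: "etrans_normal a \<Longrightarrow> emor_normal (tsrc a)"
    "etrans_normal a \<Longrightarrow> emor_normal (ttgt a)"
  by (auto simp: etrans_normal_def)

lemmas cell_components = etrans_components enriched_functor_components emor_normal_components
  etrans_normal_components

lemmas cell_closure = enriched_functor_id enriched_functor_comp enriched_trans_id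
    enriched_trans_vcomp
  enriched_trans_hcomp emor_id_normal emor_comp_normal etrans_id_normal etrans_vcomp_normal
  etrans_hcomp_normal

lemma emor_comp_id_left:
  assumes "enriched_functor V M F" "emor_normal F"
  shows "emor_comp V (emor_id V (mtgt F)) F = F"
proof -
  interpret F: enriched_functor V M F by fact
  show ?thesis using assms by (intro emor_eqI) (auto simp: cell_components cell_closure)
qed

lemma emor_comp_id_right:
  assumes "enriched_functor V M F" "emor_normal F"
  shows "emor_comp V F (emor_id V (msrc F)) = F"
proof -
  interpret F: enriched_functor V M F by fact
  show ?thesis using assms by (intro emor_eqI) (auto simp: cell_components cell_closure)
qed

lemma emor_comp_assoc:
  assumes "enriched_functor V M F" "emor_normal F" "enriched_functor V M G" "emor_normal G"
    "enriched_functor V M H" "emor_normal H" "msrc G = mtgt F" "msrc H = mtgt G"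
  shows "emor_comp V (emor_comp V H G) F = emor_comp V H (emor_comp V G F)"
proof -
  interpret F: enriched_functor V M F by fact
  interpret G: enriched_functor V M G by fact
  interpret H: enriched_functor V M H by fact
  note [simp] = assms(7,8)
  have "FO (mfun G) (FO (mfun F) x) \<in> eobj (mtgt G)" if "x \<in> eobj (msrc F)" for x
    using that G.U.FO_obj by simp
  then show ?thesis using assms G.str_arr G.str_dom G.str_cod H.str_arr H.str_dom H.str_cod
    by (intro emor_eqI) (auto simp: cell_components cell_closure)
qed

lemma Cat_enriched_cat01: "category (cat01 (Cat_enriched V M))"
  by (rule categoryI) (auto simp: cell_components cell_closure emor_comp_assoc emor_comp_id_left
    emor_comp_id_right)

lemma Cat_enriched_cat12: "category (cat12 (Cat_enriched V M))"
proof (rule categoryI, goal_cases)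
  case (5 f)
  then interpret f: enriched_trans V M f by simp
  show ?case using 5
    by (auto simp: cell_components cell_closure intro!: etrans_eqI)
next
  case (6 f)
  then interpret f: enriched_trans V M f by simp
  show ?case using 6
    by (auto simp: cell_components cell_closure intro!: etrans_eqI)
next
  case (7 f g h)
  then interpret f: enriched_trans V M f + g: enriched_trans V M g + h: enriched_trans V M h by
      simp_all
  show ?case using 7 g.t_arr g.t_dom g.t_cod h.t_arr h.t_dom h.t_cod
    by (auto simp: cell_components cell_closure intro!: etrans_eqI)
qed (auto simp: cell_components cell_closure)

lemma etrans_hcomp_id_left:
  assumes "enriched_trans V M a" "etrans_normal a"
  shows "etrans_hcomp V (etrans_id (emor_id V (mtgt (tsrc a)))) a = a"
proof -
  interpret a: enriched_trans V M a by fact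
  have "emor_comp V (emor_id V (mtgt (tsrc a))) (ttgt a) = ttgt a"
    using emor_comp_id_left[of V M "ttgt a"] assms by (simp add: cell_components)
  then show ?thesis using assms
    by (intro etrans_eqI) (auto simp: cell_components cell_closure emor_comp_id_left[of V M])
qed

lemma etrans_hcomp_id_right:
  assumes "enriched_trans V M a" "etrans_normal a"
  shows "etrans_hcomp V a (etrans_id (emor_id V (msrc (tsrc a)))) = a"
proof -
  interpret a: enriched_trans V M a by fact
  have "emor_comp V (ttgt a) (emor_id V (msrc (tsrc a))) = ttgt a"
    using emor_comp_id_right[of V M "ttgt a"] assms by (simp add: cell_components)
  then show ?thesis using assms a.T.U.FA_id
    by (intro etrans_eqI) (auto simp: cell_components cell_closure emor_comp_id_right[of V M])
qed

text \<open>On components, the target functor of \<open>c\<close> preserves the composite of the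
  image of \<open>tcomp a x\<close> with a component of \<open>b\<close>; what remains is
  associativity in the underlying target category.\<close>

lemma etrans_hcomp_assoc:
  assumes "enriched_trans V M a" "etrans_normal a" "enriched_trans V M b" "etrans_normal b"
    "enriched_trans V M c" "etrans_normal c"
    "msrc (tsrc b) = mtgt (tsrc a)" "msrc (tsrc c) = mtgt (tsrc b)"
  shows "etrans_hcomp V (etrans_hcomp V c b) a = etrans_hcomp V c (etrans_hcomp V b a)"
proof -
  interpret a: enriched_trans V M a by fact
  interpret b: enriched_trans V M b by fact
  interpret c: enriched_trans V M c by fact
  note par [simp] = assms(7,8) a.parallel b.parallel c.parallel
  show ?thesis
  proof (rule etrans_eqI)
    fix x assume "x \<in> eobj (msrc (tsrc (etrans_hcomp V c (etrans_hcomp V b a))))"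
    then have x: "x \<in> eobj (msrc (tsrc a))" by simp
    let ?Fx = "FO (mfun (tsrc a)) x"
    let ?p = "FA (mfun (ttgt b)) (tcomp a x)" and ?q = "tcomp b ?Fx"
    have p: "?p \<in> earr (mtgt (tsrc b))" "?q \<in> earr (mtgt (tsrc b))"
       "Dom (ucat (mtgt (tsrc b))) ?p = Cod (ucat (mtgt (tsrc b))) ?q"
       "Dom (ucat (mtgt (tsrc b))) ?q = FO (mfun (tsrc b)) ?Fx"
       "FO (mfun (tsrc b)) ?Fx \<in> eobj (mtgt (tsrc b))"
      using b.T.U.FA_arr[of "tcomp a x"] b.T.U.FA_dom[of "tcomp a x"] b.t_arr[of ?Fx] b.t_cod[of
          ?Fx] x
        b.t_dom[of ?Fx] b.S.U.FO_obj[of ?Fx]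
      by simp_all
    show "tcomp (etrans_hcomp V (etrans_hcomp V c b) a) x = tcomp (etrans_hcomp V c (etrans_hcomp V
        b a)) x"
      using p x c.T.U.FA_comp[of ?q ?p] c.t_arr[of "FO (mfun (tsrc b)) ?Fx"] c.t_cod[of "FO (mfun
          (tsrc b)) ?Fx"]
        c.T.U.FA_arr[of ?p] c.T.U.FA_arr[of ?q] c.T.U.FA_dom[of ?p] c.T.U.FA_cod[of ?q]
            c.T.U.FA_dom[of ?q]
      by simp
  next
    show "tsrc (etrans_hcomp V (etrans_hcomp V c b) a) = tsrc (etrans_hcomp V c (etrans_hcomp V b
        a))"
      using assms by (simp add: emor_comp_assoc[of V M] cell_components)
    show "ttgt (etrans_hcomp V (etrans_hcomp V c b) a) = ttgt (etrans_hcomp V c (etrans_hcomp V b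
        a))"
      using assms by (simp add: emor_comp_assoc[of V M] cell_components)
  qed (auto simp: assms cell_closure)
qed

lemma Cat_enriched_cat02: "category (cat02 (Cat_enriched V M))"
proof (rule categoryI, goal_cases)
  case (5 f)
  then show ?case by (simp add: etrans_hcomp_id_left[of V M])
next
  case (6 f)
  then show ?case by (simp add: etrans_hcomp_id_right[of V M])
next
  case (7 f g h)
  then show ?case by (simp add: etrans_hcomp_assoc[of V M])
qed (auto simp: cell_components cell_closure)

text \<open>Structure maps belong to the endpoints of a 2-cell, so equations of 2-cells are compared
  on components in underlying categories; interchange is the classical one for natural
  transformations.\<close>

theorem two_category_Cat_enriched: "two_category (Cat_enriched V M)"
proof (intro two_category.intro two_category_axioms.intro Cat_enriched_cat01 Cat_enriched_cat12
    Cat_enriched_cat02, goal_cases)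
  case (1 a)
  then show ?case by (simp add: etrans_components[of V M])
next
  case (2 a b)
  then show ?case by simp
next
  case (3 f g)
  then interpret f: enriched_functor V M f + g: enriched_functor V M g by simp_all
  show ?case using 3 g.U.FA_id g.U.FO_obj
    by (intro etrans_eqI) (auto simp: cell_components cell_closure)
next
  case (4 a a' b b')
  then interpret a: enriched_trans V M a + a': enriched_trans V M a'
    + b: enriched_trans V M b + b': enriched_trans V M b' by simp_all
  have par [simp]: "tsrc a' = ttgt a" "tsrc b' = ttgt b" "msrc (tsrc b) = mtgt (tsrc a)"
    using 4 by simp_all
  note par' [simp] = a.parallel b.parallel a'.parallel b'.parallel
  show ?case
    unfolding Cat_enriched_simps
  proof (rule etrans_eqI)
    fix x assume "x \<in> eobj (msrc (tsrc (etrans_vcomp (etrans_hcomp V b' a') (etrans_hcomp V b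
        a))))"
    then have x: "x \<in> eobj (msrc (tsrc a))" by simp
    let ?Fx = "FO (mfun (tsrc a)) x" and ?F'x = "FO (mfun (ttgt a)) x"
    let ?C = "ucat (mtgt (tsrc b))"
    have F': "?F'x \<in> eobj (mtgt (tsrc a))" using x a.T.U.FO_obj by simp
    have [simp]: "tcomp a' x \<in> earr (mtgt (tsrc a))" "Dom (ucat (mtgt (tsrc a))) (tcomp a' x) =
        ?F'x"
      using a'.t_arr[of x] a'.t_dom[of x] x by simp_all
    have G [simp]: "FA (mfun (ttgt b)) f \<in> Arr ?C" "Dom ?C (FA (mfun (ttgt b)) f) = FO (mfun
        (ttgt b)) (Dom (ucat (mtgt (tsrc a))) f)"
       "Cod ?C (FA (mfun (ttgt b)) f) = FO (mfun (ttgt b)) (Cod (ucat (mtgt (tsrc a))) f)"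
       "FA (mfun (ttgt b')) f \<in> Arr ?C" "Dom ?C (FA (mfun (ttgt b')) f) = FO (mfun (ttgt b'))
           (Dom (ucat (mtgt (tsrc a))) f)"
       "Cod ?C (FA (mfun (ttgt b')) f) = FO (mfun (ttgt b')) (Cod (ucat (mtgt (tsrc a))) f)"
       if "f \<in> earr (mtgt (tsrc a))" for f
      using that b.T.U.FA_arr[of f] b.T.U.FA_dom[of f] b.T.U.FA_cod[of f]
        b'.T.U.FA_arr[of f] b'.T.U.FA_dom[of f] b'.T.U.FA_cod[of f] by simp_all
    have t [simp]: "tcomp b y \<in> Arr ?C" "Dom ?C (tcomp b y) = FO (mfun (tsrc b)) y" "Cod ?C
        (tcomp b y) = FO (mfun (ttgt b)) y"
      "tcomp b' y \<in> Arr ?C" "Dom ?C (tcomp b' y) = FO (mfun (ttgt b)) y" "Cod ?C (tcomp b' y) =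
          FO (mfun (ttgt b')) y"
       if "y \<in> eobj (mtgt (tsrc a))" for y
      using that b.t_arr[of y] b.t_dom[of y] b.t_cod[of y] b'.t_arr[of y] b'.t_dom[of y]
          b'.t_cod[of y] by simp_all
    let ?K = "Comp ?C"
    have "FA (mfun (ttgt b')) (Comp (ucat (mtgt (tsrc a))) (tcomp a' x) (tcomp a x))
        = ?K (FA (mfun (ttgt b')) (tcomp a' x)) (FA (mfun (ttgt b')) (tcomp a x))"
      using x b'.T.U.FA_comp[of "tcomp a x" "tcomp a' x"] by simp
    \<comment> \<open>Naturality of \<open>b'\<close> at \<open>tcomp a x\<close> is the one
      exchange behind the interchange law.\<close>
    moreover have "?K (FA (mfun (ttgt b')) (tcomp a x)) (?K (tcomp b' ?Fx) (tcomp b ?Fx))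
       = ?K (?K (tcomp b' ?F'x) (FA (mfun (ttgt b)) (tcomp a x))) (tcomp b ?Fx)"
      using b'.S.U.B.comp_extend[OF b'.natural[of "tcomp a x"], of "tcomp b ?Fx"] x by simp
    ultimately show "tcomp (etrans_hcomp V (etrans_vcomp b' b) (etrans_vcomp a' a)) x
         = tcomp (etrans_vcomp (etrans_hcomp V b' a') (etrans_hcomp V b a)) x"
      using x F' by simp
  qed (use 4 in \<open>auto simp: cell_closure\<close>)
qed

section \<open>Pushforward is a 2-functor\<close>

context lax_functor
begin

text \<open>The tensor of \<open>F g\<close> after \<open>l ys\<close> splits by functoriality,
  naturality of \<open>l\<close> carries \<open>F g\<close> across, and the comultiplication axiom
  absorbs the rest. With \<open>g\<close> a composition or a unit of an enriched category, a nested
  composite in the pushforward becomes the image under \<open>F\<close> of the original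
  composite.\<close>

lemma l_nested:
  assumes obj: "set (xs @ ys @ zs) \<subseteq> Obj A" and g: "g \<in> hom A (tO M ys) y"
  shows "Comp B (l (xs @ [y] @ zs)) (Comp B
      (tA N (map (\<lambda>x. Id B (FO F x)) xs @ [Comp B (FA F g) (l ys)] @ map (\<lambda>x. Id B
          (FO F x)) zs))
      (dlt N (map (FO F) xs) (map (FO F) ys) (map (FO F) zs)))
    = Comp B (FA F (Comp A (tA M (map (Id A) xs @ [g] @ map (Id A) zs)) (dlt M xs ys zs)))
      (l (xs @ ys @ zs))"
proof -
  let ?I = "map (\<lambda>x. Id B (FO F x))"
  let ?gs = "map (Id A) xs @ [g] @ map (Id A) zs"
  let ?d = "dlt N (map (FO F) xs) (map (FO F) ys) (map (FO F) zs)"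
  have g': "g \<in> Arr A" "Dom A g = tO M ys" "Cod A g = y" using g by (auto simp: hom_def)
  then have y: "y \<in> Obj A" by auto
  have I [simp]: "map (FA F \<circ> Id A) xs = ?I xs" "map (FA F \<circ> Id A) zs = ?I zs"
     "map (Dom A \<circ> Id A) xs = xs" "map (Dom A \<circ> Id A) zs = zs" "map (Cod A \<circ> Id
         A) xs = xs"
     "map (Cod A \<circ> Id A) zs = zs" "map (Dom B \<circ> (\<lambda>x. Id B (FO F x))) xs = map
         (FO F) xs"
     "map (Dom B \<circ> (\<lambda>x. Id B (FO F x))) zs = map (FO F) zs"
     "map (Cod B \<circ> (\<lambda>x. Id B (FO F x))) xs = map (FO F) xs"
     "map (Cod B \<circ> (\<lambda>x. Id B (FO F x))) zs = map (FO F) zs"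
     "map (Cod B \<circ> (FA F \<circ> Id A)) xs = map (FO F) xs"
     "map (Cod B \<circ> (FA F \<circ> Id A)) zs = map (FO F) zs"
     "map (Dom B \<circ> (FA F \<circ> Id A)) xs = map (FO F) xs"
     "map (Dom B \<circ> (FA F \<circ> Id A)) zs = map (FO F) zs"
    using obj by (auto intro!: map_idI)
  have gs: "set ?gs \<subseteq> Arr A" using obj g' by auto
  have lgs: "set (?I xs @ [l ys] @ ?I zs) \<subseteq> Arr B" using obj by auto
  have Fgs: "set (map (FA F) ?gs) \<subseteq> Arr B" using obj g' by auto
  have d: "set (map (FO F) xs @ map (FO F) ys @ map (FO F) zs) \<subseteq> Obj B"
    using obj by auto
  note dd [simp] = T.dlt_arr[OF d] T.dlt_dom[OF d] T.dlt_cod[OF d]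
  note ll [simplified, simp] = T.tA_arr[OF lgs] T.tA_dom[OF lgs] T.tA_cod[OF lgs]
  note FF [simplified, simp] = T.tA_arr[OF Fgs] T.tA_dom[OF Fgs] T.tA_cod[OF Fgs]
  \<comment> \<open>To split the tensor, the identities around the middle entry are written as
    composites of identities.\<close>
  have II: "map2 (Comp B) (?I ws) (?I ws) = ?I ws" if "set ws \<subseteq> Obj A" for ws
    using that by (auto simp: list_eq_iff_nth_eq set_subset_nth)
  have "tA N (?I xs @ [Comp B (FA F g) (l ys)] @ ?I zs)
      = Comp B (tA N (map (FA F) ?gs)) (tA N (?I xs @ [l ys] @ ?I zs))"
    using obj g' by (subst T.tA_comp[OF lgs Fgs]) (auto simp: II)
  \<comment> \<open>Naturality of \<open>l\<close> along \<open>?gs\<close>, which has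
    \<open>g\<close> in the middle and identities elsewhere.\<close>
  moreover have "Comp B (l (xs @ [y] @ zs)) (tA N (map (FA F) ?gs))
      = Comp B (FA F (tA M ?gs)) (l (xs @ [tO M ys] @ zs))"
    using l_nat[OF gs] g' by simp
  ultimately have "Comp B (l (xs @ [y] @ zs)) (Comp B
      (tA N (?I xs @ [Comp B (FA F g) (l ys)] @ ?I zs)) ?d)
      = Comp B (FA F (tA M ?gs)) (Comp B (l (xs @ [tO M ys] @ zs))
          (Comp B (tA N (?I xs @ [l ys] @ ?I zs)) ?d))"
    using T.comp_extend[of "l (xs @ [y] @ zs)" "tA N (map (FA F) ?gs)" _ "Comp B (tA N (?I xs @ [l
        ys] @ ?I zs)) ?d"]
      obj g' y gs by simp
  also have "\<dots> = Comp B (FA F (tA M ?gs)) (Comp B (FA F (dlt M xs ys zs)) (l (xs @ ys @ zs)))"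
    using lax_comult[OF obj] by simp
  also have "\<dots> = Comp B (FA F (Comp A (tA M ?gs) (dlt M xs ys zs))) (l (xs @ ys @ zs))"
    using obj gs g' S.dlt_arr[OF obj] S.dlt_dom[OF obj] S.dlt_cod[OF obj] by (simp add: FA_comp)
  finally show ?thesis .
qed

lemma push0_simps [simp]:
  "ucat (push0 F l B E) = ucat E"
  "\<lbrakk>x \<in> eobj E; y \<in> eobj E\<rbrakk> \<Longrightarrow> hO (push0 F l B E) x y = FO F
      (hO E x y)"
  "\<lbrakk>f \<in> earr E; h \<in> earr E\<rbrakk> \<Longrightarrow> hA (push0 F l B E) f h = FA F
      (hA E f h)"
  "x \<in> eobj E \<Longrightarrow> eta (push0 F l B E) x = Comp B (FA F (eta E x)) (l [])"
  "\<lbrakk>x \<in> eobj E; y \<in> eobj E; z \<in> eobj E\<rbrakk> \<Longrightarrow> mu (push0 F l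
      B E) (x, y, z)
    = Comp B (FA F (mu E (x, y, z))) (l [hO E y z, hO E x y])"
  by (simp_all add: push0_def)

lemma push0_normal: "ecat_normal E \<Longrightarrow> ecat_normal (push0 F l B E)"
  by (auto simp: ecat_normal_def push0_def)

text \<open>Each law is the image under \<open>F\<close> of the law for \<open>E\<close>,
  precomposed with one structure map \<open>l\<close>; naturality of \<open>l\<close>, or
  \<open>l_nested\<close> where tensors are nested, brings both sides into that form.\<close>

lemma enriched_category_push:
  assumes "enriched_category A M E"
  shows "enriched_category B N (push0 F l B E)"
proof -
  interpret E: enriched_category A M E by fact
  interpret U: category "ucat E" by (rule E.ucat_category)
  have hom: "cat_functor (prod_cat (op_cat (ucat E)) (ucat E)) B (ehom (push0 F l B E))"
    by (rule cat_functorI)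
      (auto simp: E.hA_comp FA_comp intro!: homI category_prod category_op U.category T.category)
  show ?thesis
  proof (intro enriched_category.intro enriched_category_axioms.intro T.oplax_monoidal, goal_cases)
    case 1
    show ?case using hom by simp
  next
    case 2
    show ?case using U.category by simp
  next
    case (3 x)
    then show ?case by (auto intro!: homI)
  next
    case (4 f x y)
    then have f: "f \<in> earr E" "x \<in> eobj E" "y \<in> eobj E" "Dom (ucat E) f = x" "Cod (ucat
        E) f = y"
      by (auto simp: hom_def)
    then have "Comp A (hA E (eid E x) f) (eta E x) = Comp A (hA E f (eid E y)) (eta E y)"
      using 4 E.eta_extranatural by simp
    \<comment> \<open>Left-bracketing puts two images under \<open>F\<close> next to each other, so
      that functoriality can be read backwards; hence \<open>T.assoc\<close> is switched
      off.\<close>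
    then show ?case using f
      T.assoc[of "l []" "FA F (eta E x)" "FA F (hA E (eid E x) f)"] T.assoc[of "l []" "FA F (eta E
          y)" "FA F (hA E f (eid E y))"]
      by (simp add: FA_comp[symmetric] del: T.assoc)
  next
    case (5 x y z)
    then show ?case by (auto intro!: homI)
  next
    case (6 f x' x y h z z')
    then have f: "f \<in> earr E" "h \<in> earr E" "x \<in> eobj E" "x' \<in> eobj E" "z \<in> eobj
        E" "z' \<in> eobj E" "y \<in> eobj E"
      "Dom (ucat E) f = x'" "Cod (ucat E) f = x" "Dom (ucat E) h = z" "Cod (ucat E) h = z'"
      by (auto simp: hom_def)
    let ?p = "hA E (eid E y) h" and ?q = "hA E f (eid E y)"
    have "Comp B (FA F (hA E f h)) (Comp B (FA F (mu E (x, y, z))) (l [hO E y z, hO E x y]))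
        = Comp B (FA F (Comp A (hA E f h) (mu E (x, y, z)))) (l [hO E y z, hO E x y])"
      using f by (simp add: FA_comp)
    also have "\<dots> = Comp B (FA F (mu E (x', y, z'))) (Comp B (FA F (tA M [?p, ?q])) (l [hO E y
        z, hO E x y]))"
      using f 6 E.mu_natural by (simp add: FA_comp)
    also have "\<dots> = Comp B (FA F (mu E (x', y, z'))) (Comp B (l [hO E y z', hO E x' y]) (tA N
        [FA F ?p, FA F ?q]))"
      using f l_nat[of "[?p, ?q]"] by simp
    finally show ?case using f by simp
  next
    case (7 x g y y' z)
    then have f: "g \<in> earr E" "x \<in> eobj E" "z \<in> eobj E" "y \<in> eobj E" "y' \<in> eobj
        E"
      "Dom (ucat E) g = y" "Cod (ucat E) g = y'"
      by (auto simp: hom_def)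
    let ?p = "hA E g (eid E z)" and ?q = "hA E (eid E x) g"
    have "Comp B (FA F (mu E (x, y, z))) (Comp B (l [hO E y z, hO E x y]) (tA N [FA F ?p, FA F (Id
        A (hO E x y))]))
        = Comp B (FA F (mu E (x, y, z))) (Comp B (FA F (tA M [?p, Id A (hO E x y)])) (l [hO E y' z,
            hO E x y]))"
      using f l_nat[of "[?p, Id A (hO E x y)]"] by simp
    also have "\<dots> = Comp B (FA F (Comp A (mu E (x, y', z)) (tA M [Id A (hO E y' z), ?q]))) (l
        [hO E y' z, hO E x y])"
      using f 7 E.mu_extranatural[of x g y y' z] by (simp add: FA_comp[symmetric]
          T.assoc[symmetric] del: T.assoc)
    also have "\<dots> = Comp B (FA F (mu E (x, y', z))) (Comp B (l [hO E y' z, hO E x y']) (tA N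
        [FA F (Id A (hO E y' z)), FA F ?q]))"
      using f l_nat[of "[Id A (hO E y' z), ?q]"] by (simp add: FA_comp)
    finally show ?case using f by simp
  next
    case (8 w x y z)
    then have o: "w \<in> eobj E" "x \<in> eobj E" "y \<in> eobj E" "z \<in> eobj E" by simp_all
    let ?ls = "[hO E y z, hO E x y, hO E w x]"
    have "Comp B (FA F (mu E (w, x, z))) (Comp B (FA F (Comp A (tA M [mu E (x, y, z), Id A (hO E w
        x)])
        (dlt M [] [hO E y z, hO E x y] [hO E w x]))) (l ?ls))
      = Comp B (FA F (mu E (w, y, z))) (Comp B (FA F (Comp A (tA M [Id A (hO E y z), mu E (w, x,
          y)])
        (dlt M [hO E y z] [hO E x y, hO E w x] []))) (l ?ls))"
      using E.mu_assoc[of w x y z] o by (simp add: FA_comp[symmetric] T.assoc[symmetric] del: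
          T.assoc S.assoc)
    \<comment> \<open>The inserted arrow is the composition performed first: in the left factor on
      one side of the law, in the right factor on the other.\<close>
    then show ?case
      using o l_nested[of "[]" "[hO E y z, hO E x y]" "[hO E w x]" "mu E (x, y, z)" "hO E x z"]
        l_nested[of "[hO E y z]" "[hO E x y, hO E w x]" "[]" "mu E (w, x, y)" "hO E w y"]
      by (simp add: homI)
  next
    case (9 x y)
    then have o: "x \<in> eobj E" "y \<in> eobj E" by simp_all
    \<comment> \<open>The unit is inserted with empty \<open>ys\<close>, so the inner tensor is
      nullary; \<open>lax_counit\<close> turns the image of the counit of \<open>M\<close> into the
      counit of \<open>N\<close>.\<close>
    have "Comp B (FA F (mu E (x, y, y))) (Comp B (FA F (Comp A (tA M [eta E y, Id A (hO E x y)])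
        (dlt M [] [] [hO E x y]))) (l [hO E x y])) = cnt N (FO F (hO E x y))"
      using E.mu_unit_left[of x y] o
      by (simp add: FA_comp[symmetric] T.assoc[symmetric] lax_counit del: T.assoc S.assoc)
    then show ?case
      using o l_nested[of "[]" "[]" "[hO E x y]" "eta E y" "hO E y y"]
      by (simp add: homI)
  next
    case (10 x y)
    then have o: "x \<in> eobj E" "y \<in> eobj E" by simp_all
    have "Comp B (FA F (mu E (x, x, y))) (Comp B (FA F (Comp A (tA M [Id A (hO E x y), eta E x])
        (dlt M [hO E x y] [] []))) (l [hO E x y])) = cnt N (FO F (hO E x y))"
      using E.mu_unit_right[of x y] o
      by (simp add: FA_comp[symmetric] T.assoc[symmetric] lax_counit del: T.assoc S.assoc)
    then show ?case
      using o l_nested[of "[hO E x y]" "[]" "[]" "eta E x" "hO E x x"]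
      by (simp add: homI)
  qed
qed

lemma push1_simps [simp]:
  "msrc (push1 F l B G) = push0 F l B (msrc G)" "mtgt (push1 F l B G) = push0 F l B (mtgt G)"
  "mfun (push1 F l B G) = mfun G"
  "\<lbrakk>x \<in> eobj (msrc G); y \<in> eobj (msrc G)\<rbrakk> \<Longrightarrow> mstr (push1 F l
      B G) (x, y) = FA F (mstr G (x, y))"
  by (simp_all add: push1_def)

lemma push1_normal: "emor_normal G \<Longrightarrow> emor_normal (push1 F l B G)"
  by (simp add: emor_normal_def push1_def push0_normal)

lemma enriched_functor_push:
  assumes "enriched_functor A M G"
  shows "enriched_functor B N (push1 F l B G)"
proof -
  interpret G: enriched_functor A M G by fact
  note hom_def [simp]
  show ?thesis
  proof (intro enriched_functorI, goal_cases)
    case (4 x y)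
    then show ?case by simp
  next
    case (5 f h x x' y y')
    then have "x \<in> eobj (msrc G)" "x' \<in> eobj (msrc G)" "y \<in> eobj (msrc G)" "y' \<in>
        eobj (msrc G)"
      by auto
    then show ?case using 5 G.str_nat[of f x' x h y y'] by (auto simp: FA_comp[symmetric])
  next
    case (6 x)
    then show ?case using G.str_eta[of x] by (simp add: FA_comp[symmetric] T.assoc[symmetric] del:
        T.assoc)
  next
    case (7 x y z)
    let ?ms = "[mstr G (y, z), mstr G (x, y)]"
    let ?x = "FO (mfun G) x" and ?y = "FO (mfun G) y" and ?z = "FO (mfun G) z"
    have "Comp B (FA F (Comp A (mstr G (x, z)) (mu (msrc G) (x, y, z)))) (l [hO (msrc G) y z, hO
        (msrc G) x y])
      = Comp B (FA F (mu (mtgt G) (?x, ?y, ?z))) (Comp B (FA F (tA M ?ms)) (l [hO (msrc G) y z, hO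
          (msrc G) x y]))"
      using 7 G.str_mu[of x y z] by (simp add: FA_comp)
    \<comment> \<open>Naturality of \<open>l\<close> at the pair of structure maps of
      \<open>G\<close>.\<close>
    also have "Comp B (FA F (tA M ?ms)) (l [hO (msrc G) y z, hO (msrc G) x y])
      = Comp B (l [hO (mtgt G) ?y ?z, hO (mtgt G) ?x ?y]) (tA N (map (FA F) ?ms))"
      using 7 l_nat[of ?ms] by simp
    finally show ?case using 7 by (simp add: FA_comp)
  qed (simp_all add: enriched_category_push G.S.enriched_category G.T.enriched_category
      G.U.cat_functor)
qed

lemma push2_simps [simp]:
  "tsrc (push2 F l B a) = push1 F l B (tsrc a)" "ttgt (push2 F l B a) = push1 F l B (ttgt a)"
  "tcomp (push2 F l B a) = tcomp a"
  by (simp_all add: push2_def)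

lemma push2_normal: "etrans_normal a \<Longrightarrow> etrans_normal (push2 F l B a)"
  by (simp add: etrans_normal_def push1_normal)

text \<open>Components are kept, and the hom action of the pushforward is \<open>F\<close> of the
  old one, so compatibility is the image under \<open>F\<close> of the old condition.\<close>

lemma enriched_trans_push:
  assumes "enriched_trans A M a"
  shows "enriched_trans B N (push2 F l B a)"
proof -
  interpret a: enriched_trans A M a by fact
  show ?thesis
  proof (intro enriched_transI, goal_cases)
    case (7 x y)
    then show ?case using a.compat[of x y] a.T.str_arr[of x y] a.T.str_cod[of x y] a.T.U.FO_obj[of
        x] a.T.U.FO_obj[of y]
      by (simp add: FA_comp[symmetric] a.parallel)
  qed (simp_all add: enriched_functor_push a.S.enriched_functor a.T.enriched_functor a.parallel
      a.component a.naturality)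
qed

lemma pushforward_simps [simp]:
  "F0 (pushforward F l B) = push0 F l B" "F1 (pushforward F l B) = push1 F l B"
  "F2 (pushforward F l B) = push2 F l B"
  by (simp_all add: pushforward_def)

lemma push1_id:
  assumes "enriched_category A M E" "ecat_normal E"
  shows "push1 F l B (emor_id A E) = emor_id B (push0 F l B E)"
proof -
  interpret E: enriched_category A M E by fact
  show ?thesis
    using assms by (intro emor_eqI) (auto simp: push1_normal push0_normal cell_closure)
qed

lemma push1_comp:
  assumes "enriched_functor A M G" "emor_normal G" "enriched_functor A M H" "emor_normal H"
    "msrc H = mtgt G"
  shows "push1 F l B (emor_comp A H G) = emor_comp B (push1 F l B H) (push1 F l B G)"
proof -
  interpret G: enriched_functor A M G by fact
  interpret H: enriched_functor A M H by fact
  show ?thesis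
    using assms H.str_arr H.str_dom
    by (intro emor_eqI) (auto simp: push1_normal push0_normal cell_closure FA_comp)
qed

theorem two_functor_pushforward:
  "two_functor (Cat_enriched A M) (Cat_enriched B N) (pushforward F l B)"
proof (intro two_functor.intro two_category_Cat_enriched)
  let ?K = "Cat_enriched A M" and ?L = "Cat_enriched B N"
  show "cat_functor (cat01 ?K) (cat01 ?L) \<lparr>FO = F0 (pushforward F l B), FA = F1 (pushforward
      F l B)\<rparr>"
    by (intro cat_functorI Cat_enriched_cat01)
      (auto simp: hom_def enriched_category_push push0_normal enriched_functor_push push1_normal
        push1_id push1_comp)
  show "cat_functor (cat12 ?K) (cat12 ?L) \<lparr>FO = F1 (pushforward F l B), FA = F2 (pushforward
      F l B)\<rparr>"
    by (intro cat_functorI Cat_enriched_cat12)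
      (auto simp: hom_def enriched_functor_push push1_normal enriched_trans_push push2_normal
        cell_closure intro!: etrans_eqI)
  show "cat_functor (cat02 ?K) (cat02 ?L) \<lparr>FO = F0 (pushforward F l B), FA = F2 (pushforward
      F l B)\<rparr>"
    by (intro cat_functorI Cat_enriched_cat02)
      (auto simp: hom_def enriched_category_push push0_normal enriched_trans_push push2_normal
        cell_closure cell_components push1_id push1_comp intro!: etrans_eqI)
qed

end

section \<open>Powers of 2-categories\<close>

lemma pow_two_cat_simps [simp]:
  "Cell0 (pow_two_cat n K) = lists_of n (Cell0 K)" "Cell1 (pow_two_cat n K) = lists_of n (Cell1 K)"
  "Cell2 (pow_two_cat n K) = lists_of n (Cell2 K)" "Src1 (pow_two_cat n K) = map (Src1 K)"
  "Tgt1 (pow_two_cat n K) = map (Tgt1 K)" "Id1 (pow_two_cat n K) = map (Id1 K)"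
  "Comp1 (pow_two_cat n K) = map2 (Comp1 K)" "Src2 (pow_two_cat n K) = map (Src2 K)"
  "Tgt2 (pow_two_cat n K) = map (Tgt2 K)" "Id2 (pow_two_cat n K) = map (Id2 K)"
  "VComp (pow_two_cat n K) = map2 (VComp K)" "HComp (pow_two_cat n K) = map2 (HComp K)"
  by (simp_all add: pow_two_cat_def)

text \<open>Taking powers commutes with passing to the three underlying categories, so category and
  functor axioms for powers of 2-categories reduce to facts about \<open>pow_cat\<close>.\<close>

lemma cat_of_pow_two_cat [simp]:
  "cat01 (pow_two_cat n K) = pow_cat n (cat01 K)" "cat12 (pow_two_cat n K) = pow_cat n (cat12 K)"
  "cat02 (pow_two_cat n K) = pow_cat n (cat02 K)"
  by (auto simp: cat01_def cat12_def cat02_def pow_cat_def)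

lemma two_category_pow:
  assumes "two_category K"
  shows "two_category (pow_two_cat n K)"
proof -
  interpret two_category K by fact
  show ?thesis
    by (intro two_category.intro two_category_axioms.intro)
      (auto simp: category_pow C01.category C12.category C02.category lists_of_nth map_eq_nth
        list_eq_iff_nth_eq globular hcomp_bounds hcomp_id interchange simp del: lists_of_iff)
qed

lemma two_comp_simps [simp]:
  "F0 (G \<circ>\<^sub>2 F) x = F0 G (F0 F x)" "F1 (G \<circ>\<^sub>2 F) f = F1 G (F1 F f)" "F2 (G
      \<circ>\<^sub>2 F) a = F2 G (F2 F a)"
  by (simp_all add: two_comp_def)

lemma two_functor_comp:
  assumes "two_functor K L F" "two_functor L L' G"
  shows "two_functor K L' (G \<circ>\<^sub>2 F)"
proof -
  interpret F: two_functor K L F by fact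
  interpret G: two_functor L L' G by fact
  show ?thesis
    using cat_functor_comp[OF F.F01.cat_functor G.F01.cat_functor]
      cat_functor_comp[OF F.F12.cat_functor G.F12.cat_functor]
      cat_functor_comp[OF F.F02.cat_functor G.F02.cat_functor]
    by (intro two_functor.intro F.S.two_category_axioms G.T.two_category_axioms)
      (simp_all add: ftr_comp_def two_comp_def)
qed

text \<open>Stated for plain categories because a nested 2-functor needs it three times, once for
  each of \<open>cat01\<close>, \<open>cat12\<close> and \<open>cat02\<close>. Inner and outer
  operation have different arities and are therefore separate arguments.\<close>

lemma cat_functor_nest:
  assumes "category C" "cat_functor (pow_cat k C) C T" "cat_functor (pow_cat (i + 1 + j) C) C T'"
  shows "cat_functor (pow_cat (i + k + j) C) C
    \<lparr>FO = blocks i k (\<lambda>xs ys zs. FO T' (xs @ [FO T ys] @ zs)),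
     FA = blocks i k (\<lambda>fs gs hs. FA T' (fs @ [FA T gs] @ hs))\<rparr>"
proof -
  interpret C: category C by fact
  interpret T: cat_functor "pow_cat k C" C T by fact
  interpret T': cat_functor "pow_cat (i + 1 + j) C" C T' by fact
  show ?thesis
  proof (rule cat_functorI, goal_cases)
    case (3 ws)
    then have "length ws = i + k + j" by simp
    then obtain xs ys zs where [simp]: "ws = xs @ ys @ zs" "length xs = i" "length ys = k" "length
        zs = j"
      by (rule list_blocks)
    show ?case using 3 T'.FO_obj[of "xs @ [FO T ys] @ zs"] by simp
  next
    case (4 ws)
    then have "length ws = i + k + j" by simp
    then obtain xs ys zs where [simp]: "ws = xs @ ys @ zs" "length xs = i" "length ys = k" "length
        zs = j"
      by (rule list_blocks)
    show ?case using 4 T'.FA_arr[of "xs @ [FA T ys] @ zs"] T'.FA_dom[of "xs @ [FA T ys] @ zs"]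
      T'.FA_cod[of "xs @ [FA T ys] @ zs"] T.FA_dom[of ys] T.FA_cod[of ys]
      by (simp add: hom_def)
  next
    case (5 ws)
    then have "length ws = i + k + j" by simp
    then obtain xs ys zs where [simp]: "ws = xs @ ys @ zs" "length xs = i" "length ys = k" "length
        zs = j"
      by (rule list_blocks)
    show ?case using 5 T'.FA_id[of "xs @ [FO T ys] @ zs"] T.FA_id[of ys]
      by simp
  next
    case (6 fs gs)
    then have "length fs = i + k + j" by simp
    then obtain xs ys zs where fs [simp]: "fs = xs @ ys @ zs" "length xs = i" "length ys = k"
        "length zs = j"
      by (rule list_blocks)
    from 6 have "length gs = i + k + j" by simp
    then obtain xs' ys' zs' where gs [simp]: "gs = xs' @ ys' @ zs'" "length xs' = i" "length ys' =
        k" "length zs' = j"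
      by (rule list_blocks)
    have e: "map (Dom C) xs' = map (Cod C) xs" "map (Dom C) ys' = map (Cod C) ys" "map (Dom C) zs'
        = map (Cod C) zs"
      using 6 by simp_all
    show ?case using 6 e T.FA_comp[of ys ys'] T'.FA_comp[of "xs @ [FA T ys] @ zs" "xs' @ [FA T ys']
        @ zs'"]
      T.FA_dom[of ys'] T.FA_cod[of ys]
      by simp
  qed (simp_all add: category_pow C.category)
qed

lemma two_functor_nest:
  assumes "\<And>n. two_functor (pow_two_cat n K) K (T n)"
  shows "two_functor (pow_two_cat (i + k + j) K) K (two_nest i k j T)"
proof -
  interpret T: two_functor "pow_two_cat n K" K "T n" for n by fact
  show ?thesis
    using cat_functor_nest[OF T.T.C01.category T.F01.cat_functor[of k, simplified]
        T.F01.cat_functor[of "i + 1 + j", unfolded cat_of_pow_two_cat]]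
      cat_functor_nest[OF T.T.C12.category T.F12.cat_functor[of k, simplified] T.F12.cat_functor[of
          "i + 1 + j", unfolded cat_of_pow_two_cat]]
      cat_functor_nest[OF T.T.C02.category T.F02.cat_functor[of k, simplified] T.F02.cat_functor[of
          "i + 1 + j", unfolded cat_of_pow_two_cat]]
    by (intro two_functor.intro two_category_pow T.T.two_category_axioms)
      (simp_all add: two_nest_def)
qed

section \<open>Products of encoded tuples\<close>

locale tuple_coding =
  fixes tupO :: "'o list \<Rightarrow> 'o" and tupA :: "'a list \<Rightarrow> 'a"
  assumes inj_tupO: "inj tupO" and inj_tupA: "inj tupA"
begin

lemma tup_simps [simp]: "inv tupO (tupO xs) = xs" "inv tupA (tupA fs) = fs"
  "tupO xs = tupO ys \<longleftrightarrow> xs = ys" "tupA fs = tupA gs \<longleftrightarrow> fs =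
      gs"
  using inj_tupO inj_tupA by (auto dest: injD)

abbreviation sprod where "sprod \<equiv> small_prod tupO tupA"

text \<open>By injectivity of the encodings, a code lies in the product exactly when the tuple that
  it encodes does.\<close>

lemma tupO_in_sprod [simp]:
    "tupO xs \<in> Obj (sprod Cs) \<longleftrightarrow> length xs = length Cs \<and>
        (\<forall>i<length Cs. xs ! i \<in> Obj (Cs ! i))"
  and tupA_in_sprod [simp]:
    "tupA fs \<in> Arr (sprod Cs) \<longleftrightarrow> length fs = length Cs \<and>
        (\<forall>i<length Cs. fs ! i \<in> Arr (Cs ! i))"
  by (auto simp: small_prod_def Let_def list_all2_conv_all_nth)

lemma Obj_sprodE:
  assumes "x \<in> Obj (sprod Cs)"
  obtains xs where "x = tupO xs" "length xs = length Cs" "\<And>i. i < length Cs \<Longrightarrow>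
      xs ! i \<in> Obj (Cs ! i)"
  using assms by (auto simp: small_prod_def Let_def list_all2_conv_all_nth)

lemma Arr_sprodE:
  assumes "f \<in> Arr (sprod Cs)"
  obtains fs where "f = tupA fs" "length fs = length Cs" "\<And>i. i < length Cs \<Longrightarrow>
      fs ! i \<in> Arr (Cs ! i)"
  using assms by (auto simp: small_prod_def Let_def list_all2_conv_all_nth)

text \<open>Brings zips into the form indexed by \<open>[0..<n]\<close>, the common shape in which
  entries of product tuples are compared.\<close>

lemma map2_upt: "length ys = length xs \<Longrightarrow> map2 f xs ys = map (\<lambda>i. f (xs ! i)
    (ys ! i)) [0..<length xs]"
  by (rule nth_equalityI) simp_all

lemma Dom_sprod [simp]: "tupA fs \<in> Arr (sprod Cs) \<Longrightarrow>
      Dom (sprod Cs) (tupA fs) = tupO (map (\<lambda>i. Dom (Cs ! i) (fs ! i)) [0..<length Cs])"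
  and Cod_sprod [simp]: "tupA fs \<in> Arr (sprod Cs) \<Longrightarrow>
      Cod (sprod Cs) (tupA fs) = tupO (map (\<lambda>i. Cod (Cs ! i) (fs ! i)) [0..<length Cs])"
  and Id_sprod [simp]: "tupO xs \<in> Obj (sprod Cs) \<Longrightarrow>
      Id (sprod Cs) (tupO xs) = tupA (map (\<lambda>i. Id (Cs ! i) (xs ! i)) [0..<length Cs])"
  unfolding tupO_in_sprod tupA_in_sprod
  by (auto simp: small_prod_def Let_def list_all2_conv_all_nth map2_upt)

lemma Comp_sprod [simp]:
  assumes "length fs = length Cs" "\<forall>i<length Cs. fs ! i \<in> Arr (Cs ! i)"
    "length gs = length Cs" "\<forall>i<length Cs. gs ! i \<in> Arr (Cs ! i)"
    "\<forall>i<length Cs. Dom (Cs ! i) (gs ! i) = Cod (Cs ! i) (fs ! i)"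
  shows "Comp (sprod Cs) (tupA gs) (tupA fs)
    = tupA (map (\<lambda>i. Comp (Cs ! i) (gs ! i) (fs ! i)) [0..<length Cs])"
proof -
  have "map2 Dom Cs gs = map2 Cod Cs fs" using assms by (simp add: map2_upt)
  moreover have "list_all2 (\<lambda>C f. f \<in> Arr C) Cs gs" "list_all2 (\<lambda>C f. f \<in>
      Arr C) Cs fs"
    using assms by (auto simp: list_all2_conv_all_nth)
  ultimately show ?thesis
    by (auto simp: small_prod_def Let_def)
qed

text \<open>The tuples for \<open>x\<close> and \<open>y\<close> are read off from the arrow, whose
  domain and codomain are codes by construction.\<close>

lemma hom_sprodE:
  assumes "f \<in> hom (sprod Cs) x y" "\<And>C. C \<in> set Cs \<Longrightarrow> category C"
  obtains fs xs ys where "f = tupA fs" "x = tupO xs" "y = tupO ys"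
    "length fs = length Cs" "length xs = length Cs" "length ys = length Cs"
    "\<And>i. i < length Cs \<Longrightarrow> fs ! i \<in> hom (Cs ! i) (xs ! i) (ys ! i)"
proof -
  from assms have f: "f \<in> Arr (sprod Cs)" and xy: "Dom (sprod Cs) f = x" "Cod (sprod Cs) f = y"
    by (auto simp: hom_def)
  from f obtain fs where "f = tupA fs" "length fs = length Cs" "\<And>i. i < length Cs
      \<Longrightarrow> fs ! i \<in> Arr (Cs ! i)"
    by (rule Arr_sprodE) blast
  with xy show thesis
    by (intro that[of fs "map (\<lambda>i. Dom (Cs ! i) (fs ! i)) [0..<length Cs]"
      "map (\<lambda>i. Cod (Cs ! i) (fs ! i)) [0..<length Cs]"]) (simp_all add: hom_def)
qed

lemma tupA_hom [simp]:
  assumes "length fs = length Cs" "length xs = length Cs" "length ys = length Cs"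
    "\<And>i. i < length Cs \<Longrightarrow> fs ! i \<in> hom (Cs ! i) (xs ! i) (ys ! i)"
  shows "tupA fs \<in> hom (sprod Cs) (tupO xs) (tupO ys)"
  using assms by (auto simp: hom_def intro!: nth_equalityI)

lemma category_sprod:
  assumes "\<And>C. C \<in> set Cs \<Longrightarrow> category C"
  shows "category (sprod Cs)"
proof -
  have C: "category (Cs ! i)" if "i < length Cs" for i
    using assms that by simp
  note facts = C[THEN category.dom_obj] C[THEN category.cod_obj] C[THEN category.id_arr]
    C[THEN category.id_dom] C[THEN category.id_cod] C[THEN category.comp_id_left] C[THEN
        category.comp_id_right]
    C[THEN category.comp_arr] C[THEN category.comp_dom] C[THEN category.comp_cod] C[THEN
        category.assoc]
  \<comment> \<open>The unit laws end in tuples rebuilt index by index; this identifies them with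
    the original lists.\<close>
  have eqI: "map g [0..<length Cs] = xs" if "length xs = length Cs" "\<And>i. i < length Cs
      \<Longrightarrow> g i = xs ! i"
    for g and xs :: "'z list"
    using that by (intro nth_equalityI) simp_all
  show ?thesis
  proof (rule categoryI, goal_cases)
    case (1 f)
    then show ?case by (rule Arr_sprodE) (simp add: facts)
  next
    case (2 f)
    then show ?case by (rule Arr_sprodE) (simp add: facts)
  next
    case (3 x)
    then show ?case by (rule Obj_sprodE) (simp add: facts eqI)
  next
    case (4 f g)
    from 4(1) obtain fs where [simp]: "f = tupA fs" and fs: "length fs = length Cs"
      "\<And>i. i < length Cs \<Longrightarrow> fs ! i \<in> Arr (Cs ! i)" by (rule Arr_sprodE)
          blast
    from 4(2) obtain gs where [simp]: "g = tupA gs" and gs: "length gs = length Cs"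
      "\<And>i. i < length Cs \<Longrightarrow> gs ! i \<in> Arr (Cs ! i)" by (rule Arr_sprodE)
          blast
    have "\<forall>i<length Cs. Dom (Cs ! i) (gs ! i) = Cod (Cs ! i) (fs ! i)"
      using 4(3) fs gs by simp
    then show ?case using fs gs by (simp add: facts)
  next
    case (5 f)
    then show ?case by (rule Arr_sprodE) (simp add: facts eqI)
  next
    case (6 f)
    then show ?case by (rule Arr_sprodE) (simp add: facts eqI)
  next
    case (7 f g h)
    from 7(1) obtain fs where [simp]: "f = tupA fs" and fs: "length fs = length Cs"
      "\<And>i. i < length Cs \<Longrightarrow> fs ! i \<in> Arr (Cs ! i)" by (rule Arr_sprodE)
          blast
    from 7(2) obtain gs where [simp]: "g = tupA gs" and gs: "length gs = length Cs"
      "\<And>i. i < length Cs \<Longrightarrow> gs ! i \<in> Arr (Cs ! i)" by (rule Arr_sprodE)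
          blast
    from 7(3) obtain hs where [simp]: "h = tupA hs" and hs: "length hs = length Cs"
      "\<And>i. i < length Cs \<Longrightarrow> hs ! i \<in> Arr (Cs ! i)" by (rule Arr_sprodE)
          blast
    have "\<forall>i<length Cs. Dom (Cs ! i) (gs ! i) = Cod (Cs ! i) (fs ! i)"
      "\<forall>i<length Cs. Dom (Cs ! i) (hs ! i) = Cod (Cs ! i) (gs ! i)"
      using 7(4,5) fs gs hs by simp_all
    then show ?case using fs gs hs by (simp add: facts)
  qed
qed

text \<open>The product is restricted by construction; this supplies the clauses of
  \<open>ecat_normal\<close> that concern the underlying category.\<close>

lemma sprod_normal:
  "Dom (sprod Cs) \<in> extensional (Arr (sprod Cs))" "Cod (sprod Cs) \<in> extensional (Arr (sprod
      Cs))"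
  "Id (sprod Cs) \<in> extensional (Obj (sprod Cs))"
  "\<not> (f \<in> Arr (sprod Cs) \<and> g \<in> Arr (sprod Cs) \<and> Dom (sprod Cs) g = Cod
      (sprod Cs) f)
    \<Longrightarrow> Comp (sprod Cs) g f = undefined"
  by (auto simp: small_prod_def Let_def)

end

section \<open>The external product is a 2-functor\<close>

lemma map2_map_upt [simp]:
  "map2 f (map g [0..<n]) (map h [0..<n]) = map (\<lambda>i. f (g i) (h i)) [0..<n]"
  by (rule nth_equalityI) simp_all

lemma map_upt_eqI: "\<lbrakk>length xs = n; \<And>i. i < n \<Longrightarrow> g i = xs ! i\<rbrakk>
    \<Longrightarrow> map g [0..<n] = xs"
  by (intro nth_equalityI) simp_all

section \<open>External products of enriched categories, functors and transformations, index by
  index\<close>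

context tuple_coding
begin

lemma box0_ucat [simp]: "ucat (box0 tupO tupA Es) = sprod (map ucat Es)"
  by (simp add: box0_def Let_def)

lemma box0_simps [simp]:
  "\<lbrakk>length xs = length Es; length ys = length Es; \<forall>i<length Es. xs ! i \<in> eobj
      (Es ! i);
    \<forall>i<length Es. ys ! i \<in> eobj (Es ! i)\<rbrakk> \<Longrightarrow>
    hO (box0 tupO tupA Es) (tupO xs) (tupO ys) = map (\<lambda>i. hO (Es ! i) (xs ! i) (ys ! i))
        [0..<length Es]"
  "\<lbrakk>length fs = length Es; length gs = length Es; \<forall>i<length Es. fs ! i \<in> earr
      (Es ! i);
    \<forall>i<length Es. gs ! i \<in> earr (Es ! i)\<rbrakk> \<Longrightarrow>
    hA (box0 tupO tupA Es) (tupA fs) (tupA gs) = map (\<lambda>i. hA (Es ! i) (fs ! i) (gs ! i))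
        [0..<length Es]"
  "\<lbrakk>length xs = length Es; \<forall>i<length Es. xs ! i \<in> eobj (Es ! i)\<rbrakk>
      \<Longrightarrow>
    eta (box0 tupO tupA Es) (tupO xs) = map (\<lambda>i. eta (Es ! i) (xs ! i)) [0..<length Es]"
  "\<lbrakk>length xs = length Es; length ys = length Es; length zs = length Es;
    \<forall>i<length Es. xs ! i \<in> eobj (Es ! i); \<forall>i<length Es. ys ! i \<in> eobj (Es !
        i);
    \<forall>i<length Es. zs ! i \<in> eobj (Es ! i)\<rbrakk> \<Longrightarrow>
    mu (box0 tupO tupA Es) (tupO xs, tupO ys, tupO zs)
      = map (\<lambda>i. mu (Es ! i) (xs ! i, ys ! i, zs ! i)) [0..<length Es]"
  by (simp_all add: box0_def Let_def)

lemma box0_normal: "ecat_normal (box0 tupO tupA Es)"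
  unfolding ecat_normal_def box0_ucat
  by (intro conjI allI impI sprod_normal) (simp_all add: box0_def Let_def)

lemma eobj_boxE:
  assumes "x \<in> Obj (sprod (map ucat Es))"
  obtains xs where "x = tupO xs" "length xs = length Es" "\<forall>i<length Es. xs ! i \<in> eobj
      (Es ! i)"
  using Obj_sprodE[OF assms] by (metis length_map nth_map)

lemma earr_boxE:
  assumes "f \<in> Arr (sprod (map ucat Es))"
  obtains fs where "f = tupA fs" "length fs = length Es" "\<forall>i<length Es. fs ! i \<in> earr
      (Es ! i)"
  using Arr_sprodE[OF assms] by (metis length_map nth_map)

lemma hom_boxE:
  assumes "f \<in> hom (sprod (map ucat Es)) x y" "\<forall>E\<in>set Es. enriched_category V M E"
  obtains fs xs ys where "f = tupA fs" "x = tupO xs" "y = tupO ys"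
    "length fs = length Es" "length xs = length Es" "length ys = length Es"
    "\<forall>i<length Es. fs ! i \<in> hom (ucat (Es ! i)) (xs ! i) (ys ! i)"
    "\<forall>i<length Es. fs ! i \<in> earr (Es ! i)" "\<forall>i<length Es. xs ! i \<in> eobj (Es
        ! i)"
    "\<forall>i<length Es. ys ! i \<in> eobj (Es ! i)" "\<forall>i<length Es. Dom (ucat (Es ! i))
        (fs ! i) = xs ! i"
    "\<forall>i<length Es. Cod (ucat (Es ! i)) (fs ! i) = ys ! i"
proof -
  have C: "category C" if "C \<in> set (map ucat Es)" for C
    using that assms(2) enriched_category.ucat_category by auto
  obtain fs xs ys where fs: "f = tupA fs" "x = tupO xs" "y = tupO ys"
    "length fs = length Es" "length xs = length Es" "length ys = length Es"
    "\<And>i. i < length Es \<Longrightarrow> fs ! i \<in> hom (ucat (Es ! i)) (xs ! i) (ys ! i)"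
    by (rule hom_sprodE[OF assms(1) C]) simp_all
  have "fs ! i \<in> earr (Es ! i) \<and> xs ! i \<in> eobj (Es ! i) \<and> ys ! i \<in> eobj (Es !
      i) \<and>
     Dom (ucat (Es ! i)) (fs ! i) = xs ! i \<and> Cod (ucat (Es ! i)) (fs ! i) = ys ! i" if "i <
         length Es" for i
    using fs(7)[OF that] C[of "ucat (Es ! i)"] that
      category.dom_obj[of "ucat (Es ! i)" "fs ! i"] category.cod_obj[of "ucat (Es ! i)" "fs ! i"]
    by (simp add: hom_def)
  with fs show thesis by (intro that[of fs xs ys]) simp_all
qed

end

text \<open>That the componentwise structure on the power is oplax monoidal is a hypothesis here;
  for a duoidal category it comes with the lax functor given by \<open>chi n\<close>, whose source
  is this power.\<close>

locale enriched_box = tuple_coding tupO tupA + base: oplax_monoidal V M +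
  pow: oplax_monoidal "pow_cat n V" "pow_mon n M"
  for tupO :: "'o list \<Rightarrow> 'o" and tupA :: "'a list \<Rightarrow> 'a"
    and V :: "('p, 'b) cat" and M :: "('p, 'b) mon" and n :: nat
begin

text \<open>Every law is the list of the corresponding laws of the factors. The tensor of the power
  receives a list of \<open>n\<close>-tuples, which \<open>columns_def\<close> transposes into one
  argument list for each factor.\<close>

lemma enriched_category_box:
  fixes Es :: "('o, 'a, 'p, 'b) ecat list"
  assumes Es: "\<forall>E\<in>set Es. enriched_category V M E" and n: "length Es = n"
  shows "enriched_category (pow_cat n V) (pow_mon n M) (box0 tupO tupA Es)"
proof -
  have E: "enriched_category V M (Es ! i)" if "i < n" for i
    using Es n that by simp
  note U = E[THEN enriched_category.ucat_category]
  note facts = E[THEN enriched_category.hO_obj] E[THEN enriched_category.hA_arr]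
    E[THEN enriched_category.hA_dom] E[THEN enriched_category.hA_cod] E[THEN
        enriched_category.hA_id]
    E[THEN enriched_category.hA_comp] E[THEN enriched_category.eta_arr]
    E[THEN enriched_category.eta_dom] E[THEN enriched_category.eta_cod]
    E[THEN enriched_category.mu_arr] E[THEN enriched_category.mu_dom] E[THEN
        enriched_category.mu_cod]
    U[THEN category.dom_obj] U[THEN category.cod_obj] U[THEN category.id_arr]
    U[THEN category.id_dom] U[THEN category.id_cod] U[THEN category.comp_arr] U[THEN
        category.comp_dom]
    U[THEN category.comp_cod]
  have C: "category C" if "C \<in> set (map ucat Es)" for C
    using that Es enriched_category.ucat_category by auto
  have P: "category (sprod (map ucat Es))" by (intro category_sprod C)
  have hom: "cat_functor (prod_cat (op_cat (sprod (map ucat Es))) (sprod (map ucat Es)))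
      (pow_cat n V) (ehom (box0 tupO tupA Es))"
  proof (rule cat_functorI, goal_cases)
    case (3 x)
    then show ?case using n
      by (auto elim!: eobj_boxE simp: facts)
  next
    case (4 f)
    then show ?case using n
      by (auto elim!: earr_boxE simp: facts hom_def)
  next
    case (5 x)
    then show ?case using n
      by (auto elim!: eobj_boxE simp: facts)
  next
    case (6 f g)
    obtain fs hs where [simp]: "f = (tupA fs, tupA hs)" and f: "length fs = n" "length hs = n"
       "\<forall>i<n. fs ! i \<in> earr (Es ! i)" "\<forall>i<n. hs ! i \<in> earr (Es ! i)"
      using 6(1) n by (auto elim!: earr_boxE)
    obtain fs' hs' where [simp]: "g = (tupA fs', tupA hs')" and g: "length fs' = n" "length hs' = n"
       "\<forall>i<n. fs' ! i \<in> earr (Es ! i)" "\<forall>i<n. hs' ! i \<in> earr (Es ! i)"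
      using 6(2) n by (auto elim!: earr_boxE)
    \<comment> \<open>In the contravariant first variable composability runs the other way, so the
      primed and unprimed tuples change roles.\<close>
    have "\<forall>i<n. Dom (ucat (Es ! i)) (hs' ! i) = Cod (ucat (Es ! i)) (hs ! i)"
      "\<forall>i<n. Dom (ucat (Es ! i)) (fs ! i) = Cod (ucat (Es ! i)) (fs' ! i)"
      using 6(3) f g n by simp_all
    then show ?case using f g n by (simp add: facts)
  qed (simp_all add: category_prod category_op P category_pow base.category)
  show ?thesis
  proof (intro enriched_category.intro enriched_category_axioms.intro pow.oplax_monoidal,
      goal_cases)
    case 1
    then show ?case using hom by simp
  next
    case 2
    then show ?case using P by simp
  next
    case (3 x)
    then show ?case using n
      by (auto elim!: eobj_boxE simp: facts hom_def pow_mon_def columns_def)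
  next
    case (4 f x y)
    then show ?case unfolding box0_ucat
      using n E[THEN enriched_category.eta_extranatural] by (auto elim!: hom_boxE[OF _ Es] simp:
          facts)
  next
    case (5 x y z)
    then show ?case using n
      by (auto elim!: eobj_boxE simp: facts hom_def pow_mon_def columns_def)
  next
    case (6 f x' x y h z z')
    then show ?case unfolding box0_ucat
      using n E[THEN enriched_category.mu_natural]
      by (auto elim!: hom_boxE[OF _ Es] eobj_boxE simp: facts pow_mon_def columns_def)
  next
    case (7 x g y y' z)
    then show ?case unfolding box0_ucat
      using n E[THEN enriched_category.mu_extranatural]
      by (auto elim!: hom_boxE[OF _ Es] eobj_boxE simp: facts pow_mon_def columns_def)
  next
    case (8 w x y z)
    then show ?case unfolding box0_ucat
      using n E[THEN enriched_category.mu_assoc]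
      by (auto elim!: eobj_boxE simp: facts pow_mon_def columns_def)
  next
    case (9 x y)
    then show ?case unfolding box0_ucat
      using n E[THEN enriched_category.mu_unit_left]
      by (auto elim!: eobj_boxE simp: facts pow_mon_def columns_def)
  next
    case (10 x y)
    then show ?case unfolding box0_ucat
      using n E[THEN enriched_category.mu_unit_right]
      by (auto elim!: eobj_boxE simp: facts pow_mon_def columns_def)
  qed
qed

end

context tuple_coding
begin

lemma box1_simps [simp]:
  "msrc (box1 tupO tupA Fs) = box0 tupO tupA (map msrc Fs)"
  "mtgt (box1 tupO tupA Fs) = box0 tupO tupA (map mtgt Fs)"
  "\<lbrakk>length xs = length Fs; \<forall>i<length Fs. xs ! i \<in> eobj (msrc (Fs ! i))\<rbrakk>
      \<Longrightarrow>
    FO (mfun (box1 tupO tupA Fs)) (tupO xs) = tupO (map (\<lambda>i. FO (mfun (Fs ! i)) (xs ! i))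
        [0..<length Fs])"
  "\<lbrakk>length fs = length Fs; \<forall>i<length Fs. fs ! i \<in> earr (msrc (Fs ! i))\<rbrakk>
      \<Longrightarrow>
    FA (mfun (box1 tupO tupA Fs)) (tupA fs) = tupA (map (\<lambda>i. FA (mfun (Fs ! i)) (fs ! i))
        [0..<length Fs])"
  "\<lbrakk>length xs = length Fs; length ys = length Fs; \<forall>i<length Fs. xs ! i \<in> eobj
      (msrc (Fs ! i));
    \<forall>i<length Fs. ys ! i \<in> eobj (msrc (Fs ! i))\<rbrakk> \<Longrightarrow>
    mstr (box1 tupO tupA Fs) (tupO xs, tupO ys) = map (\<lambda>i. mstr (Fs ! i) (xs ! i, ys ! i))
        [0..<length Fs]"
  by (simp_all add: box1_def Let_def map2_upt)

lemma box1_normal: "emor_normal (box1 tupO tupA Fs)"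
  unfolding emor_normal_def box1_simps
  by (intro conjI box0_normal) (simp_all add: box1_def Let_def)

lemma box2_simps [simp]:
  "tsrc (box2 tupO tupA as) = box1 tupO tupA (map tsrc as)"
  "ttgt (box2 tupO tupA as) = box1 tupO tupA (map ttgt as)"
  "\<lbrakk>length xs = length as; \<forall>i<length as. xs ! i \<in> eobj (msrc (tsrc (as !
      i)))\<rbrakk> \<Longrightarrow>
    tcomp (box2 tupO tupA as) (tupO xs) = tupA (map (\<lambda>i. tcomp (as ! i) (xs ! i))
        [0..<length as])"
  by (simp_all add: box2_def Let_def map2_upt)

lemma box2_normal: "etrans_normal (box2 tupO tupA as)"
  unfolding etrans_normal_def box2_simps
  by (intro conjI box1_normal) (simp_all add: box2_def Let_def)

lemma boxprod_simps [simp]: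
  "F0 (boxprod tupO tupA) = box0 tupO tupA" "F1 (boxprod tupO tupA) = box1 tupO tupA"
  "F2 (boxprod tupO tupA) = box2 tupO tupA"
  by (simp_all add: boxprod_def)

lemma emor_eobj_boxE:
  assumes "x \<in> Obj (sprod (map ucat (map f Fs)))"
  obtains xs where "x = tupO xs" "length xs = length Fs" "\<forall>i<length Fs. xs ! i \<in> eobj
      (f (Fs ! i))"
  by (rule eobj_boxE[OF assms]) simp

lemma emor_earr_boxE:
  assumes "g \<in> Arr (sprod (map ucat (map f Fs)))"
  obtains gs where "g = tupA gs" "length gs = length Fs" "\<forall>i<length Fs. gs ! i \<in> earr
      (f (Fs ! i))"
  by (rule earr_boxE[OF assms]) simp

end

context enriched_box
begin

lemma enriched_functor_box:
  fixes Fs :: "('o, 'a, 'p, 'b) emor list"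
  assumes Fs: "\<forall>F\<in>set Fs. enriched_functor V M F" and n: "length Fs = n"
  shows "enriched_functor (pow_cat n V) (pow_mon n M) (box1 tupO tupA Fs)"
proof -
  have F: "enriched_functor V M (Fs ! i)" if "i < n" for i
    using Fs n that by simp
  note U = F[THEN enriched_functor_components(3)]
  note S = F[THEN enriched_functor_components(1)] and T = F[THEN enriched_functor_components(2)]
  note facts = S[THEN enriched_category.hO_obj] S[THEN enriched_category.hA_arr]
    S[THEN enriched_category.hA_dom] S[THEN enriched_category.hA_cod]
    F[THEN enriched_functor.str_arr] F[THEN enriched_functor.str_dom] F[THEN
        enriched_functor.str_cod]
    U[THEN cat_functor.FO_obj] U[THEN cat_functor.FA_arr] U[THEN cat_functor.FA_dom]
    U[THEN cat_functor.FA_cod] U[THEN cat_functor.FA_id] U[THEN cat_functor.FA_comp]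
  have sE: "\<forall>E\<in>set (map msrc Fs). enriched_category V M E" and tE: "\<forall>E\<in>set
      (map mtgt Fs). enriched_category V M E"
    using Fs by (auto simp: enriched_functor_components)
  have sC: "category C" if "C \<in> set (map ucat (map msrc Fs))" for C
    using that sE enriched_category.ucat_category by auto
  have tC: "category C" if "C \<in> set (map ucat (map mtgt Fs))" for C
    using that tE enriched_category.ucat_category by auto
  note idf = S[THEN enriched_category.ucat_category, THEN category.id_arr]
    S[THEN enriched_category.ucat_category, THEN category.dom_obj]
    S[THEN enriched_category.ucat_category, THEN category.cod_obj]
    S[THEN enriched_category.ucat_category, THEN category.comp_arr]
  have func: "cat_functor (sprod (map ucat (map msrc Fs))) (sprod (map ucat (map mtgt Fs))) (mfun
      (box1 tupO tupA Fs))"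
  proof (rule cat_functorI, goal_cases)
    case 1
    show ?case by (intro category_sprod sC)
  next
    case 2
    show ?case by (intro category_sprod tC)
  next
    case (3 x)
    then show ?case using n
      by (elim emor_eobj_boxE) (auto simp: facts)
  next
    case (4 f)
    then show ?case using n
      by (elim emor_earr_boxE) (auto simp: facts idf hom_def)
  next
    case (5 x)
    then show ?case using n
      by (elim emor_eobj_boxE) (auto simp: facts idf)
  next
    case (6 f g)
    obtain fs where [simp]: "f = tupA fs" and f: "length fs = n"
       "\<forall>i<n. fs ! i \<in> earr (msrc (Fs ! i))"
      using 6(1) n by (auto elim!: emor_earr_boxE simp del: map_map)
    obtain gs where [simp]: "g = tupA gs" and g: "length gs = n"
       "\<forall>i<n. gs ! i \<in> earr (msrc (Fs ! i))"
      using 6(2) n by (auto elim!: emor_earr_boxE simp del: map_map)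
    have "\<forall>i<n. Dom (ucat (msrc (Fs ! i))) (gs ! i) = Cod (ucat (msrc (Fs ! i))) (fs ! i)"
      using 6(3) f g n by simp
    then show ?case using f g n by (simp add: facts idf)
  qed
  show ?thesis
  proof (rule enriched_functorI, goal_cases)
    case 1
    show ?case using enriched_category_box[OF sE] n by simp
  next
    case 2
    show ?case using enriched_category_box[OF tE] n by simp
  next
    case 3
    show ?case using func by simp
  next
    case (4 x y)
    then show ?case using n unfolding box0_ucat box1_simps
      by (elim emor_eobj_boxE) (auto simp: facts hom_def)
  next
    case (5 f h x x' y y')
    then show ?case using n F[THEN enriched_functor.str_nat] unfolding box0_ucat box1_simps
      by (elim hom_boxE[OF _ sE]) (auto simp: facts)
  next
    case (6 x)
    then show ?case using n F[THEN enriched_functor.str_eta] unfolding box0_ucat box1_simps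
      by (elim emor_eobj_boxE) (auto simp: facts)
  next
    case (7 x y z)
    then show ?case using n F[THEN enriched_functor.str_mu] unfolding box0_ucat box1_simps
      by (elim emor_eobj_boxE) (auto simp: facts pow_mon_def columns_def)
  qed
qed

lemma enriched_trans_box:
  fixes as :: "('o, 'a, 'p, 'b) etrans list"
  assumes as: "\<forall>a\<in>set as. enriched_trans V M a" and n: "length as = n"
  shows "enriched_trans (pow_cat n V) (pow_mon n M) (box2 tupO tupA as)"
proof -
  have a: "enriched_trans V M (as ! i)" if "i < n" for i
    using as n that by simp
  \<comment> \<open>Entrywise parallelism gives equal lists of endpoints, which makes the two
    product functors parallel.\<close>
  have par: "map msrc (map ttgt as) = map msrc (map tsrc as)" "map mtgt (map ttgt as) = map mtgt
      (map tsrc as)"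
    using as by (auto simp: etrans_components)
  note S = a[THEN etrans_components(1)] and T = a[THEN etrans_components(2)]
  note pars = a[THEN etrans_components(3)] a[THEN etrans_components(4)]
  note U = S[THEN enriched_functor_components(3)] and W = T[THEN enriched_functor_components(3)]
  note C = S[THEN enriched_functor_components(2), THEN enriched_category.ucat_category]
  note comp = a[THEN enriched_trans.tcomp_hom]
  have comps: "tcomp (as ! i) x \<in> earr (mtgt (tsrc (as ! i)))"
    "Dom (ucat (mtgt (tsrc (as ! i)))) (tcomp (as ! i) x) = FO (mfun (tsrc (as ! i))) x"
    "Cod (ucat (mtgt (tsrc (as ! i)))) (tcomp (as ! i) x) = FO (mfun (ttgt (as ! i))) x"
    if "i < n" "x \<in> eobj (msrc (tsrc (as ! i)))" for i x
    using comp[OF that] by (simp_all add: hom_def)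
  have ttgts: "FO (mfun (ttgt (as ! i))) x \<in> eobj (mtgt (tsrc (as ! i)))"
    if "i < n" "x \<in> eobj (msrc (tsrc (as ! i)))" for i x
    using W[THEN cat_functor.FO_obj, OF that(1), of x] that pars by simp
  have ttgta: "FA (mfun (ttgt (as ! i))) f \<in> earr (mtgt (tsrc (as ! i)))"
    "Dom (ucat (mtgt (tsrc (as ! i)))) (FA (mfun (ttgt (as ! i))) f) = FO (mfun (ttgt (as ! i)))
        (Dom (ucat (msrc (tsrc (as ! i)))) f)"
    if "i < n" "f \<in> earr (msrc (tsrc (as ! i)))" for i f
    using W[THEN cat_functor.FA_arr, OF that(1), of f] W[THEN cat_functor.FA_dom, OF that(1), of f]
      that pars by simp_all
  note facts = pars comps ttgts ttgta U[THEN cat_functor.FO_obj] U[THEN cat_functor.FA_arr] U[THEN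
      cat_functor.FA_cod]
    C[THEN category.id_arr]
  have "\<forall>F\<in>set (map tsrc as). enriched_functor V M F" "\<forall>F\<in>set (map ttgt
      as). enriched_functor V M F"
    using as by (auto simp: etrans_components)
  note F = this[THEN enriched_functor_box]
  have sE: "\<forall>E\<in>set (map msrc (map tsrc as)). enriched_category V M E"
    using as by (auto intro!: enriched_functor_components etrans_components)
  show ?thesis
  proof (rule enriched_transI, goal_cases)
    case 1
    show ?case using F(1) n by simp
  next
    case 2
    show ?case using F(2) n by simp
  next
    case 3
    show ?case unfolding box2_simps box1_simps par ..
  next
    case 4
    show ?case unfolding box2_simps box1_simps par ..
  next
    case (5 x)
    then show ?case using n unfolding box0_ucat box1_simps box2_simps
      by (elim emor_eobj_boxE) (auto intro!: tupA_hom simp: facts comp)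
  next
    case (6 f x y)
    then show ?case using n a[THEN enriched_trans.axioms(3), THEN nat_trans.naturality]
      unfolding box0_ucat box1_simps box2_simps
      by (elim hom_boxE[OF _ sE]) (auto simp: facts)
  next
    case (7 x y)
    then show ?case using n a[THEN enriched_trans.compat]
      unfolding box0_ucat box1_simps box2_simps
      by (elim emor_eobj_boxE) (auto simp: facts)
  qed
qed

text \<open>\<open>box1\<close> and \<open>box2\<close> always produce normal cells, so preservation
  of identities and composites can be checked on encoded tuples, one index at a time.\<close>

theorem two_functor_boxprod:
  "two_functor (pow_two_cat n (Cat_enriched V M :: (('o, 'a, 'p, 'b) ecat, _, _) two_cat))
    (Cat_enriched (pow_cat n V) (pow_mon n M)) (boxprod tupO tupA)"
proof (intro two_functor.intro two_category_pow two_category_Cat_enriched)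
  let ?K = "Cat_enriched V M :: (('o, 'a, 'p, 'b) ecat, _, _) two_cat"
    and ?L = "Cat_enriched (pow_cat n V) (pow_mon n M) :: (('o, 'a, 'p list, 'b list) ecat, _, _)
        two_cat"
  have ec: "enriched_category (pow_cat n V) (pow_mon n M) (box0 tupO tupA Es)"
    if "Es \<in> lists_of n (Cell0 ?K)" for Es
    using that by (intro enriched_category_box) auto
  have ef: "enriched_functor (pow_cat n V) (pow_mon n M) (box1 tupO tupA Fs)"
    if "Fs \<in> lists_of n (Cell1 ?K)" for Fs
    using that by (intro enriched_functor_box) auto
  have et: "enriched_trans (pow_cat n V) (pow_mon n M) (box2 tupO tupA as)"
    if "as \<in> lists_of n (Cell2 ?K)" for as
    using that by (intro enriched_trans_box) auto
  have id1: "box1 tupO tupA (map (emor_id V) Es) = emor_id (pow_cat n V) (box0 tupO tupA Es)"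
    if "Es \<in> lists_of n (Cell0 ?K)" for Es
  proof (rule emor_eqI)
    fix x assume "x \<in> eobj (msrc (emor_id (pow_cat n V) (box0 tupO tupA Es)))"
    then have "x \<in> Obj (sprod (map ucat Es))" by simp
    then show "FO (mfun (box1 tupO tupA (map (emor_id V) Es))) x = FO (mfun (emor_id (pow_cat n V)
        (box0 tupO tupA Es))) x"
      by (elim eobj_boxE) (simp add: map_upt_eqI)
  next
    fix f assume "f \<in> earr (msrc (emor_id (pow_cat n V) (box0 tupO tupA Es)))"
    then have "f \<in> Arr (sprod (map ucat Es))" by simp
    then show "FA (mfun (box1 tupO tupA (map (emor_id V) Es))) f = FA (mfun (emor_id (pow_cat n V)
        (box0 tupO tupA Es))) f"
      by (elim earr_boxE) (simp add: map_upt_eqI)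
  next
    fix x y assume "x \<in> eobj (msrc (emor_id (pow_cat n V) (box0 tupO tupA Es)))"
      "y \<in> eobj (msrc (emor_id (pow_cat n V) (box0 tupO tupA Es)))"
    then have "x \<in> Obj (sprod (map ucat Es))" "y \<in> Obj (sprod (map ucat Es))" by simp_all
    then show "mstr (box1 tupO tupA (map (emor_id V) Es)) (x, y) = mstr (emor_id (pow_cat n V)
        (box0 tupO tupA Es)) (x, y)"
      by (elim eobj_boxE) simp
  qed (simp_all add: box1_normal box0_normal emor_id_normal comp_def)
  have comp1: "box1 tupO tupA (map2 (emor_comp V) Gs Fs) = emor_comp (pow_cat n V) (box1 tupO tupA
      Gs) (box1 tupO tupA Fs)"
    if Fs: "Fs \<in> lists_of n (Cell1 ?K)" and Gs: "Gs \<in> lists_of n (Cell1 ?K)" and GF: "map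
        msrc Gs = map mtgt Fs"
    for Fs Gs
  proof -
    have n: "length Fs = n" "length Gs = n" using Fs Gs by simp_all
    have F: "enriched_functor V M (Fs ! i)" if "i < n" for i
      using Fs that by (simp add: set_subset_nth)
    note U = F[THEN enriched_functor_components(3)]
    note facts = U[THEN cat_functor.FO_obj] U[THEN cat_functor.FA_arr]
    have e: "msrc (Gs ! i) = mtgt (Fs ! i)" if "i < n" for i
      using GF that n by (metis nth_map)
    have s: "map msrc (map2 (emor_comp V) Gs Fs) = map msrc Fs" "map mtgt (map2 (emor_comp V) Gs
        Fs) = map mtgt Gs"
      using n by (simp_all add: map2_upt map_upt_eqI)
    note r = map2_upt[of Fs Gs "emor_comp V", unfolded n]
    show ?thesis
    proof (rule emor_eqI, goal_cases)
      case (5 x)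
      then have "x \<in> Obj (sprod (map ucat (map msrc Fs)))" by simp
      then show ?case
        using n by (elim emor_eobj_boxE) (auto simp: r e facts)
    next
      case (6 f)
      then have "f \<in> Arr (sprod (map ucat (map msrc Fs)))" by simp
      then show ?case
        using n by (elim emor_earr_boxE) (auto simp: r e facts)
    next
      case (7 x y)
      then have "x \<in> Obj (sprod (map ucat (map msrc Fs)))" "y \<in> Obj (sprod (map ucat (map
          msrc Fs)))" by simp_all
      then show ?case
        using n by (elim emor_eobj_boxE) (auto simp: r e facts)
    qed (simp_all only: box1_simps emor_comp_simps s box1_normal emor_comp_normal)
  qed
  show "cat_functor (cat01 (pow_two_cat n ?K)) (cat01 ?L) \<lparr>FO = F0 (boxprod tupO tupA), FA =
      F1 (boxprod tupO tupA)\<rparr>"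
    using ec ef id1 comp1
    by (intro cat_functorI)
      (auto simp: hom_def category_pow Cat_enriched_cat01 box0_normal box1_normal)
  have id2: "box2 tupO tupA (map etrans_id Fs) = etrans_id (box1 tupO tupA Fs)"
    if Fs: "Fs \<in> lists_of n (Cell1 ?K)" for Fs
  proof -
    have n: "length Fs = n" using Fs by simp
    have F: "enriched_functor V M (Fs ! i)" if "i < n" for i
      using Fs that by (simp add: set_subset_nth)
    note facts = F[THEN enriched_functor_components(3), THEN cat_functor.FO_obj]
    show ?thesis
    proof (rule etrans_eqI, goal_cases)
      case (5 x)
      then have "x \<in> Obj (sprod (map ucat (map msrc Fs)))" by simp
      then show ?case using n by (elim emor_eobj_boxE) (auto simp: facts)
    qed (simp_all add: box2_normal box1_normal etrans_id_normal comp_def)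
  qed
  have vcomp: "box2 tupO tupA (map2 etrans_vcomp bs as) = etrans_vcomp (box2 tupO tupA bs) (box2
      tupO tupA as)"
    if as: "as \<in> lists_of n (Cell2 ?K)" and bs: "bs \<in> lists_of n (Cell2 ?K)" and ab: "map
        tsrc bs = map ttgt as"
    for as bs
  proof -
    have n: "length as = n" "length bs = n" using as bs by simp_all
    have a: "enriched_trans V M (as ! i)" "enriched_trans V M (bs ! i)" if "i < n" for i
      using as bs that by (simp_all add: set_subset_nth)
    have e: "tsrc (bs ! i) = ttgt (as ! i)" if "i < n" for i
      using ab that n by (metis nth_map)
    have t: "tcomp (as ! i) x \<in> earr (mtgt (tsrc (as ! i)))" "tcomp (bs ! i) x \<in> earr (mtgt
        (tsrc (as ! i)))"
      "Dom (ucat (mtgt (tsrc (as ! i)))) (tcomp (bs ! i) x) = Cod (ucat (mtgt (tsrc (as ! i))))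
          (tcomp (as ! i) x)"
      if "i < n" "x \<in> eobj (msrc (tsrc (as ! i)))" for i x
      using enriched_trans.tcomp_hom[OF a(1)[OF that(1)], of x] enriched_trans.tcomp_hom[OF a(2)[OF
          that(1)], of x]
        that e etrans_components[OF a(1)[OF that(1)]]
      by (simp_all add: hom_def)
    have s: "map tsrc (map2 etrans_vcomp bs as) = map tsrc as" "map ttgt (map2 etrans_vcomp bs as)
        = map ttgt bs"
      using n by (simp_all add: map2_upt map_upt_eqI)
    note r = map2_upt[of as bs etrans_vcomp, unfolded n]
    show ?thesis
    proof (rule etrans_eqI, goal_cases)
      case (5 x)
      then have "x \<in> Obj (sprod (map ucat (map (\<lambda>a. msrc (tsrc a)) as)))" by (simp add:
          comp_def)
      then show ?case using n by (elim emor_eobj_boxE) (auto simp: r t e a(1)[THEN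
          etrans_components(3)])
    qed (simp_all only: box2_simps etrans_vcomp_simps s box2_normal etrans_vcomp_normal)
  qed
  have hcomp: "box2 tupO tupA (map2 (etrans_hcomp V) bs as)
      = etrans_hcomp (pow_cat n V) (box2 tupO tupA bs) (box2 tupO tupA as)"
    if as: "as \<in> lists_of n (Cell2 ?K)" and bs: "bs \<in> lists_of n (Cell2 ?K)"
      and ab: "map msrc (map tsrc bs) = map mtgt (map tsrc as)"
    for as bs
  proof -
    have n: "length as = n" "length bs = n" using as bs by simp_all
    have a: "enriched_trans V M (as ! i)" "enriched_trans V M (bs ! i)" if "i < n" for i
      using as bs that by (simp_all add: set_subset_nth)
    note ac = a(1)[THEN etrans_components(1)] a(1)[THEN etrans_components(3)] a(1)[THEN
        etrans_components(4)]
    note bc = a(2)[THEN etrans_components(2)] a(2)[THEN etrans_components(3)] a(2)[THEN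
        etrans_components(4)]
    have e: "msrc (tsrc (bs ! i)) = mtgt (tsrc (as ! i))" if "i < n" for i
      using ab that n by (metis nth_map length_map)
    have o: "FO (mfun (tsrc (as ! i))) x \<in> eobj (mtgt (tsrc (as ! i)))"
      "tcomp (as ! i) x \<in> earr (mtgt (tsrc (as ! i)))"
      "Cod (ucat (mtgt (tsrc (as ! i)))) (tcomp (as ! i) x) = FO (mfun (ttgt (as ! i))) x"
      "Dom (ucat (mtgt (tsrc (as ! i)))) (tcomp (as ! i) x) = FO (mfun (tsrc (as ! i))) x"
      if "i < n" "x \<in> eobj (msrc (tsrc (as ! i)))" for i x
      using cat_functor.FO_obj[OF enriched_functor_components(3)[OF ac(1)[OF that(1)]], of x]
        enriched_trans.tcomp_hom[OF a(1)[OF that(1)], of x] that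
      by (simp_all add: hom_def)
    have b: "tcomp (bs ! i) y \<in> earr (mtgt (tsrc (bs ! i)))"
      "Cod (ucat (mtgt (tsrc (bs ! i)))) (tcomp (bs ! i) y) = FO (mfun (ttgt (bs ! i))) y"
      if "i < n" "y \<in> eobj (mtgt (tsrc (as ! i)))" for i y
      using enriched_trans.tcomp_hom[OF a(2)[OF that(1)], of y] that e by (simp_all add: hom_def)
    have B: "FA (mfun (ttgt (bs ! i))) f \<in> earr (mtgt (tsrc (bs ! i)))"
      "Dom (ucat (mtgt (tsrc (bs ! i)))) (FA (mfun (ttgt (bs ! i))) f)
        = FO (mfun (ttgt (bs ! i))) (Dom (ucat (mtgt (tsrc (as ! i)))) f)"
      if "i < n" "f \<in> earr (mtgt (tsrc (as ! i)))" for i f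
      using cat_functor.FA_arr[OF enriched_functor_components(3)[OF bc(1)[OF that(1)]], of f]
        cat_functor.FA_dom[OF enriched_functor_components(3)[OF bc(1)[OF that(1)]], of f] that e
            bc(2,3)
      by simp_all
    have s: "map tsrc (map2 (etrans_hcomp V) bs as) = map2 (emor_comp V) (map tsrc bs) (map tsrc
        as)"
      "map ttgt (map2 (etrans_hcomp V) bs as) = map2 (emor_comp V) (map ttgt bs) (map ttgt as)"
      using n by (simp_all add: map2_upt)
    \<comment> \<open>Endpoints of a horizontal composite are composites of 1-cells, so
      \<open>comp1\<close> is applied to the sources and once more to the targets.\<close>
    have c: "box1 tupO tupA (map2 (emor_comp V) (map tsrc bs) (map tsrc as))
        = emor_comp (pow_cat n V) (box1 tupO tupA (map tsrc bs)) (box1 tupO tupA (map tsrc as))"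
      using as bs ab by (intro comp1) (auto simp: etrans_components dest: etrans_components(1)
          etrans_normal_components)
    \<comment> \<open>Composability is given for the source 1-cells; parallelism transfers it to the
      targets.\<close>
    have "map msrc (map ttgt bs) = map mtgt (map ttgt as)"
      using n e ac(2,3) bc(2,3) by (intro nth_equalityI) simp_all
    then have c': "box1 tupO tupA (map2 (emor_comp V) (map ttgt bs) (map ttgt as))
        = emor_comp (pow_cat n V) (box1 tupO tupA (map ttgt bs)) (box1 tupO tupA (map ttgt as))"
      using as bs by (intro comp1) (auto dest: etrans_components(2) etrans_normal_components)
    note r = map2_upt[of as bs "etrans_hcomp V", unfolded n]
    show ?thesis
    proof (rule etrans_eqI, goal_cases)
      case (5 x)
      then have "x \<in> Obj (sprod (map ucat (map (\<lambda>a. msrc (tsrc a)) as)))" by (simp add: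
          comp_def)
      then show ?case using n by (elim emor_eobj_boxE) (auto simp: r o b B e bc)
    qed (simp_all only: box2_simps etrans_hcomp_simps s c c' box2_normal etrans_hcomp_normal)
  qed
  show "cat_functor (cat12 (pow_two_cat n ?K)) (cat12 ?L) \<lparr>FO = F1 (boxprod tupO tupA), FA =
      F2 (boxprod tupO tupA)\<rparr>"
    using ef et id2 vcomp
    by (intro cat_functorI)
      (auto simp: hom_def category_pow Cat_enriched_cat12 box1_normal box2_normal)
  show "cat_functor (cat02 (pow_two_cat n ?K)) (cat02 ?L) \<lparr>FO = F0 (boxprod tupO tupA), FA =
      F2 (boxprod tupO tupA)\<rparr>"
  proof (rule cat_functorI, goal_cases)
    case (5 Es)
    \<comment> \<open>An identity of \<open>cat02\<close> is the identity 2-cell of an identity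
      1-cell, so \<open>id1\<close> and \<open>id2\<close> are combined.\<close>
    then have "map (emor_id V) Es \<in> lists_of n (Cell1 ?K)"
      by (auto simp: cell_closure)
    then show ?case
      using id1[of Es] id2[of "map (emor_id V) Es"] 5 by (simp add: comp_def)
  next
    case (6 f g)
    then show ?case using hcomp[of f g] by simp
  qed (use ec et in \<open>auto simp: hom_def category_pow Cat_enriched_cat02 box0_normal
      box2_normal\<close>)
qed

end

section \<open>The induced operations on enriched categories\<close>

text \<open>Indexed by the positions of the first list, as in the definitions of the external
  product, but splitting along concatenations by \<open>map3_append\<close>.\<close>

definition map3 :: "('x \<Rightarrow> 'y \<Rightarrow> 'z \<Rightarrow> 'w) \<Rightarrow> 'x list
    \<Rightarrow> 'y list \<Rightarrow> 'z list \<Rightarrow> 'w list" where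
  "map3 f xs ys zs = map (\<lambda>i. f (xs ! i) (ys ! i) (zs ! i)) [0..<length xs]"

definition map4 :: "('x \<Rightarrow> 'y \<Rightarrow> 'z \<Rightarrow> 'u \<Rightarrow> 'w)
    \<Rightarrow> 'x list \<Rightarrow> 'y list \<Rightarrow> 'z list \<Rightarrow> 'u list
    \<Rightarrow> 'w list" where
  "map4 f xs ys zs us = map (\<lambda>i. f (xs ! i) (ys ! i) (zs ! i) (us ! i)) [0..<length xs]"

lemma length_map3 [simp]: "length (map3 f xs ys zs) = length xs"
  and nth_map3 [simp]: "i < length xs \<Longrightarrow> map3 f xs ys zs ! i = f (xs ! i) (ys ! i)
      (zs ! i)"
  by (simp_all add: map3_def)

lemma length_map4 [simp]: "length (map4 f xs ys zs us) = length xs"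
  and nth_map4 [simp]: "i < length xs \<Longrightarrow> map4 f xs ys zs us ! i = f (xs ! i) (ys !
      i) (zs ! i) (us ! i)"
  by (simp_all add: map4_def)

lemma map3_append [simp]:
  "\<lbrakk>length ys = length xs; length zs = length xs\<rbrakk> \<Longrightarrow>
    map3 f (xs @ xs') (ys @ ys') (zs @ zs') = map3 f xs ys zs @ map3 f xs' ys' zs'"
  by (rule nth_equalityI) (auto simp: nth_append)

lemma map3_Cons [simp]: "map3 f (x # xs) (y # ys) (z # zs) = f x y z # map3 f xs ys zs"
  by (rule nth_equalityI) (auto simp: nth_Cons split: nat.split)

lemma map3_Nil [simp]: "map3 f [] ys zs = []"
  by (simp add: map3_def)

lemma map4_append [simp]:
  "\<lbrakk>length ys = length xs; length zs = length xs; length us = length xs\<rbrakk>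
      \<Longrightarrow>
    map4 f (xs @ xs') (ys @ ys') (zs @ zs') (us @ us') = map4 f xs ys zs us @ map4 f xs' ys' zs'
        us'"
  by (rule nth_equalityI) (auto simp: nth_append)

lemma map4_Cons [simp]: "map4 f (x # xs) (y # ys) (z # zs) (u # us) = f x y z u # map4 f xs ys zs
    us"
  by (rule nth_equalityI) (auto simp: nth_Cons split: nat.split)

lemma map4_Nil [simp]: "map4 f [] ys zs us = []"
  by (simp add: map4_def)

text \<open>\<open>list_all2\<close> records equal length and membership together and decomposes
  along concatenation, as tuples with an inner tuple require.\<close>

abbreviation objs :: "('o, 'a, 'p, 'b) ecat list \<Rightarrow> 'o list \<Rightarrow> bool" where
  "objs \<equiv> list_all2 (\<lambda>E x. x \<in> eobj E)"
abbreviation arrs :: "('o, 'a, 'p, 'b) ecat list \<Rightarrow> 'a list \<Rightarrow> bool" where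
  "arrs \<equiv> list_all2 (\<lambda>E f. f \<in> earr E)"
abbreviation doms :: "('o, 'a, 'p, 'b) ecat list \<Rightarrow> 'a list \<Rightarrow> 'o list" where
  "doms \<equiv> map2 (\<lambda>E. Dom (ucat E))"
abbreviation cods :: "('o, 'a, 'p, 'b) ecat list \<Rightarrow> 'a list \<Rightarrow> 'o list" where
  "cods \<equiv> map2 (\<lambda>E. Cod (ucat E))"
abbreviation hOs :: "('o, 'a, 'p, 'b) ecat list \<Rightarrow> 'o list \<Rightarrow> 'o list
    \<Rightarrow> 'p list" where
  "hOs \<equiv> map3 (\<lambda>E x y. hO E x y)"
abbreviation hAs :: "('o, 'a, 'p, 'b) ecat list \<Rightarrow> 'a list \<Rightarrow> 'a list
    \<Rightarrow> 'b list" where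
  "hAs \<equiv> map3 (\<lambda>E f g. hA E f g)"
abbreviation mus :: "('o, 'a, 'p, 'b) ecat list \<Rightarrow> 'o list \<Rightarrow> 'o list
    \<Rightarrow> 'o list \<Rightarrow> 'b list" where
  "mus \<equiv> map4 (\<lambda>E x y z. mu E (x, y, z))"

lemma objs_doms: "\<lbrakk>arrs Es fs; \<forall>E\<in>set Es. enriched_category V M E\<rbrakk>
    \<Longrightarrow> objs Es (doms Es fs)"
  and objs_cods: "\<lbrakk>arrs Es fs; \<forall>E\<in>set Es. enriched_category V M E\<rbrakk>
      \<Longrightarrow> objs Es (cods Es fs)"
proof -
  assume fs: "arrs Es fs" and Es: "\<forall>E\<in>set Es. enriched_category V M E"
  have "category (ucat (Es ! i))" if "i < length Es" for i
    using Es that by (simp add: enriched_category.ucat_category[of V M])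
  then show "objs Es (doms Es fs)" "objs Es (cods Es fs)"
    using fs by (auto simp: list_all2_conv_all_nth category.dom_obj category.cod_obj)
qed

section \<open>The operations \<open>T n\<close> expressed through lists of homs, units and
  compositions\<close>

locale duoidal_tuples = duoidal D lam om chi + tuple_coding tupO tupA
  for D :: "('p, 'b) cat" (structure) and lam om :: "('p, 'b) mon"
    and chi :: "nat \<Rightarrow> 'p list list \<Rightarrow> 'b"
    and tupO :: "'o list \<Rightarrow> 'o" and tupA :: "'a list \<Rightarrow> 'a"
begin

sublocale W: oplax_monoidal D om by (rule oplax)
sublocale L: lax_monoidal_category D lam by (rule lax_monoidal_categoryI[OF lax])
sublocale chi: lax_functor "pow_cat n D" "pow_mon n om" D om "tens lam" "chi n" for n
  by (rule lambda_lax)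

lemma enriched_box: "enriched_box tupO tupA D om n"
  by (intro enriched_box.intro tuple_coding_axioms W.oplax_monoidal chi.S.oplax_monoidal)

abbreviation CatD :: "(('o, 'a, 'p, 'b) ecat, ('o, 'a, 'p, 'b) emor, ('o, 'a, 'p, 'b) etrans)
    two_cat" where
  "CatD \<equiv> Cat_enriched D om"

abbreviation ecs :: "('o, 'a, 'p, 'b) ecat list \<Rightarrow> bool" where
  "ecs Es \<equiv> \<forall>E\<in>set Es. enriched_category D om E"

abbreviation T :: "nat \<Rightarrow> (('o, 'a, 'p, 'b) ecat list, ('o, 'a, 'p, 'b) emor list, ('o,
    'a, 'p, 'b) etrans list,
    ('o, 'a, 'p, 'b) ecat, ('o, 'a, 'p, 'b) emor, ('o, 'a, 'p, 'b) etrans) two_ftr" where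
  "T n \<equiv> pushforward (tens lam) (chi n) D \<circ>\<^sub>2 boxprod tupO tupA"

theorem T_functor: "two_functor (pow_two_cat n CatD) CatD (T n)"
  by (rule two_functor_comp[OF enriched_box.two_functor_boxprod[OF enriched_box]
    lax_functor.two_functor_pushforward[OF lambda_lax]])

text \<open>The arity index of \<open>T\<close> is the length of the argument; leaving it implicit
  avoids arithmetic on arities when lists are concatenated. \<open>T_eq\<close> translates between
  the two forms.\<close>

definition T0 :: "('o, 'a, 'p, 'b) ecat list \<Rightarrow> ('o, 'a, 'p, 'b) ecat" where
  "T0 Es = F0 (T (length Es)) Es"
definition T1 :: "('o, 'a, 'p, 'b) emor list \<Rightarrow> ('o, 'a, 'p, 'b) emor" where
  "T1 Fs = F1 (T (length Fs)) Fs"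
definition T2 :: "('o, 'a, 'p, 'b) etrans list \<Rightarrow> ('o, 'a, 'p, 'b) etrans" where
  "T2 as = F2 (T (length as)) as"

lemma T_eq: "length Es = n \<Longrightarrow> F0 (T n) Es = T0 Es" "length Fs = n \<Longrightarrow>
    F1 (T n) Fs = T1 Fs"
  "length as = n \<Longrightarrow> F2 (T n) as = T2 as"
  by (auto simp: T0_def T1_def T2_def)

lemma T0_cell:
  assumes "\<forall>E\<in>set Es. E \<in> Cell0 CatD"
  shows "T0 Es \<in> Cell0 CatD"
proof -
  interpret two_functor "pow_two_cat (length Es) CatD" CatD "T (length Es)" by (rule T_functor)
  show ?thesis using F01.FO_obj[of Es] assms by (auto simp: T0_def)
qed

lemma T1_cell:
  assumes "\<forall>F\<in>set Fs. F \<in> Cell1 CatD"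
  shows "T1 Fs \<in> Cell1 CatD"
proof -
  interpret two_functor "pow_two_cat (length Fs) CatD" CatD "T (length Fs)" by (rule T_functor)
  show ?thesis using F01.FA_arr[of Fs] assms by (auto simp: T1_def)
qed

lemma T2_cell:
  assumes "\<forall>a\<in>set as. a \<in> Cell2 CatD"
  shows "T2 as \<in> Cell2 CatD"
proof -
  interpret two_functor "pow_two_cat (length as) CatD" CatD "T (length as)" by (rule T_functor)
  show ?thesis using F12.FA_arr[of as] assms by (auto simp: T2_def)
qed

lemma T0_ucat: "ucat (T0 Es) = sprod (map ucat Es)"
  by (simp add: T0_def)

lemma T0_objE:
  assumes "x \<in> eobj (T0 Es)"
  obtains xs where "x = tupO xs" "objs Es xs"
  using assms unfolding T0_ucat by (elim eobj_boxE) (auto simp: list_all2_conv_all_nth)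

lemma T0_arrE:
  assumes "f \<in> earr (T0 Es)"
  obtains fs where "f = tupA fs" "arrs Es fs"
  using assms unfolding T0_ucat by (elim earr_boxE) (auto simp: list_all2_conv_all_nth)

lemma T0_obj [simp]: "tupO xs \<in> eobj (T0 Es) \<longleftrightarrow> objs Es xs"
  and T0_arr [simp]: "tupA fs \<in> earr (T0 Es) \<longleftrightarrow> arrs Es fs"
  by (auto simp: T0_ucat list_all2_conv_all_nth)

lemma T0_dom [simp]: "arrs Es fs \<Longrightarrow> Dom (ucat (T0 Es)) (tupA fs) = tupO (doms Es fs)"
  and T0_cod [simp]: "arrs Es fs \<Longrightarrow> Cod (ucat (T0 Es)) (tupA fs) = tupO (cods Es fs)"
  and T0_id [simp]: "objs Es xs \<Longrightarrow> eid (T0 Es) (tupO xs) = tupA (map2 (\<lambda>E.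
      eid E) Es xs)"
  by (auto simp: T0_ucat list_all2_conv_all_nth map2_upt)

lemma T0_comp [simp]: "\<lbrakk>arrs Es fs; arrs Es gs; doms Es gs = cods Es fs\<rbrakk>
    \<Longrightarrow>
    Comp (ucat (T0 Es)) (tupA gs) (tupA fs) = tupA (map3 (\<lambda>E. Comp (ucat E)) Es gs fs)"
  by (simp add: T0_ucat list_all2_conv_all_nth map2_upt map3_def)

lemma T0_hO [simp]: "\<lbrakk>objs Es xs; objs Es ys\<rbrakk> \<Longrightarrow> hO (T0 Es) (tupO
    xs) (tupO ys) = tO lam (hOs Es xs ys)"
  by (simp add: T0_def list_all2_conv_all_nth map3_def)

lemma T0_hA [simp]: "\<lbrakk>arrs Es fs; arrs Es gs\<rbrakk> \<Longrightarrow> hA (T0 Es) (tupA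
    fs) (tupA gs) = tA lam (hAs Es fs gs)"
  by (simp add: T0_def list_all2_conv_all_nth map3_def)

text \<open>With zero rows, \<open>chi (length Es) []\<close> is the comparison from the unit of
  \<open>om\<close> to \<open>lam\<close> of a list of such units.\<close>

lemma T0_eta [simp]: "objs Es xs \<Longrightarrow>
    eta (T0 Es) (tupO xs) = tA lam (map2 eta Es xs) \<cdot> chi (length Es) []"
  by (simp add: T0_def list_all2_conv_all_nth map2_upt)

lemma T0_mu [simp]: "\<lbrakk>objs Es xs; objs Es ys; objs Es zs\<rbrakk> \<Longrightarrow> mu (T0
    Es) (tupO xs, tupO ys, tupO zs)
    = tA lam (mus Es xs ys zs) \<cdot> chi (length Es) [hOs Es ys zs, hOs Es xs ys]"
  by (simp add: T0_def list_all2_conv_all_nth map3_def map4_def)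

lemma T1_ends [simp]: "msrc (T1 Fs) = T0 (map msrc Fs)" "mtgt (T1 Fs) = T0 (map mtgt Fs)"
  by (simp_all add: T0_def T1_def)

lemma T1_FO [simp]: "objs (map msrc Fs) xs \<Longrightarrow>
    FO (mfun (T1 Fs)) (tupO xs) = tupO (map2 (\<lambda>F. FO (mfun F)) Fs xs)"
  by (simp add: T1_def list_all2_conv_all_nth map2_upt)

lemma T1_FA [simp]: "arrs (map msrc Fs) fs \<Longrightarrow>
    FA (mfun (T1 Fs)) (tupA fs) = tupA (map2 (\<lambda>F. FA (mfun F)) Fs fs)"
  by (simp add: T1_def list_all2_conv_all_nth map2_upt)

lemma T1_mstr [simp]: "\<lbrakk>objs (map msrc Fs) xs; objs (map msrc Fs) ys\<rbrakk>
    \<Longrightarrow>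
    mstr (T1 Fs) (tupO xs, tupO ys) = tA lam (map3 (\<lambda>F x y. mstr F (x, y)) Fs xs ys)"
  by (simp add: T1_def list_all2_conv_all_nth map3_def)

lemma T2_ends [simp]: "tsrc (T2 as) = T1 (map tsrc as)" "ttgt (T2 as) = T1 (map ttgt as)"
  by (simp_all add: T1_def T2_def)

lemma T2_tcomp [simp]: "objs (map msrc (map tsrc as)) xs \<Longrightarrow>
    tcomp (T2 as) (tupO xs) = tupA (map2 tcomp as xs)"
  by (simp add: T2_def list_all2_conv_all_nth map2_upt)

end

section \<open>Interaction of the structure maps of \<open>lam\<close> with
  \<open>chi\<close>\<close>

lemma columns_0 [simp]: "columns 0 xss = []"
  by (simp add: columns_def)

text \<open>The oplax axiom for \<open>om\<close> takes two rows as a list of columns of height two;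
  transposing recovers the rows in the form in which \<open>chi\<close> receives them.\<close>

lemma columns_2:
  assumes "length ys = length xs"
  shows "columns 2 (map2 (\<lambda>x y. [x, y]) xs ys) = [xs, ys]"
proof -
  have "[0..<2] = [0, Suc 0]" by (simp add: upt_rec)
  then show ?thesis using assms by (auto simp: columns_def intro!: nth_equalityI)
qed

lemma pairs_subset: "set xs \<subseteq> A \<Longrightarrow> set ys \<subseteq> A \<Longrightarrow>
    set (map2 (\<lambda>x y. [x, y]) xs ys) \<subseteq> lists_of 2 A"
  by (induction xs ys rule: list_induct2') auto

lemma (in tuple_coding) flatten_simps [simp]:
  "flatten tupO (length xs) (tupO (xs @ [tupO ys] @ zs)) = tupO (xs @ ys @ zs)"
  "flatten tupA (length fs) (tupA (fs @ [tupA gs] @ hs)) = tupA (fs @ gs @ hs)"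
  by (simp_all add: flatten_def)

context duoidal_tuples
begin

text \<open>\<open>css\<close>, \<open>dss\<close>, \<open>ess\<close> are lists of columns of
  height \<open>m\<close>, and the arrows start at the \<open>om\<close>-products of these columns.
  Naturality moves \<open>dlt lam\<close> before the arrows, where the comultiplication axiom of
  \<open>om\<close> as an oplax functor trades it for \<open>dlt lam\<close> taken row by row. The
  arrows will be units for \<open>m = 0\<close> and compositions for \<open>m = 2\<close>.\<close>

lemma chi_nested:
  assumes rows: "set (css @ dss @ ess) \<subseteq> lists_of m (Obj D)"
    and arr: "set (as @ bs @ es) \<subseteq> Arr D"
    and doms: "map (Dom D) as = map (tO om) css" "map (Dom D) bs = map (tO om) dss"
      "map (Dom D) es = map (tO om) ess"
  shows "dlt lam (map (Cod D) as) (map (Cod D) bs) (map (Cod D) es)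
      \<cdot> (tA lam (as @ [tA lam bs \<cdot> chi (length dss) (columns m dss)] @ es)
      \<cdot> chi (length css + 1 + length ess) (columns m (css @ [map (tO lam) (columns m dss)] @
          ess)))
    = tA lam (as @ bs @ es) \<cdot> (chi (length (css @ dss @ ess)) (columns m (css @ dss @ ess))
      \<cdot> tA om (map (\<lambda>j. dlt lam (columns m css ! j) (columns m dss ! j) (columns m
          ess ! j)) [0..<m]))"
proof -
  interpret O: lax_functor "op_cat (pow_cat m D)" "pow_mon m lam" "op_cat D" lam "tens om"
    "\<lambda>css. chi (length css) (columns m css)"
    by (rule omega_oplax)
  let ?c = "chi (length dss) (columns m dss)"
  let ?ts = "map (tO lam) (columns m dss)"
  let ?I = "map (\<lambda>x. Id D (tO om x))"
  let ?p = "chi (length css + 1 + length ess) (columns m (css @ [?ts] @ ess))"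
  let ?q = "chi (length (css @ dss @ ess)) (columns m (css @ dss @ ess))"
  let ?d = "tA om (map (\<lambda>j. dlt lam (columns m css ! j) (columns m dss ! j) (columns m ess
      ! j)) [0..<m])"
  have [simp]: "tO (pow_mon m lam) dss = ?ts"
    by (simp add: pow_mon_def)
  have dss: "set dss \<subseteq> Obj (op_cat (pow_cat m D))"
    and pss: "set (css @ [?ts] @ ess) \<subseteq> Obj (op_cat (pow_cat m D))"
    using rows O.S.tO_obj[of dss] by auto
  have omo: "x \<in> set css \<union> set dss \<union> set ess \<Longrightarrow> tO om x \<in> Obj
      D" for x
    using rows by (intro W.tO_obj) (auto simp: subset_iff)
  have c: "?c \<in> Arr D" "Cod D ?c = tO lam (map (tO om) dss)" "Dom D ?c = tO om ?ts"
    using O.l_arr[OF dss] O.l_dom[OF dss] O.l_cod[OF dss] by simp_all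
  have p: "?p \<in> Arr D" "Cod D ?p = tO lam (map (tO om) css @ [tO om ?ts] @ map (tO om) ess)"
    using O.l_arr[OF pss] O.l_dom[OF pss] by simp_all
  \<comment> \<open>The comultiplication axiom is stated in opposite categories, so its composites
    are read backwards in \<open>D\<close>.\<close>
  have comult: "?q \<cdot> ?d = (dlt lam (map (tO om) css) (map (tO om) dss) (map (tO om) ess)
      \<cdot> tA lam (?I css @ [?c] @ ?I ess)) \<cdot> ?p"
    using O.lax_comult[of css dss ess] rows by (simp add: pow_mon_def subset_iff)
  have [simp]: "length as = length css" "length es = length ess"
    using doms by (auto dest: map_eq_imp_length_eq)
  have r: "map2 (\<cdot>) as (?I css) = as" "map2 (\<cdot>) es (?I ess) = es"
    using doms arr by (auto intro!: nth_equalityI simp: map_eq_nth set_subset_nth)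
  have Is: "set (?I css @ [?c] @ ?I ess) \<subseteq> Arr D" using omo c by auto
  have As: "set (as @ [tA lam bs] @ es) \<subseteq> Arr D" using arr by simp
  have eq: "map (Dom D) (as @ [tA lam bs] @ es) = map (Cod D) (?I css @ [?c] @ ?I ess)"
    using doms arr c omo by (simp add: comp_def)
  \<comment> \<open>Only the middle entry is a genuine composite; by \<open>r\<close> the outer
    arrows absorb identities.\<close>
  have s: "tA lam (as @ [tA lam bs \<cdot> ?c] @ es) = tA lam (as @ [tA lam bs] @ es) \<cdot> tA
      lam (?I css @ [?c] @ ?I ess)"
    unfolding L.tA_comp[OF Is As eq] using r by simp
  have n: "tA lam (as @ bs @ es) \<cdot> dlt lam (map (tO om) css) (map (tO om) dss) (map (tO om)
      ess)
    = dlt lam (map (Cod D) as) (map (Cod D) bs) (map (Cod D) es) \<cdot> tA lam (as @ [tA lam bs] @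
        es)"
    using L.dlt_nat[OF arr] doms by simp
  have o1: "set (map (Cod D) as @ map (Cod D) bs @ map (Cod D) es) \<subseteq> Obj D" using arr by
      auto
  have o2: "set (map (tO om) css @ map (tO om) dss @ map (tO om) ess) \<subseteq> Obj D" using omo
      by auto
  have e1: "map (Dom D \<circ> (\<lambda>x. Id D (tO om x))) css = map (tO om) css"
     "map (Dom D \<circ> (\<lambda>x. Id D (tO om x))) ess = map (tO om) ess"
     "map (Cod D \<circ> (\<lambda>x. Id D (tO om x))) css = map (tO om) css"
     "map (Cod D \<circ> (\<lambda>x. Id D (tO om x))) ess = map (tO om) ess"
    using omo by auto
  note facts = L.tA_arr[OF Is] L.tA_dom[OF Is] L.tA_cod[OF Is] L.tA_arr[OF As] L.tA_dom[OF As]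
      L.tA_cod[OF As]
    L.tA_arr[OF arr] L.tA_dom[OF arr] L.dlt_arr[OF o1] L.dlt_dom[OF o1] L.dlt_cod[OF o1]
    L.dlt_arr[OF o2] L.dlt_dom[OF o2] L.dlt_cod[OF o2]
  let ?D1 = "dlt lam (map (Cod D) as) (map (Cod D) bs) (map (Cod D) es)"
  let ?D2 = "dlt lam (map (tO om) css) (map (tO om) dss) (map (tO om) ess)"
  let ?X = "tA lam (as @ [tA lam bs] @ es)" and ?Y = "tA lam (?I css @ [?c] @ ?I ess)" and ?Z = "tA
      lam (as @ bs @ es)"
  have ty: "?D1 \<in> Arr D" "?D2 \<in> Arr D" "?X \<in> Arr D" "?Y \<in> Arr D" "?Z \<in> Arr D"
    "Dom D ?D1 = Cod D ?X" "Dom D ?X = Cod D ?Y" "Dom D ?Y = Cod D ?p" "Dom D ?Z = Cod D ?D2"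
    "Dom D ?D2 = Cod D ?Y"
    using facts p c doms arr e1 by simp_all
  have "?D1 \<cdot> ((?X \<cdot> ?Y) \<cdot> ?p) = (?D1 \<cdot> ?X) \<cdot> (?Y \<cdot> ?p)"
    using ty p(1) by (simp del: append.simps)
  also have "\<dots> = ?Z \<cdot> ((?D2 \<cdot> ?Y) \<cdot> ?p)"
    unfolding n[symmetric] using ty p(1) by (simp del: append.simps)
  finally show ?thesis unfolding s comult .
qed

text \<open>The case of zero rows: all columns are empty and only their number remains, taken from
  the lists of arrows.\<close>

lemma chi_nested_unary:
  assumes "set (as @ bs @ es) \<subseteq> Arr D" "\<forall>f\<in>set (as @ bs @ es). Dom D f = tO
      om []"
  shows "dlt lam (map (Cod D) as) (map (Cod D) bs) (map (Cod D) es)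
      \<cdot> (tA lam (as @ [tA lam bs \<cdot> chi (length bs) []] @ es) \<cdot> chi (length as + 1
          + length es) [])
    = tA lam (as @ bs @ es) \<cdot> chi (length (as @ bs @ es)) []"
proof -
  let ?n = "map (\<lambda>_. []) :: 'b list \<Rightarrow> 'p list list"
  have e: "tO (pow_mon 0 lam) css = []" "columns 0 css = []" for css by (simp_all add: pow_mon_def)
  interpret O: lax_functor "op_cat (pow_cat 0 D)" "pow_mon 0 lam" "op_cat D" lam "tens om"
    "\<lambda>css. chi (length css) (columns 0 css)"
    by (rule omega_oplax)
  have "chi (length (as @ bs @ es)) [] \<in> Arr D" "Dom D (chi (length (as @ bs @ es)) []) = tO om
      []"
    using O.l_arr[of "?n (as @ bs @ es)"] O.l_cod[of "?n (as @ bs @ es)"] by (auto simp: e)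
  \<comment> \<open>Without rows, the row-by-row \<open>dlt lam\<close> is \<open>om\<close> of no
    arrows, an identity, and drops out.\<close>
  moreover have "tA om [] = Id D (tO om [])"
    using W.tA_id[of "[]"] by simp
  moreover have "set (?n as @ ?n bs @ ?n es) \<subseteq> lists_of 0 (Obj D)" by auto
  ultimately show ?thesis
    using chi_nested[of "?n as" "?n bs" "?n es" 0 as bs es] assms
    by (simp add: comp_def ball_Un)
qed

text \<open>The case of two rows, one made of \<open>A1\<close>, \<open>B1\<close>,
  \<open>C1\<close> and the other of \<open>A2\<close>, \<open>B2\<close>, \<open>C2\<close>;
  pairing corresponding entries gives the columns.\<close>

lemma chi_nested_binary:
  assumes len: "length A1 = length A2" "length B1 = length B2" "length C1 = length C2"
    and obj: "set (A1 @ B1 @ C1) \<subseteq> Obj D" "set (A2 @ B2 @ C2) \<subseteq> Obj D"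
    and arr: "set (as @ bs @ es) \<subseteq> Arr D"
    and doms: "map (Dom D) as = map2 (\<lambda>a b. tO om [a, b]) A1 A2"
      "map (Dom D) bs = map2 (\<lambda>a b. tO om [a, b]) B1 B2"
      "map (Dom D) es = map2 (\<lambda>a b. tO om [a, b]) C1 C2"
  shows "dlt lam (map (Cod D) as) (map (Cod D) bs) (map (Cod D) es)
      \<cdot> (tA lam (as @ [tA lam bs \<cdot> chi (length bs) [B1, B2]] @ es)
      \<cdot> chi (length as + 1 + length es) [A1 @ [tO lam B1] @ C1, A2 @ [tO lam B2] @ C2])
    = tA lam (as @ bs @ es) \<cdot> (chi (length (as @ bs @ es)) [A1 @ B1 @ C1, A2 @ B2 @ C2]
      \<cdot> tA om [dlt lam A1 B1 C1, dlt lam A2 B2 C2])"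
proof -
  define z where "z = (map2 (\<lambda>a b. [a, b]) :: 'p list \<Rightarrow> 'p list \<Rightarrow>
      'p list list)"
  have l: "length as = length A2" "length bs = length B2" "length es = length C2"
    using doms len by (auto dest!: arg_cong[where f = length])
  have c: "columns 2 (z xs ys) = [xs, ys]" if "length xs = length ys" for xs ys
    unfolding z_def using that by (intro columns_2) simp
  have "columns 2 (z A1 A2 @ z B1 B2 @ z C1 C2) = [A1 @ B1 @ C1, A2 @ B2 @ C2]"
    "columns 2 (z A1 A2 @ [tO lam B1, tO lam B2] # z C1 C2)
      = [A1 @ [tO lam B1] @ C1, A2 @ [tO lam B2] @ C2]"
    using c[of "A1 @ B1 @ C1" "A2 @ B2 @ C2"] c[of "A1 @ [tO lam B1] @ C1" "A2 @ [tO lam B2] @ C2"]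
        len
    by (simp_all add: z_def)
  moreover have "[0..<2] = [0, Suc 0]" by (simp add: upt_rec)
  moreover have "set (z A1 A2 @ z B1 B2 @ z C1 C2) \<subseteq> lists_of 2 (Obj D)"
    using obj pairs_subset[of _ "Obj D"] by (simp add: z_def del: set_map)
  moreover have "length (z xs ys) = min (length xs) (length ys)"
    "map (tO om) (z xs ys) = map2 (\<lambda>a b. tO om [a, b]) xs ys" for xs ys
    by (simp_all add: z_def comp_def case_prod_unfold)
  ultimately show ?thesis
    using chi_nested[of "z A1 A2" "z B1 B2" "z C1 C2" 2 as bs es] arr doms len l
    by (simp add: c)
qed

text \<open>The counit axiom of \<open>om\<close> as an oplax functor for \<open>lam\<close>, at a
  single column \<open>x\<close>; its rows have length one, hence \<open>chi 1\<close>.\<close>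

lemma chi_unit:
  assumes "set x \<subseteq> Obj D"
  shows "chi 1 (map (\<lambda>y. [y]) x) \<cdot> tA om (map (cnt lam) x) = cnt lam (tO om x)"
proof -
  interpret O: lax_functor "op_cat (pow_cat (length x) D)" "pow_mon (length x) lam" "op_cat D" lam
      "tens om"
    "\<lambda>css. chi (length css) (columns (length x) css)"
    by (rule omega_oplax)
  have "columns (length x) [x] = map (\<lambda>y. [y]) x"
    by (rule nth_equalityI) (simp_all add: columns_def)
  then show ?thesis using O.lax_counit[of x] assms by (simp add: pow_mon_def)
qed

end

section \<open>The multiplication\<close>

lemma list_all2_nestedE:
  assumes "list_all2 P (Xs @ Y # Zs) ws"
  obtains xs y zs where "ws = xs @ y # zs" "list_all2 P Xs xs" "P Y y" "list_all2 P Zs zs"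
    "length Xs = length xs" "length Zs = length zs"
  using assms by (auto simp: list_all2_append1 list_all2_Cons1 dest: list_all2_lengthD)

text \<open>The other factor of the component is the image of an identity, so whiskering on this
  side only reindexes \<open>a\<close>.\<close>

lemma tcomp_hcomp_id_right:
  assumes "enriched_trans V M a" "enriched_functor V M F" "msrc (tsrc a) = mtgt F" "x \<in> eobj
      (msrc F)"
  shows "tcomp (etrans_hcomp V a (etrans_id F)) x = tcomp a (FO (mfun F) x)"
proof -
  interpret a: enriched_trans V M a by fact
  interpret F: enriched_functor V M F by fact
  have "FO (mfun F) x \<in> eobj (msrc (tsrc a))" using assms by simp
  then show ?thesis
    using assms a.T.U.FA_id[of "FO (mfun F) x"] by (simp add: a.parallel)
qed

lemma tcomp_hcomp_id_left:
  assumes "enriched_trans V M a" "enriched_functor V M G" "msrc G = mtgt (tsrc a)" "x \<in> eobj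
      (msrc (tsrc a))"
  shows "tcomp (etrans_hcomp V (etrans_id G) a) x = FA (mfun G) (tcomp a x)"
proof -
  interpret a: enriched_trans V M a by fact
  interpret G: enriched_functor V M G by fact
  have "tcomp a x \<in> earr (msrc G)" "Dom (ucat (msrc G)) (tcomp a x) = FO (mfun (tsrc a)) x"
    using assms by simp_all
  then show ?thesis
    using assms G.U.FA_arr[of "tcomp a x"] G.U.FA_dom[of "tcomp a x"] a.S.U.FO_obj[of x] by simp
qed

context duoidal_tuples
begin

lemma chi_binary:
  assumes "length A = n" "length B = n" "set A \<subseteq> Obj D" "set B \<subseteq> Obj D"
  shows "chi n [A, B] \<in> Arr D" "Dom D (chi n [A, B]) = tO om [tO lam A, tO lam B]"
    "Cod D (chi n [A, B]) = tO lam (map2 (\<lambda>a b. tO om [a, b]) A B)"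
proof -
  have "set [A, B] \<subseteq> Obj (pow_cat n D)" using assms by simp
  note l = chi.l_arr[OF this] chi.l_dom[OF this] chi.l_cod[OF this]
  have "map (tO om) (columns n [A, B]) = map2 (\<lambda>a b. tO om [a, b]) A B"
    using assms by (auto simp: columns_def intro!: nth_equalityI)
  then show "chi n [A, B] \<in> Arr D" "Dom D (chi n [A, B]) = tO om [tO lam A, tO lam B]"
    "Cod D (chi n [A, B]) = tO lam (map2 (\<lambda>a b. tO om [a, b]) A B)"
    using l by (simp_all add: pow_mon_def)
qed

text \<open>The version for bare enriched categories, the level at which \<open>gam_functor\<close>
  works; normality is tracked separately in \<open>gam_normal\<close>.\<close>

lemma T0_enriched: "ecs Es \<Longrightarrow> enriched_category D om (T0 Es)"
  unfolding T0_def using lax_functor.enriched_category_push[OF lambda_lax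
    enriched_box.enriched_category_box[OF enriched_box]]
  by (simp add: chi.pushforward_simps)

lemma arrs_ids:
  assumes "ecs Es" "objs Es xs"
  shows "arrs Es (map2 (\<lambda>E. eid E) Es xs)"
proof -
  have "category (ucat (Es ! i))" if "i < length Es" for i
    using assms(1) that by (simp add: enriched_category.ucat_category[of D om])
  then show ?thesis
    using assms(2) by (auto simp: list_all2_conv_all_nth category.id_arr)
qed

lemma hOs_obj: "\<lbrakk>ecs Es; objs Es xs; objs Es ys\<rbrakk> \<Longrightarrow> set (hOs Es xs
    ys) \<subseteq> Obj D"
  unfolding list_all2_conv_all_nth set_subset_nth by (auto intro!: enriched_category.hO_obj[of D
      om])

lemma hAs_arr:
  assumes "ecs Es" "arrs Es fs" "arrs Es gs"
  shows "set (hAs Es fs gs) \<subseteq> Arr D"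
    "map (Dom D) (hAs Es fs gs) = hOs Es (cods Es fs) (doms Es gs)"
    "map (Cod D) (hAs Es fs gs) = hOs Es (doms Es fs) (cods Es gs)"
proof -
  have E: "enriched_category D om (Es ! i)" if "i < length Es" for i using assms that by simp
  note facts = E[THEN enriched_category.hA_arr] E[THEN enriched_category.hA_dom]
    E[THEN enriched_category.hA_cod]
  show "set (hAs Es fs gs) \<subseteq> Arr D" "map (Dom D) (hAs Es fs gs) = hOs Es (cods Es fs)
      (doms Es gs)"
    "map (Cod D) (hAs Es fs gs) = hOs Es (doms Es fs) (cods Es gs)"
    using assms(2,3) by (auto simp: set_subset_nth list_all2_conv_all_nth facts intro!:
        nth_equalityI)
qed

lemma etas_arr:
  assumes "ecs Es" "objs Es xs"
  shows "set (map2 eta Es xs) \<subseteq> Arr D" "\<forall>f\<in>set (map2 eta Es xs). Dom D f = tO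
      om []"
    "map (Cod D) (map2 eta Es xs) = hOs Es xs xs"
proof -
  have E: "enriched_category D om (Es ! i)" if "i < length Es" for i using assms that by simp
  note facts = E[THEN enriched_category.eta_arr] E[THEN enriched_category.eta_dom]
    E[THEN enriched_category.eta_cod]
  show "set (map2 eta Es xs) \<subseteq> Arr D" "map (Cod D) (map2 eta Es xs) = hOs Es xs xs"
    using assms(2) by (auto simp: set_subset_nth list_all2_conv_all_nth facts intro!: nth_equalityI
        simp del: set_map)
  show "\<forall>f\<in>set (map2 eta Es xs). Dom D f = tO om []"
    using assms(2) by (auto simp: in_set_conv_nth list_all2_conv_all_nth facts simp del: set_map)
qed

lemma mus_arr:
  assumes "ecs Es" "objs Es xs" "objs Es ys" "objs Es zs"
  shows "set (mus Es xs ys zs) \<subseteq> Arr D"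
    "map (Dom D) (mus Es xs ys zs) = map2 (\<lambda>a b. tO om [a, b]) (hOs Es ys zs) (hOs Es xs
        ys)"
    "map (Cod D) (mus Es xs ys zs) = hOs Es xs zs"
proof -
  have E: "enriched_category D om (Es ! i)" if "i < length Es" for i using assms that by simp
  note facts = E[THEN enriched_category.mu_arr] E[THEN enriched_category.mu_dom]
    E[THEN enriched_category.mu_cod]
  show "set (mus Es xs ys zs) \<subseteq> Arr D"
    "map (Dom D) (mus Es xs ys zs) = map2 (\<lambda>a b. tO om [a, b]) (hOs Es ys zs) (hOs Es xs
        ys)"
    "map (Cod D) (mus Es xs ys zs) = hOs Es xs zs"
    using assms(2-4) by (auto simp: set_subset_nth list_all2_conv_all_nth facts intro!:
        nth_equalityI)
qed

abbreviation "gam \<equiv> times_mult tupO tupA D lam chi"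

lemma gam_ends [simp]: "msrc (gam Xs Ys Zs) = T0 (Xs @ T0 Ys # Zs)" "mtgt (gam Xs Ys Zs) = T0 (Xs @
    Ys @ Zs)"
  by (simp_all add: times_mult_def Let_def times_lam_def T0_def)

lemma gam_FO [simp]:
  assumes "objs Xs xs" "objs Ys ys" "objs Zs zs"
  shows "FO (mfun (gam Xs Ys Zs)) (tupO (xs @ tupO ys # zs)) = tupO (xs @ ys @ zs)"
proof -
  have "tupO (xs @ tupO ys # zs) \<in> eobj (T0 (Xs @ T0 Ys # Zs))"
    using assms by (auto intro!: list_all2_appendI)
  then show ?thesis using list_all2_lengthD[OF assms(1)] flatten_simps(1)[of xs ys zs]
    by (simp add: times_mult_def Let_def times_lam_def T0_def)
qed

lemma gam_FA [simp]:
  assumes "arrs Xs fs" "arrs Ys gs" "arrs Zs hs"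
  shows "FA (mfun (gam Xs Ys Zs)) (tupA (fs @ tupA gs # hs)) = tupA (fs @ gs @ hs)"
proof -
  have "tupA (fs @ tupA gs # hs) \<in> earr (T0 (Xs @ T0 Ys # Zs))"
    using assms by (auto intro!: list_all2_appendI)
  then show ?thesis using list_all2_lengthD[OF assms(1)] flatten_simps(2)[of fs gs hs]
    by (simp add: times_mult_def Let_def times_lam_def T0_def)
qed

text \<open>The hom list of the flattened tuples is the concatenation of three hom lists, and
  \<open>blocks\<close> cuts it exactly at the ends of \<open>Xs\<close> and
  \<open>Ys\<close>.\<close>

lemma gam_mstr [simp]:
  assumes "objs Xs xs" "objs Ys ys" "objs Zs zs" "objs Xs xs'" "objs Ys ys'" "objs Zs zs'"
  shows "mstr (gam Xs Ys Zs) (tupO (xs @ tupO ys # zs), tupO (xs' @ tupO ys' # zs'))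
    = dlt lam (hOs Xs xs xs') (hOs Ys ys ys') (hOs Zs zs zs')"
proof -
  have m: "tupO (xs @ tupO ys # zs) \<in> eobj (T0 (Xs @ T0 Ys # Zs))" "tupO (xs' @ tupO ys' # zs')
      \<in> eobj (T0 (Xs @ T0 Ys # Zs))"
    using assms by (auto intro!: list_all2_appendI)
  have o: "objs (Xs @ Ys @ Zs) (xs @ ys @ zs)" "objs (Xs @ Ys @ Zs) (xs' @ ys' @ zs')"
    using assms by (auto intro!: list_all2_appendI)
  have "hO (box0 tupO tupA (Xs @ Ys @ Zs)) (tupO (xs @ ys @ zs)) (tupO (xs' @ ys' @ zs'))
     = hOs (Xs @ Ys @ Zs) (xs @ ys @ zs) (xs' @ ys' @ zs')"
    using o unfolding list_all2_conv_all_nth by (subst box0_simps) (simp_all add: map3_def)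
  also have "\<dots> = hOs Xs xs xs' @ hOs Ys ys ys' @ hOs Zs zs zs'"
    using assms[THEN list_all2_lengthD] by simp
  finally show ?thesis using m assms[THEN list_all2_lengthD] flatten_simps(1)[of xs ys zs]
      flatten_simps(1)[of xs' ys' zs']
    by (simp add: times_mult_def Let_def times_lam_def T0_def)
qed

lemma T0_nested_objE:
  assumes "x \<in> eobj (T0 (Xs @ T0 Ys # Zs))"
  obtains xs ys zs where "x = tupO (xs @ tupO ys # zs)" "objs Xs xs" "objs Ys ys" "objs Zs zs"
    "length Xs = length xs" "length Ys = length ys" "length Zs = length zs"
  using assms by (elim T0_objE list_all2_nestedE) (auto dest: list_all2_lengthD)

lemma T0_nested_arrE:
  assumes "f \<in> earr (T0 (Xs @ T0 Ys # Zs))"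
  obtains fs gs hs where "f = tupA (fs @ tupA gs # hs)" "arrs Xs fs" "arrs Ys gs" "arrs Zs hs"
    "length Xs = length fs" "length Ys = length gs" "length Zs = length hs"
  using assms by (elim T0_arrE list_all2_nestedE) (auto dest: list_all2_lengthD)

lemma gam_normal:
  assumes "\<forall>E\<in>set (Xs @ Ys @ Zs). E \<in> Cell0 CatD"
  shows "emor_normal (gam Xs Ys Zs)"
proof -
  have "T0 Ys \<in> Cell0 CatD" using assms by (intro T0_cell) auto
  then have "T0 (Xs @ T0 Ys # Zs) \<in> Cell0 CatD" "T0 (Xs @ Ys @ Zs) \<in> Cell0 CatD"
    using assms by (auto intro!: T0_cell simp del: Cat_enriched_simps)
  then show ?thesis unfolding emor_normal_def gam_ends
    by (auto simp: times_mult_def Let_def times_lam_def T0_def)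
qed

text \<open>Functoriality holds because concatenation commutes with entrywise operations; naturality
  of the structure maps is naturality of \<open>dlt lam\<close> at the lists of hom actions.\<close>

lemma gam_functor:
  assumes "ecs (Xs @ Ys @ Zs)"
  shows "enriched_functor D om (gam Xs Ys Zs)"
proof -
  have ec: "ecs Xs" "ecs Ys" "ecs Zs" "ecs (Xs @ T0 Ys # Zs)" using assms T0_enriched by auto
  let ?S = "T0 (Xs @ T0 Ys # Zs)" and ?T = "T0 (Xs @ Ys @ Zs)"
  interpret S: enriched_category D om ?S by (rule T0_enriched[OF ec(4)])
  interpret T: enriched_category D om ?T by (rule T0_enriched[OF assms])
  interpret SC: category "ucat ?S" by (rule S.ucat_category)
  interpret TC: category "ucat ?T" by (rule T.ucat_category)
  note oI = list_all2_appendI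
  note od = objs_doms[OF _ ec(1)] objs_doms[OF _ ec(2)] objs_doms[OF _ ec(3)]
    objs_cods[OF _ ec(1)] objs_cods[OF _ ec(2)] objs_cods[OF _ ec(3)]
  have "cat_functor (ucat ?S) (ucat ?T) (mfun (gam Xs Ys Zs))"
  proof (rule cat_functorI, goal_cases)
    case 1
    show ?case by (rule SC.category)
  next
    case 2
    show ?case by (rule TC.category)
  next
    case (3 x)
    then show ?case by (elim T0_nested_objE) (simp add: oI)
  next
    case (4 f)
    then show ?case by (elim T0_nested_arrE) (simp add: oI od hom_def)
  next
    case (5 x)
    then show ?case
      by (elim T0_nested_objE) (simp add: oI arrs_ids ec)
  next
    case (6 f g)
    from 6(1) obtain fs gs hs where f: "f = tupA (fs @ tupA gs # hs)" "arrs Xs fs" "arrs Ys gs"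
        "arrs Zs hs"
      and fl: "length Xs = length fs" "length Ys = length gs" "length Zs = length hs" by (rule
          T0_nested_arrE)
    from 6(2) obtain fs' gs' hs' where g: "g = tupA (fs' @ tupA gs' # hs')" "arrs Xs fs'" "arrs Ys
        gs'" "arrs Zs hs'"
      and gl: "length Xs = length fs'" "length Ys = length gs'" "length Zs = length hs'" by (rule
          T0_nested_arrE)
    \<comment> \<open>By injectivity of the encodings, composability of nested tuples splits into
      composability of the three blocks.\<close>
    have e: "doms Xs fs' = cods Xs fs" "doms Ys gs' = cods Ys gs" "doms Zs hs' = cods Zs hs"
      using 6(3) f g fl gl by (simp_all add: oI)
    have c: "arrs Es (map3 (\<lambda>E. Comp (ucat E)) Es ks' ks)"
      if "ecs Es" "arrs Es ks" "arrs Es ks'" "doms Es ks' = cods Es ks" for Es ks ks'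
    proof -
      have "category (ucat (Es ! i))" if "i < length Es" for i
        using \<open>ecs Es\<close> that by (simp add: enriched_category.ucat_category[of D om])
      moreover have "Dom (ucat (Es ! i)) (ks' ! i) = Cod (ucat (Es ! i)) (ks ! i)" if "i < length
          Es" for i
        using arg_cong[OF \<open>doms Es ks' = cods Es ks\<close>, of "\<lambda>l. l ! i"]
            \<open>arrs Es ks\<close> \<open>arrs Es ks'\<close> that
        by (simp add: list_all2_conv_all_nth)
      ultimately show ?thesis using that
        by (auto simp: list_all2_conv_all_nth category.comp_arr)
    qed
    \<comment> \<open>The middle entry of the composite is again a code, that of a composite in
      \<open>T0 Ys\<close>; in this form \<open>gam_FA\<close> can flatten it.\<close>
    have "Comp (ucat ?S) g f = tupA (map3 (\<lambda>E. Comp (ucat E)) Xs fs' fs @ tupA (map3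
        (\<lambda>E. Comp (ucat E)) Ys gs' gs)
        # map3 (\<lambda>E. Comp (ucat E)) Zs hs' hs)"
      using f g fl gl e by (simp add: oI)
    then show ?case
      using f g fl gl e by (simp add: oI c[OF ec(1)] c[OF ec(2)] c[OF ec(3)])
  qed
  then show ?thesis
  proof (intro enriched_functorI, goal_cases)
    case 1
    show ?case using S.enriched_category by simp
  next
    case 2
    show ?case using T.enriched_category by simp
  next
    case 3
    then show ?case by simp
  next
    case (4 x y)
    from 4(2) obtain xs ys zs where x: "x = tupO (xs @ tupO ys # zs)" "objs Xs xs" "objs Ys ys"
        "objs Zs zs"
      and xl: "length Xs = length xs" "length Ys = length ys" "length Zs = length zs"
      unfolding gam_ends by (rule T0_nested_objE)
    from 4(3) obtain xs' ys' zs' where y: "y = tupO (xs' @ tupO ys' # zs')" "objs Xs xs'" "objs Ys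
        ys'" "objs Zs zs'"
      and yl: "length Xs = length xs'" "length Ys = length ys'" "length Zs = length zs'"
      unfolding gam_ends by (rule T0_nested_objE)
    show ?case using x xl y yl by (simp add: oI hOs_obj ec hom_def)
  next
    case (5 f h x x' y y')
    then have "f \<in> earr ?S" "h \<in> earr ?S" and d: "x = Cod (ucat ?S) f" "x' = Dom (ucat ?S)
        f"
      "y = Dom (ucat ?S) h" "y' = Cod (ucat ?S) h"
      by (auto simp: hom_def)
    obtain fs gs hs where f: "f = tupA (fs @ tupA gs # hs)" "arrs Xs fs" "arrs Ys gs" "arrs Zs hs"
      and fl: "length Xs = length fs" "length Ys = length gs" "length Zs = length hs"
      using \<open>f \<in> earr ?S\<close> by (rule T0_nested_arrE)
    obtain fs' gs' hs' where g: "h = tupA (fs' @ tupA gs' # hs')" "arrs Xs fs'" "arrs Ys gs'" "arrs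
        Zs hs'"
      and gl: "length Xs = length fs'" "length Ys = length gs'" "length Zs = length hs'"
      using \<open>h \<in> earr ?S\<close> by (rule T0_nested_arrE)
    have "set (hAs Xs fs fs' @ hAs Ys gs gs' @ hAs Zs hs hs') \<subseteq> Arr D"
      using f g ec by (simp add: hAs_arr)
    from L.dlt_nat[OF this] show ?case
      unfolding d using f g fl gl by (simp add: oI od hAs_arr ec)
  next
    case (6 x)
    from 6(2) obtain xs ys zs where x: "x = tupO (xs @ tupO ys # zs)" "objs Xs xs" "objs Ys ys"
        "objs Zs zs"
      and xl: "length Xs = length xs" "length Ys = length ys" "length Zs = length zs"
      unfolding gam_ends by (rule T0_nested_objE)
    \<comment> \<open>Units start at the nullary product of \<open>om\<close>, which is the product
      of an empty column.\<close>
    show ?case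
      using chi_nested_unary[of "map2 eta Xs xs" "map2 eta Ys ys" "map2 eta Zs zs"]
        etas_arr[OF ec(1) x(2)] etas_arr[OF ec(2) x(3)] etas_arr[OF ec(3) x(4)] x xl
      by (simp add: oI ball_Un del: set_map set_zip)
  next
    case (7 x y z)
    from 7(2) obtain xs ys zs where x: "x = tupO (xs @ tupO ys # zs)" "objs Xs xs" "objs Ys ys"
        "objs Zs zs"
      and xl: "length Xs = length xs" "length Ys = length ys" "length Zs = length zs"
      unfolding gam_ends by (rule T0_nested_objE)
    from 7(3) obtain xs' ys' zs' where y: "y = tupO (xs' @ tupO ys' # zs')" "objs Xs xs'" "objs Ys
        ys'" "objs Zs zs'"
      and yl: "length Xs = length xs'" "length Ys = length ys'" "length Zs = length zs'"
      unfolding gam_ends by (rule T0_nested_objE)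
    from 7(4) obtain xs'' ys'' zs'' where z: "z = tupO (xs'' @ tupO ys'' # zs'')" "objs Xs xs''"
        "objs Ys ys''" "objs Zs zs''"
      and zl: "length Xs = length xs''" "length Ys = length ys''" "length Zs = length zs''"
      unfolding gam_ends by (rule T0_nested_objE)
    \<comment> \<open>The first row holds the homs from \<open>y\<close> to \<open>z\<close>, the
      second those from \<open>x\<close> to \<open>y\<close>, in the order of the factors of
      \<open>mu\<close>.\<close>
    show ?case
      using chi_nested_binary[of "hOs Xs xs' xs''" "hOs Xs xs xs'" "hOs Ys ys' ys''" "hOs Ys ys ys'"
          "hOs Zs zs' zs''" "hOs Zs zs zs'" "mus Xs xs xs' xs''" "mus Ys ys ys' ys''" "mus Zs zs
              zs' zs''"]
        mus_arr[OF ec(1) x(2) y(2) z(2)] mus_arr[OF ec(2) x(3) y(3) z(3)] mus_arr[OF ec(3) x(4)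
            y(4) z(4)]
        chi_binary[of "hOs Xs xs' xs'' @ hOs Ys ys' ys'' @ hOs Zs zs' zs''"
          "length xs + (length ys + length zs)" "hOs Xs xs xs' @ hOs Ys ys ys' @ hOs Zs zs zs'"]
        x xl y yl z zl
      by (simp add: oI hOs_obj ec)
  qed
qed

lemma gam_cell:
  assumes "\<forall>E\<in>set (Xs @ Ys @ Zs). E \<in> Cell0 CatD"
  shows "gam Xs Ys Zs \<in> Cell1 CatD"
  using gam_functor[of Xs Ys Zs] gam_normal[OF assms] assms by simp

abbreviation FOs :: "('o, 'a, 'p, 'b) emor list \<Rightarrow> 'o list \<Rightarrow> 'o list" where
  "FOs \<equiv> map2 (\<lambda>F. FO (mfun F))"
abbreviation FAs :: "('o, 'a, 'p, 'b) emor list \<Rightarrow> 'a list \<Rightarrow> 'a list" where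
  "FAs \<equiv> map2 (\<lambda>F. FA (mfun F))"
abbreviation mstrs :: "('o, 'a, 'p, 'b) emor list \<Rightarrow> 'o list \<Rightarrow> 'o list
    \<Rightarrow> 'b list" where
  "mstrs \<equiv> map3 (\<lambda>F x y. mstr F (x, y))"

lemma emor_lists:
  assumes "\<forall>F\<in>set Fs. F \<in> Cell1 CatD"
  shows "objs (map msrc Fs) xs \<Longrightarrow> objs (map mtgt Fs) (FOs Fs xs)"
    "arrs (map msrc Fs) fs \<Longrightarrow> arrs (map mtgt Fs) (FAs Fs fs)"
    "\<lbrakk>objs (map msrc Fs) xs; objs (map msrc Fs) ys\<rbrakk> \<Longrightarrow> set (mstrs Fs
        xs ys) \<subseteq> Arr D"
    "\<lbrakk>objs (map msrc Fs) xs; objs (map msrc Fs) ys\<rbrakk> \<Longrightarrow>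
      map (Dom D) (mstrs Fs xs ys) = hOs (map msrc Fs) xs ys"
    "\<lbrakk>objs (map msrc Fs) xs; objs (map msrc Fs) ys\<rbrakk> \<Longrightarrow>
      map (Cod D) (mstrs Fs xs ys) = hOs (map mtgt Fs) (FOs Fs xs) (FOs Fs ys)"
proof -
  have F: "enriched_functor D om (Fs ! i)" if "i < length Fs" for i using assms that by simp
  note U = F[THEN enriched_functor_components(3)]
  note facts = F[THEN enriched_functor.str_arr] F[THEN enriched_functor.str_dom]
    F[THEN enriched_functor.str_cod] U[THEN cat_functor.FO_obj] U[THEN cat_functor.FA_arr]
  show "objs (map msrc Fs) xs \<Longrightarrow> objs (map mtgt Fs) (FOs Fs xs)"
    "arrs (map msrc Fs) fs \<Longrightarrow> arrs (map mtgt Fs) (FAs Fs fs)"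
    "\<lbrakk>objs (map msrc Fs) xs; objs (map msrc Fs) ys\<rbrakk> \<Longrightarrow> set (mstrs Fs
        xs ys) \<subseteq> Arr D"
    "\<lbrakk>objs (map msrc Fs) xs; objs (map msrc Fs) ys\<rbrakk> \<Longrightarrow>
      map (Dom D) (mstrs Fs xs ys) = hOs (map msrc Fs) xs ys"
    "\<lbrakk>objs (map msrc Fs) xs; objs (map msrc Fs) ys\<rbrakk> \<Longrightarrow>
      map (Cod D) (mstrs Fs xs ys) = hOs (map mtgt Fs) (FOs Fs xs) (FOs Fs ys)"
    by (auto simp: set_subset_nth list_all2_conv_all_nth facts intro!: nth_equalityI)
qed

lemma Cell1_ends:
  assumes "\<forall>F\<in>set Fs. F \<in> Cell1 CatD"
  shows "\<forall>E\<in>set (map msrc Fs). E \<in> Cell0 CatD" "\<forall>E\<in>set (map mtgt Fs). E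
      \<in> Cell0 CatD"
  using assms by (auto intro: enriched_functor_components emor_normal_components)

lemma Cell2_ends:
  assumes "\<forall>a\<in>set as. a \<in> Cell2 CatD"
  shows "\<forall>F\<in>set (map tsrc as). F \<in> Cell1 CatD" "\<forall>F\<in>set (map ttgt as). F
      \<in> Cell1 CatD"
    "map msrc (map ttgt as) = map msrc (map tsrc as)" "map mtgt (map ttgt as) = map mtgt (map tsrc
        as)"
  using assms by (auto intro: etrans_components etrans_normal_components)

text \<open>Applying functors entrywise commutes with flattening; on structure maps the equation is
  naturality of \<open>dlt lam\<close> at the concatenated structure maps of the 1-cells.\<close>

lemma gam_natural1:
  assumes "\<forall>F\<in>set (Fs @ Gs @ Hs). F \<in> Cell1 CatD"
  shows "emor_comp D (T1 (Fs @ Gs @ Hs)) (gam (map msrc Fs) (map msrc Gs) (map msrc Hs))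
    = emor_comp D (gam (map mtgt Fs) (map mtgt Gs) (map mtgt Hs)) (T1 (Fs @ T1 Gs # Hs))"
proof -
  have c: "\<forall>F\<in>set Fs. F \<in> Cell1 CatD" "\<forall>F\<in>set Gs. F \<in> Cell1 CatD"
      "\<forall>F\<in>set Hs. F \<in> Cell1 CatD"
    using assms by auto
  have T1G: "T1 Gs \<in> Cell1 CatD" by (rule T1_cell[OF c(2)])
  note el = emor_lists[OF c(1)] emor_lists[OF c(2)] emor_lists[OF c(3)]
  note oI = list_all2_appendI
  let ?S = "T0 (map msrc Fs @ T0 (map msrc Gs) # map msrc Hs)"
  show ?thesis
  proof (rule emor_eqI, goal_cases)
    case 1
    have "T1 (Fs @ Gs @ Hs) \<in> Cell1 CatD" "gam (map msrc Fs) (map msrc Gs) (map msrc Hs) \<in>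
        Cell1 CatD"
      using Cell1_ends[OF assms] by (auto intro!: T1_cell gam_cell assms simp del:
          Cat_enriched_simps)
    then show ?case by (simp add: emor_comp_normal)
  next
    case 2
    have "T1 (Fs @ T1 Gs # Hs) \<in> Cell1 CatD" "gam (map mtgt Fs) (map mtgt Gs) (map mtgt Hs)
        \<in> Cell1 CatD"
      using Cell1_ends[OF assms] T1G assms by (auto intro!: T1_cell gam_cell simp del:
          Cat_enriched_simps)
    then show ?case by (simp add: emor_comp_normal)
  next
    case (5 x)
    then have "x \<in> eobj ?S" by simp
    then obtain xs ys zs where x: "x = tupO (xs @ tupO ys # zs)" "objs (map msrc Fs) xs" "objs (map
        msrc Gs) ys"
      "objs (map msrc Hs) zs" and xl: "length (map msrc Fs) = length xs" "length (map msrc Gs) =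
          length ys"
      "length (map msrc Hs) = length zs" by (rule T0_nested_objE)
    then show ?case by (simp add: oI el)
  next
    case (6 f)
    then have "f \<in> earr ?S" by simp
    then obtain xs ys zs where x: "f = tupA (xs @ tupA ys # zs)" "arrs (map msrc Fs) xs" "arrs (map
        msrc Gs) ys"
      "arrs (map msrc Hs) zs" and xl: "length (map msrc Fs) = length xs" "length (map msrc Gs) =
          length ys"
      "length (map msrc Hs) = length zs" by (rule T0_nested_arrE)
    then show ?case by (simp add: oI el)
  next
    case (7 x y)
    then have "x \<in> eobj ?S" "y \<in> eobj ?S" by simp_all
    from this(1) obtain xs ys zs where x: "x = tupO (xs @ tupO ys # zs)" "objs (map msrc Fs) xs"
        "objs (map msrc Gs) ys"
      "objs (map msrc Hs) zs" and xl: "length (map msrc Fs) = length xs" "length (map msrc Gs) =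
          length ys"
      "length (map msrc Hs) = length zs" by (rule T0_nested_objE)
    from \<open>y \<in> eobj ?S\<close> obtain xs' ys' zs' where y: "y = tupO (xs' @ tupO ys' #
        zs')" "objs (map msrc Fs) xs'"
      "objs (map msrc Gs) ys'" "objs (map msrc Hs) zs'" and yl: "length (map msrc Fs) = length xs'"
      "length (map msrc Gs) = length ys'" "length (map msrc Hs) = length zs'" by (rule
          T0_nested_objE)
    have "set (mstrs Fs xs xs' @ mstrs Gs ys ys' @ mstrs Hs zs zs') \<subseteq> Arr D"
      using x y by (simp add: el)
    from L.dlt_nat[OF this] show ?case using x xl y yl by (simp add: oI el)
  qed simp_all
qed

lemma two_nest_simps:
  "length Xs = i \<Longrightarrow> length Ys = k \<Longrightarrow> length Zs = j \<Longrightarrow>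
      F0 (two_nest i k j T) (Xs @ Ys @ Zs) = T0 (Xs @ T0 Ys # Zs)"
  "length Fs = i \<Longrightarrow> length Gs = k \<Longrightarrow> length Hs = j \<Longrightarrow>
      F1 (two_nest i k j T) (Fs @ Gs @ Hs) = T1 (Fs @ T1 Gs # Hs)"
  "length as = i \<Longrightarrow> length bs = k \<Longrightarrow> length cs = j \<Longrightarrow>
      F2 (two_nest i k j T) (as @ bs @ cs) = T2 (as @ T2 bs # cs)"
  by (simp_all add: two_nest_def T_eq del: two_comp_simps)

text \<open>For 2-cells, both whiskerings have the concatenated tuple of components: on one side
  objects are flattened before the components are taken, on the other the tuple of components is
  flattened. The endpoints agree by \<open>gam_natural1\<close>.\<close>

theorem gam_natural:
  "two_natural (pow_two_cat (i + k + j) CatD) CatD (two_nest i k j T) (T (i + k + j)) (blocks i k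
      gam)"
proof (intro two_natural.intro two_natural_axioms.intro)
  let ?K = "pow_two_cat (i + k + j) CatD"
  interpret N: two_functor ?K CatD "two_nest i k j T" by (rule two_functor_nest[OF T_functor])
  interpret TT: two_functor ?K CatD "T (i + k + j)" by (rule T_functor)
  show "two_functor ?K CatD (two_nest i k j T)" "two_functor ?K CatD (T (i + k + j))" by
      unfold_locales
  show "nat_trans (cat01 ?K) (cat01 CatD) \<lparr>FO = F0 (two_nest i k j T), FA = F1 (two_nest i k
      j T)\<rparr>
     \<lparr>FO = F0 (T (i + k + j)), FA = F1 (T (i + k + j))\<rparr> (blocks i k gam)"
  proof (rule nat_transI, goal_cases)
    case 1
    show ?case by (rule N.F01.cat_functor)
  next
    case 2
    show ?case by (rule TT.F01.cat_functor)
  next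
    case (3 Es)
    then have len: "length Es = i + k + j" and Es: "\<forall>E\<in>set Es. E \<in> Cell0 CatD" by
        auto
    obtain Xs Ys Zs where [simp]: "Es = Xs @ Ys @ Zs" "length Xs = i" "length Ys = k" "length Zs =
        j"
      using len by (rule list_blocks)
    show ?case using gam_cell[of Xs Ys Zs] Es by (simp add: hom_def two_nest_simps T_eq del:
        two_comp_simps)
  next
    case (4 Fs')
    then have len: "length Fs' = i + k + j" and Fs': "\<forall>E\<in>set Fs'. E \<in> Cell1 CatD"
        by auto
    obtain Fs Gs Hs where [simp]: "Fs' = Fs @ Gs @ Hs" "length Fs = i" "length Gs = k" "length Hs =
        j"
      using len by (rule list_blocks)
    show ?case using gam_natural1[of Fs Gs Hs] Fs' by (simp add: two_nest_simps T_eq del: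
        two_comp_simps)
  qed
  fix as assume "as \<in> Cell2 ?K"
  then have len: "length as = i + k + j" and as: "\<forall>a\<in>set as. a \<in> Cell2 CatD" by auto
  obtain bs cs ds where [simp]: "as = bs @ cs @ ds" "length bs = i" "length cs = k" "length ds = j"
    using len by (rule list_blocks)
  let ?n = "bs @ T2 cs # ds"
  let ?g = "gam (map msrc (map tsrc bs)) (map msrc (map tsrc cs)) (map msrc (map tsrc ds))"
  let ?g' = "gam (map mtgt (map tsrc bs)) (map mtgt (map tsrc cs)) (map mtgt (map tsrc ds))"
  have cells: "T2 as \<in> Cell2 CatD" "T2 ?n \<in> Cell2 CatD" "?g \<in> Cell1 CatD" "?g' \<in>
      Cell1 CatD"
    using as Cell2_ends[of as] Cell1_ends[of "map tsrc as"] T2_cell[of cs]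
    by (auto intro!: T2_cell gam_cell simp del: Cat_enriched_simps)
  have b: "\<forall>a\<in>set bs. a \<in> Cell2 CatD" and c: "\<forall>a\<in>set cs. a \<in> Cell2
      CatD" and d: "\<forall>a\<in>set ds. a \<in> Cell2 CatD"
    using as by auto
  note par = Cell2_ends(3,4)[OF b] Cell2_ends(3,4)[OF c] Cell2_ends(3,4)[OF d]
  have "etrans_hcomp D (T2 as) (etrans_id ?g) = etrans_hcomp D (etrans_id ?g') (T2 ?n)"
  proof (rule etrans_eqI, goal_cases)
    case 1
    show ?case using cells by (simp add: cell_closure)
  next
    case 2
    show ?case using cells by (simp add: cell_closure)
  next
    case 3
    show ?case using gam_natural1[of "map tsrc bs" "map tsrc cs" "map tsrc ds"] Cell2_ends[OF as]
      by simp
  next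
    case 4
    \<comment> \<open>Naturality is applied to the target 1-cells, whose ends \<open>par\<close>
      rewrites to the ends of the source 1-cells from which \<open>?g\<close> and \<open>?g'\<close>
      are formed.\<close>
    have "\<forall>F\<in>set (map ttgt bs @ map ttgt cs @ map ttgt ds). F \<in> Cell1 CatD"
      using Cell2_ends[OF as] by simp
    from gam_natural1[OF this, unfolded par] show ?case by simp
  next
    case (5 x)
    then have "x \<in> eobj (T0 (map msrc (map tsrc bs) @ T0 (map msrc (map tsrc cs)) # map msrc
        (map tsrc ds)))"
      by simp
    then obtain xs ys zs where x: "x = tupO (xs @ tupO ys # zs)" "objs (map msrc (map tsrc bs)) xs"
      "objs (map msrc (map tsrc cs)) ys" "objs (map msrc (map tsrc ds)) zs"
      and xl: "length (map msrc (map tsrc bs)) = length xs" "length (map msrc (map tsrc cs)) =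
          length ys"
      "length (map msrc (map tsrc ds)) = length zs"
      by (rule T0_nested_objE)
    have t: "arrs (map mtgt (map tsrc es)) (map2 tcomp es ws)"
      if es: "\<forall>a\<in>set es. a \<in> Cell2 CatD" and ws: "objs (map msrc (map tsrc es)) ws"
          for es ws
    proof -
      have "enriched_trans D om (es ! i)" if "i < length es" for i
        using es that by simp
      note this[THEN enriched_trans.tcomp_hom]
      then show ?thesis using ws by (auto simp: list_all2_conv_all_nth hom_def)
    qed
    have "tcomp (etrans_hcomp D (T2 as) (etrans_id ?g)) x = tcomp (T2 as) (FO (mfun ?g) x)"
      using cells x by (intro tcomp_hcomp_id_right[of D om]) (auto intro!: list_all2_appendI)
    also have "\<dots> = tupA (map2 tcomp bs xs @ map2 tcomp cs ys @ map2 tcomp ds zs)"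
      using x xl by (simp add: list_all2_appendI)
    also have "\<dots> = FA (mfun ?g') (tcomp (T2 ?n) x)"
      using x xl as by (simp add: list_all2_appendI t[simplified])
    also have "\<dots> = tcomp (etrans_hcomp D (etrans_id ?g') (T2 ?n)) x"
      using cells x by (intro tcomp_hcomp_id_left[of D om, symmetric]) (auto intro!:
          list_all2_appendI)
    finally show ?case .
  qed
  then show "HComp CatD (F2 (T (i + k + j)) as) (Id2 CatD (blocks i k gam (Src1 ?K (Src2 ?K as))))
    = HComp CatD (Id2 CatD (blocks i k gam (Tgt1 ?K (Src2 ?K as)))) (F2 (two_nest i k j T) as)"
    by (simp add: two_nest_simps T_eq del: two_comp_simps)
qed

end

section \<open>The unit\<close>

lemma cat_functor_singleton:
  assumes "category C" "cat_functor (pow_cat 1 C) C F"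
  shows "cat_functor C C \<lparr>FO = (\<lambda>x. FO F [x]), FA = (\<lambda>f. FA F [f])\<rparr>"
proof -
  interpret C: category C by fact
  interpret F: cat_functor "pow_cat 1 C" C F by fact
  show ?thesis
    using F.FA_id[of "[_]"] F.FA_comp[of "[_]" "[_]"] F.FA_arr[of "[_]"] F.FA_dom[of "[_]"]
      F.FA_cod[of "[_]"] F.FO_obj[of "[_]"]
    by (intro cat_functorI) (auto simp: C.category hom_def)
qed

lemma two_functor_singleton:
  assumes "two_functor (pow_two_cat 1 K) K F"
  shows "two_functor K K \<lparr>F0 = (\<lambda>x. F0 F [x]), F1 = (\<lambda>f. F1 F [f]), F2 =
      (\<lambda>a. F2 F [a])\<rparr>"
proof -
  interpret F: two_functor "pow_two_cat 1 K" K F by fact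
  show ?thesis
    using cat_functor_singleton[OF F.T.C01.category F.F01.cat_functor[unfolded cat_of_pow_two_cat]]
      cat_functor_singleton[OF F.T.C12.category F.F12.cat_functor[unfolded cat_of_pow_two_cat]]
      cat_functor_singleton[OF F.T.C02.category F.F02.cat_functor[unfolded cat_of_pow_two_cat]]
    by (intro two_functor.intro F.T.two_category_axioms) simp_all
qed

lemma two_functor_id:
  assumes "two_category K"
  shows "two_functor K K two_id"
proof -
  interpret two_category K by fact
  show ?thesis
    by (intro two_functor.intro two_category_axioms cat_functorI C01.category C12.category
        C02.category)
      (auto simp: two_id_def hom_def)
qed

context duoidal_tuples
begin

abbreviation "iot \<equiv> times_unit tupO tupA D lam chi"

lemma iot_simps [simp]:
  "msrc (iot X) = X" "mtgt (iot X) = T0 [X]"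
  "x \<in> eobj X \<Longrightarrow> FO (mfun (iot X)) x = tupO [x]"
  "f \<in> earr X \<Longrightarrow> FA (mfun (iot X)) f = tupA [f]"
  "x \<in> eobj X \<Longrightarrow> y \<in> eobj X \<Longrightarrow> mstr (iot X) (x, y) = cnt lam
      (hO X x y)"
  by (simp_all add: times_unit_def times_lam_def T0_def)

text \<open>Units and compositions are preserved by \<open>chi_unit\<close> at columns of height
  zero and two, followed by naturality of \<open>cnt lam\<close>.\<close>

lemma iot_functor:
  assumes "enriched_category D om X"
  shows "enriched_functor D om (iot X)"
proof -
  interpret X: enriched_category D om X by fact
  interpret U: category "ucat X" by (rule X.ucat_category)
  interpret TX: enriched_category D om "T0 [X]" by (rule T0_enriched) (use assms in simp)
  interpret TU: category "ucat (T0 [X])" by (rule TX.ucat_category)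
  have "cat_functor (ucat X) (ucat (T0 [X])) (mfun (iot X))"
    by (rule cat_functorI) (auto simp: hom_def U.category TU.category)
  then show ?thesis
  proof (intro enriched_functorI, goal_cases)
    case (5 f h x x' y y')
    then show ?case using L.cnt_nat[of "hA X f h"] by (auto simp: hom_def)
  next
    case (6 x)
    \<comment> \<open>For the empty column the factor \<open>tA om []\<close> is an identity, so
      \<open>chi 1 []\<close> itself is the unit map of \<open>lam\<close> at the unit object of
      \<open>om\<close>.\<close>
    have "chi 1 [] \<in> Arr D" "Dom D (chi 1 []) = tO om []"
      using chi.l_arr[of "[]" 1] chi.l_dom[of "[]" 1] by simp_all
    then have "chi 1 [] = cnt lam (tO om [])"
      using chi_unit[of "[]"] W.tA_id[of "[]"] by simp
    then show ?case using 6 L.cnt_nat[of "eta X x"] by simp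
  next
    case (7 x y z)
    then have "chi 1 [[hO X y z], [hO X x y]] \<cdot> tA om [cnt lam (hO X y z), cnt lam (hO X x y)]
        = cnt lam (tO om [hO X y z, hO X x y])"
      using chi_unit[of "[hO X y z, hO X x y]"] by simp
    then show ?case using 7 L.cnt_nat[of "mu X (x, y, z)"] chi_binary[of "[hO X y z]" 1 "[hO X x
        y]"] by simp
  qed (auto simp: hom_def X.enriched_category TX.enriched_category)
qed

lemma iot_cell: "X \<in> Cell0 CatD \<Longrightarrow> iot X \<in> Cell1 CatD"
  using T0_cell[of "[X]"] iot_functor[of X]
  by (simp add: emor_normal_def) (simp add: times_unit_def)

text \<open>On structure maps this is naturality of \<open>cnt lam\<close> at those of
  \<open>F\<close>; on tuples both sides wrap an entry as a one-element tuple.\<close>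

lemma iot_natural1:
  assumes "F \<in> Cell1 CatD"
  shows "emor_comp D (T1 [F]) (iot (msrc F)) = emor_comp D (iot (mtgt F)) F"
proof -
  interpret F: enriched_functor D om F using assms by simp
  show ?thesis
  proof (rule emor_eqI, goal_cases)
    case 1
    have "T1 [F] \<in> Cell1 CatD" "iot (msrc F) \<in> Cell1 CatD"
      using assms Cell1_ends[of "[F]"] by (auto intro!: T1_cell iot_cell simp del:
          Cat_enriched_simps)
    then show ?case by (simp add: emor_comp_normal)
  next
    case 2
    have "iot (mtgt F) \<in> Cell1 CatD"
      using assms Cell1_ends[of "[F]"] by (auto intro!: iot_cell simp del: Cat_enriched_simps)
    then show ?case using assms by (simp add: emor_comp_normal)
  next
    case (7 x y)
    then show ?case using L.cnt_nat[of "mstr F (x, y)"] by simp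
  qed simp_all
qed

theorem iot_natural:
  "two_natural CatD CatD two_id
    \<lparr>F0 = (\<lambda>x. F0 (T 1) [x]), F1 = (\<lambda>f. F1 (T 1) [f]), F2 = (\<lambda>a. F2
        (T 1) [a])\<rparr> iot"
  (is "two_natural _ _ ?I ?T1 _")
proof (intro two_natural.intro two_natural_axioms.intro)
  show f1: "two_functor CatD CatD ?I" by (rule two_functor_id[OF two_category_Cat_enriched])
  show f2: "two_functor CatD CatD ?T1" by (rule two_functor_singleton[OF T_functor])
  show "nat_trans (cat01 CatD) (cat01 CatD) \<lparr>FO = F0 ?I, FA = F1 ?I\<rparr> \<lparr>FO = F0
      ?T1, FA = F1 ?T1\<rparr> iot"
  proof (rule nat_transI, goal_cases)
    case 1
    show ?case by (rule two_functor.axioms(3)[OF f1])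
  next
    case 2
    show ?case by (rule two_functor.axioms(3)[OF f2])
  next
    case (3 X)
    then show ?case using iot_cell[of X] by (simp add: hom_def two_id_def T_eq del: two_comp_simps)
  next
    case (4 F)
    then show ?case using iot_natural1[of F] by (simp add: two_id_def T_eq del: two_comp_simps)
  qed
  fix a assume a: "a \<in> Cell2 CatD"
  then interpret a: enriched_trans D om a by simp
  have cells: "T2 [a] \<in> Cell2 CatD" "tsrc a \<in> Cell1 CatD" "ttgt a \<in> Cell1 CatD"
    "iot (msrc (tsrc a)) \<in> Cell1 CatD" "iot (mtgt (tsrc a)) \<in> Cell1 CatD"
    using a Cell2_ends[of "[a]"] Cell1_ends[of "[tsrc a]"]
    by (auto intro!: T2_cell iot_cell simp del: Cat_enriched_simps)
  have "etrans_hcomp D (T2 [a]) (etrans_id (iot (msrc (tsrc a)))) = etrans_hcomp D (etrans_id (iot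
      (mtgt (tsrc a)))) a"
  proof (rule etrans_eqI, goal_cases)
    case 1
    show ?case using cells by (simp add: cell_closure)
  next
    case 2
    show ?case using cells a by (simp add: cell_closure)
  next
    case 3
    show ?case using iot_natural1[OF cells(2)] by simp
  next
    case 4
    show ?case using iot_natural1[OF cells(3)] by (simp add: a.parallel)
  next
    case (5 x)
    then have x: "x \<in> eobj (msrc (tsrc a))" by simp
    then have "tcomp (etrans_hcomp D (T2 [a]) (etrans_id (iot (msrc (tsrc a))))) x = tcomp (T2 [a])
        (tupO [x])"
      using cells by (subst tcomp_hcomp_id_right[of D om]) auto
    moreover have "tcomp (etrans_hcomp D (etrans_id (iot (mtgt (tsrc a)))) a) x = tupA [tcomp a x]"
      using cells a x by (subst tcomp_hcomp_id_left[of D om]) auto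
    ultimately show ?case using x by simp
  qed
  then show "HComp CatD (F2 ?T1 a) (Id2 CatD (iot (Src1 CatD (Src2 CatD a))))
     = HComp CatD (Id2 CatD (iot (Tgt1 CatD (Src2 CatD a)))) (F2 ?I a)"
    by (simp add: two_id_def T_eq del: two_comp_simps)
qed

section \<open>The coherence axioms\<close>

text \<open>Identity 1-cells fill the outer positions in the coherence axioms: as lists they fix
  tuples, and their structure maps are the identities that occur in the laws of
  \<open>lam\<close>.\<close>

lemma emor_ids:
  shows "map (msrc \<circ> emor_id D) Xs = Xs" "map (mtgt \<circ> emor_id D) Xs = Xs"
    "objs Xs xs \<Longrightarrow> FOs (map (emor_id D) Xs) xs = xs"
    "arrs Xs fs \<Longrightarrow> FAs (map (emor_id D) Xs) fs = fs"
    "\<lbrakk>objs Xs xs; objs Xs ys\<rbrakk> \<Longrightarrow> mstrs (map (emor_id D) Xs) xs ys =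
        map (Id D) (hOs Xs xs ys)"
  by (auto simp: list_all2_conv_all_nth intro!: nth_equalityI)

lemma emor_ids_cell: "\<forall>X\<in>set Xs. X \<in> Cell0 CatD \<Longrightarrow>
    \<forall>F\<in>set (map (emor_id D) Xs). F \<in> Cell1 CatD"
  by (auto intro: enriched_functor_id emor_id_normal)

text \<open>Flattening strips the outer one-element tuple that \<open>iot\<close> adds; on homs this
  is the outer unit law of \<open>lam\<close>.\<close>

lemma gam_unit_outer:
  assumes Xs: "\<forall>X\<in>set Xs. X \<in> Cell0 CatD"
  shows "emor_comp D (gam [] Xs []) (iot (T0 Xs)) = emor_id D (T0 Xs)"
proof -
  have cells: "gam [] Xs [] \<in> Cell1 CatD" "iot (T0 Xs) \<in> Cell1 CatD" "T0 Xs \<in> Cell0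
      CatD"
    using Xs by (auto intro!: gam_cell iot_cell T0_cell simp del: Cat_enriched_simps)
  \<comment> \<open>With empty outer lists the left sides of these rules collapse to one-element
    tuples; unsimplified they would not match.\<close>
  note simps = gam_FO[of "[]" "[]" Xs _ "[]" "[]", simplified] gam_FA[of "[]" "[]" Xs _ "[]" "[]",
      simplified]
    gam_mstr[of "[]" "[]" Xs _ "[]" "[]" "[]" _ "[]", simplified]
  show ?thesis
  proof (rule emor_eqI, goal_cases)
    case 1
    show ?case using cells by (simp add: emor_comp_normal)
  next
    case 2
    show ?case using cells by (simp add: emor_id_normal)
  next
    case (5 x)
    then have "x \<in> eobj (T0 Xs)" by simp
    then show ?case by (elim T0_objE) (simp add: simps)
  next
    case (6 f)
    then have "f \<in> earr (T0 Xs)" by simp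
    then show ?case by (elim T0_arrE) (simp add: simps)
  next
    case (7 x y)
    then have "x \<in> eobj (T0 Xs)" "y \<in> eobj (T0 Xs)" by simp_all
    then show ?case using Xs by (elim T0_objE) (simp add: simps L.unit_outer hOs_obj)
  qed simp_all
qed

text \<open>Wrapping the middle entry as a one-element tuple and then flattening restores the tuple;
  on homs this is the inner unit law of \<open>lam\<close>.\<close>

lemma gam_unit_inner:
  assumes Xs: "\<forall>X\<in>set Xs. X \<in> Cell0 CatD" and Y: "Y \<in> Cell0 CatD" and Zs:
      "\<forall>X\<in>set Zs. X \<in> Cell0 CatD"
  shows "emor_comp D (gam Xs [Y] Zs) (T1 (map (emor_id D) Xs @ iot Y # map (emor_id D) Zs))
    = emor_id D (T0 (Xs @ Y # Zs))"
proof -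
  let ?F = "map (emor_id D) Xs @ iot Y # map (emor_id D) Zs"
  have cells: "gam Xs [Y] Zs \<in> Cell1 CatD" "T1 ?F \<in> Cell1 CatD" "T0 (Xs @ Y # Zs) \<in>
      Cell0 CatD"
    using assms emor_ids_cell[OF Xs] emor_ids_cell[OF Zs]
    by (auto intro!: gam_cell T1_cell iot_cell T0_cell simp del: Cat_enriched_simps set_map)
  have m: "map msrc ?F = Xs @ Y # Zs" "map mtgt ?F = Xs @ T0 [Y] # Zs"
    using emor_ids(1,2)[of Xs] emor_ids(1,2)[of Zs] by simp_all
  note oI = list_all2_appendI
  show ?thesis
  proof (rule emor_eqI, goal_cases)
    case 1
    show ?case using cells by (simp add: emor_comp_normal)
  next
    case 2
    show ?case using cells by (simp add: emor_id_normal)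
  next
    case 3
    show ?case by (simp only: emor_comp_simps emor_id_simps T1_ends m)
  next
    case (5 x)
    then have "x \<in> eobj (T0 (Xs @ Y # Zs))" by simp
    then show ?case
      by (elim T0_objE list_all2_nestedE) (simp add: oI emor_ids)
  next
    case (6 f)
    then have "f \<in> earr (T0 (Xs @ Y # Zs))" by simp
    then show ?case
      by (elim T0_arrE list_all2_nestedE) (simp add: oI emor_ids)
  next
    case (7 x y)
    then have "x \<in> eobj (T0 (Xs @ Y # Zs))" "y \<in> eobj (T0 (Xs @ Y # Zs))" by simp_all
    from this(1) obtain xs x1 zs where x: "x = tupO (xs @ x1 # zs)" "objs Xs xs" "x1 \<in> eobj Y"
        "objs Zs zs"
      and xl: "length Xs = length xs" "length Zs = length zs" by (elim T0_objE list_all2_nestedE)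
          simp
    from \<open>y \<in> eobj (T0 (Xs @ Y # Zs))\<close> obtain xs' x1' zs' where y: "y = tupO (xs'
        @ x1' # zs')"
      "objs Xs xs'" "x1' \<in> eobj Y" "objs Zs zs'"
      and yl: "length Xs = length xs'" "length Zs = length zs'" by (elim T0_objE list_all2_nestedE)
          simp
    have "hO Y x1 x1' \<in> Obj D" using Y x y by (simp add: enriched_category.hO_obj[of D om])
    then have "set (hOs Xs xs xs' @ [hO Y x1 x1'] @ hOs Zs zs zs') \<subseteq> Obj D"
      using assms x y by (simp add: hOs_obj)
    from L.unit_inner[OF this] show ?case
      using x xl y yl by (simp add: oI emor_ids)
  qed simp_all
qed

text \<open>Two disjoint inner tuples may be flattened in either order, with result
  \<open>xs @ us @ ys @ vs @ zs\<close>; on homs this is the parallel associativity law of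
  \<open>lam\<close>.\<close>

lemma gam_assoc_parallel:
  assumes cells: "\<forall>X\<in>set (Xs @ Us @ Ys @ Vs @ Zs). X \<in> Cell0 CatD"
  shows "emor_comp D (gam Xs Us (Ys @ Vs @ Zs)) (gam (Xs @ T0 Us # Ys) Vs Zs)
    = emor_comp D (gam (Xs @ Us @ Ys) Vs Zs) (gam Xs Us (Ys @ T0 Vs # Zs))"
proof -
  have "T0 Us \<in> Cell0 CatD" "T0 Vs \<in> Cell0 CatD" using cells by (auto intro!: T0_cell simp
      del: Cat_enriched_simps)
  then have c: "gam Xs Us (Ys @ Vs @ Zs) \<in> Cell1 CatD" "gam (Xs @ T0 Us # Ys) Vs Zs \<in> Cell1
      CatD"
    "gam (Xs @ Us @ Ys) Vs Zs \<in> Cell1 CatD" "gam Xs Us (Ys @ T0 Vs # Zs) \<in> Cell1 CatD"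
    using cells by (auto intro!: gam_cell simp del: Cat_enriched_simps)
  let ?S = "T0 (Xs @ T0 Us # Ys @ T0 Vs # Zs)"
  note oI = list_all2_appendI
  have objE: thesis if "x \<in> eobj ?S"
    "\<And>xs us ys vs zs. \<lbrakk>x = tupO (xs @ tupO us # ys @ tupO vs # zs); objs Xs xs; objs
        Us us; objs Ys ys; objs Vs vs; objs Zs zs;
     length Xs = length xs; length Us = length us; length Ys = length ys; length Vs = length vs;
         length Zs = length zs\<rbrakk> \<Longrightarrow> thesis"
    for x thesis
  proof -
    from that(1) obtain xs us ws where x: "x = tupO (xs @ tupO us # ws)" "objs Xs xs" "objs Us us"
        "objs (Ys @ T0 Vs # Zs) ws"
      "length Xs = length xs" "length Us = length us" by (rule T0_nested_objE)
    from x(4) obtain ys v zs where "ws = ys @ v # zs" "objs Ys ys" "v \<in> eobj (T0 Vs)" "objs Zs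
        zs"
       "length Ys = length ys" "length Zs = length zs" by (rule list_all2_nestedE)
    moreover from this(3) obtain vs where "v = tupO vs" "objs Vs vs" by (rule T0_objE)
    ultimately show thesis using that(2) x by (auto dest: list_all2_lengthD)
  qed
  have arrE: thesis if "x \<in> earr ?S"
    "\<And>xs us ys vs zs. \<lbrakk>x = tupA (xs @ tupA us # ys @ tupA vs # zs); arrs Xs xs; arrs
        Us us; arrs Ys ys; arrs Vs vs; arrs Zs zs\<rbrakk> \<Longrightarrow> thesis"
    for x thesis
  proof -
    from that(1) obtain xs us ws where x: "x = tupA (xs @ tupA us # ws)" "arrs Xs xs" "arrs Us us"
        "arrs (Ys @ T0 Vs # Zs) ws"
      by (rule T0_nested_arrE)
    from x(4) obtain ys v zs where "ws = ys @ v # zs" "arrs Ys ys" "v \<in> earr (T0 Vs)" "arrs Zs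
        zs"
      by (rule list_all2_nestedE)
    moreover from this(3) obtain vs where "v = tupA vs" "arrs Vs vs" by (rule T0_arrE)
    ultimately show thesis using that(2) x by auto
  qed
  show ?thesis
  proof (rule emor_eqI, goal_cases)
    case 1
    show ?case using c by (simp add: emor_comp_normal)
  next
    case 2
    show ?case using c by (simp add: emor_comp_normal)
  next
    case (5 x)
    then have "x \<in> eobj ?S" by simp
    then show ?case
    proof (rule objE, goal_cases)
      case (1 xs us ys vs zs)
      then have "objs (Xs @ T0 Us # Ys) (xs @ tupO us # ys)" "objs (Xs @ Us @ Ys) (xs @ us @ ys)"
          by (simp_all add: oI)
      \<comment> \<open>Concatenations are normalised to right-nested form, so the front part must
        be supplied as one list for \<open>gam_FO\<close> to act on the second inner tuple.\<close>
      from this[THEN gam_FO, OF 1(5,6)] 1 show ?case by (simp add: oI)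
    qed
  next
    case (6 f)
    then have "f \<in> earr ?S" by simp
    then show ?case
    proof (rule arrE, goal_cases)
      case (1 xs us ys vs zs)
      then have "arrs (Xs @ T0 Us # Ys) (xs @ tupA us # ys)" "arrs (Xs @ Us @ Ys) (xs @ us @ ys)"
          by (simp_all add: oI)
      from this[THEN gam_FA, OF 1(5,6)] 1 show ?case by (simp add: oI)
    qed
  next
    case (7 x y)
    then have "x \<in> eobj ?S" "y \<in> eobj ?S" by simp_all
    from this(1) show ?case
    proof (rule objE, goal_cases)
      case x: (1 xs us ys vs zs)
      from \<open>y \<in> eobj ?S\<close> show ?case
      proof (rule objE, goal_cases)
        case y: (1 xs' us' ys' vs' zs')
        have o: "objs (Xs @ T0 Us # Ys) (xs @ tupO us # ys)" "objs (Xs @ Us @ Ys) (xs @ us @ ys)"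
            "objs (Xs @ T0 Us # Ys) (xs' @ tupO us' # ys')" "objs (Xs @ Us @ Ys) (xs' @ us' @ ys')"
          using x y by (simp_all add: oI)
        note f = gam_FO[OF o(1) x(5,6)] gam_FO[OF o(2) x(5,6)] gam_FO[OF o(3) y(5,6)] gam_FO[OF
            o(4) y(5,6)]
          gam_mstr[OF o(1) x(5,6) o(3) y(5,6)] gam_mstr[OF o(2) x(5,6) o(4) y(5,6)]
        have "set (hOs Xs xs xs' @ hOs Us us us' @ hOs Ys ys ys' @ hOs Vs vs vs' @ hOs Zs zs zs')
            \<subseteq> Obj D"
          using cells x y by (simp add: hOs_obj)
        from L.assoc_parallel[OF this] f x y show ?case by (simp add: oI)
      qed
    qed
  qed simp_all
qed

text \<open>Tuples are nested twice, and flattening the innermost or the outermost level first gives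
  the same concatenation. Innermost first, the structure map contains \<open>lam\<close> applied to
  a \<open>dlt lam\<close> between identities, so the equation on homs is the nested associativity
  law of \<open>lam\<close>.\<close>

lemma gam_assoc_nested:
  assumes cells: "\<forall>X\<in>set (Xs @ Us @ Vs @ Ws @ Zs). X \<in> Cell0 CatD"
  shows "emor_comp D (gam Xs (Us @ Vs @ Ws) Zs) (T1 (map (emor_id D) Xs @ gam Us Vs Ws # map
      (emor_id D) Zs))
    = emor_comp D (gam (Xs @ Us) Vs (Ws @ Zs)) (gam Xs (Us @ T0 Vs # Ws) Zs)"
proof -
  let ?F = "map (emor_id D) Xs @ gam Us Vs Ws # map (emor_id D) Zs"
  let ?M = "T0 (Us @ T0 Vs # Ws)"
  let ?S = "T0 (Xs @ ?M # Zs)"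
  have XZ: "\<forall>X\<in>set Xs. X \<in> Cell0 CatD" "\<forall>X\<in>set Zs. X \<in> Cell0 CatD"
      using cells by auto
  have "T0 Vs \<in> Cell0 CatD" using cells by (auto intro!: T0_cell simp del: Cat_enriched_simps)
  then have c: "gam Xs (Us @ Vs @ Ws) Zs \<in> Cell1 CatD" "T1 ?F \<in> Cell1 CatD"
    "gam (Xs @ Us) Vs (Ws @ Zs) \<in> Cell1 CatD" "gam Xs (Us @ T0 Vs # Ws) Zs \<in> Cell1 CatD"
    using cells XZ[THEN emor_ids_cell] by (auto intro!: gam_cell T1_cell simp del:
        Cat_enriched_simps set_map)
  have m: "map msrc ?F = Xs @ ?M # Zs" "map mtgt ?F = Xs @ T0 (Us @ Vs @ Ws) # Zs"
    using emor_ids(1,2)[of Xs] emor_ids(1,2)[of Zs] by simp_all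
  note oI = list_all2_appendI
  have objE: thesis if "x \<in> eobj ?S"
    "\<And>xs us vs ws zs. \<lbrakk>x = tupO (xs @ tupO (us @ tupO vs # ws) # zs); objs Xs xs; objs
        Us us; objs Vs vs; objs Ws ws; objs Zs zs;
     length Xs = length xs; length Us = length us; length Vs = length vs; length Ws = length ws;
         length Zs = length zs\<rbrakk> \<Longrightarrow> thesis"
    for x thesis
  proof -
    from that(1) obtain xs ys zs where x: "x = tupO (xs @ tupO ys # zs)" "objs Xs xs" "tupO ys
        \<in> eobj ?M" "objs Zs zs"
      "length Xs = length xs" "length Zs = length zs" by (rule T0_nested_objE) (simp only: T0_obj)
    from x(3) obtain us vs ws where "tupO ys = tupO (us @ tupO vs # ws)" "objs Us us" "objs Vs vs"
        "objs Ws ws"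
       "length Us = length us" "length Vs = length vs" "length Ws = length ws" by (rule
           T0_nested_objE)
    then show thesis using that(2) x by auto
  qed
  have arrE: thesis if "x \<in> earr ?S"
    "\<And>xs us vs ws zs. \<lbrakk>x = tupA (xs @ tupA (us @ tupA vs # ws) # zs); arrs Xs xs; arrs
        Us us; arrs Vs vs; arrs Ws ws; arrs Zs zs;
     length Xs = length xs; length Us = length us; length Vs = length vs; length Ws = length ws;
         length Zs = length zs\<rbrakk> \<Longrightarrow> thesis"
    for x thesis
  proof -
    from that(1) obtain xs ys zs where x: "x = tupA (xs @ tupA ys # zs)" "arrs Xs xs" "tupA ys
        \<in> earr ?M" "arrs Zs zs"
      "length Xs = length xs" "length Zs = length zs" by (rule T0_nested_arrE) (simp only: T0_arr)
    from x(3) obtain us vs ws where "tupA ys = tupA (us @ tupA vs # ws)" "arrs Us us" "arrs Vs vs"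
        "arrs Ws ws"
       "length Us = length us" "length Vs = length vs" "length Ws = length ws" by (rule
           T0_nested_arrE)
    then show thesis using that(2) x by auto
  qed
  show ?thesis
  proof (rule emor_eqI, goal_cases)
    case 1
    show ?case using c by (simp add: emor_comp_normal)
  next
    case 2
    show ?case using c by (simp add: emor_comp_normal)
  next
    case 3
    show ?case by (simp only: emor_comp_simps T1_ends m gam_ends)
  next
    case (5 x)
    then have "x \<in> eobj ?S" by simp
    then show ?case
    proof (rule objE, goal_cases)
      case (1 xs us vs ws zs)
      \<comment> \<open>Once the outer level is flattened, the remaining inner tuple has the
        concatenated lists \<open>xs @ us\<close> and \<open>ws @ zs\<close> on its two
        sides.\<close>
      then have "objs (Xs @ Us) (xs @ us)" "objs (Ws @ Zs) (ws @ zs)" by (simp_all add: oI)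
      from gam_FO[OF this(1) 1(4) this(2)] 1 show ?case by (simp add: oI emor_ids)
    qed
  next
    case (6 f)
    then have "f \<in> earr ?S" by simp
    then show ?case
    proof (rule arrE, goal_cases)
      case (1 xs us vs ws zs)
      then have "arrs (Xs @ Us) (xs @ us)" "arrs (Ws @ Zs) (ws @ zs)" by (simp_all add: oI)
      from gam_FA[OF this(1) 1(4) this(2)] 1 show ?case by (simp add: oI emor_ids)
    qed
  next
    case (7 x y)
    then have "x \<in> eobj ?S" "y \<in> eobj ?S" by simp_all
    from this(1) show ?case
    proof (rule objE, goal_cases)
      case x: (1 xs us vs ws zs)
      from \<open>y \<in> eobj ?S\<close> show ?case
      proof (rule objE, goal_cases)
        case y: (1 xs' us' vs' ws' zs')
        have o: "objs (Xs @ Us) (xs @ us)" "objs (Ws @ Zs) (ws @ zs)"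
            "objs (Xs @ Us) (xs' @ us')" "objs (Ws @ Zs) (ws' @ zs')"
          using x y by (simp_all add: oI)
        note f = gam_FO[OF o(1) x(4) o(2)] gam_FO[OF o(3) y(4) o(4)] gam_mstr[OF o(1) x(4) o(2)
            o(3) y(4) o(4)]
        have "set (hOs Xs xs xs' @ hOs Us us us' @ hOs Vs vs vs' @ hOs Ws ws ws' @ hOs Zs zs zs')
            \<subseteq> Obj D"
          using cells x y by (simp add: hOs_obj)
        from L.assoc_nested[OF this] f x y show ?case by (simp add: oI emor_ids)
      qed
    qed
  qed simp_all
qed

theorem lax_monoidal_CatD: "lax_monoidal_two_category CatD T gam iot"
proof (intro lax_monoidal_two_category.intro lax_monoidal_two_category_axioms.intro
    two_category_Cat_enriched T_functor gam_natural iot_natural, goal_cases)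
  case (1 xs)
  then have "\<forall>X\<in>set xs. X \<in> Cell0 CatD" by blast
  from gam_unit_outer[OF this] show ?case by (simp add: T_eq del: two_comp_simps)
next
  case (2 xs y zs n)
  then have "\<forall>X\<in>set xs. X \<in> Cell0 CatD" "y \<in> Cell0 CatD" "\<forall>X\<in>set
      zs. X \<in> Cell0 CatD" by auto
  from gam_unit_inner[OF this] 2(2) show ?case by (simp add: T_eq del: two_comp_simps)
next
  case (3 xs us ys vs zs)
  then have "\<forall>X\<in>set (xs @ us @ ys @ vs @ zs). X \<in> Cell0 CatD" by blast
  from gam_assoc_parallel[OF this] show ?case by (simp add: T_eq del: two_comp_simps)
next
  case (4 xs us vs ws zs n)
  then have "\<forall>X\<in>set (xs @ us @ vs @ ws @ zs). X \<in> Cell0 CatD" by blast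
  from gam_assoc_nested[OF this] 4(2) show ?case by (simp add: T_eq del: two_comp_simps)
qed

end

theorem mainTheorem5:
  fixes D :: "('p, 'b) cat" and lam om :: "('p, 'b) mon"
    and chi :: "nat \<Rightarrow> 'p list list \<Rightarrow> 'b"
    and tupO :: "'o list \<Rightarrow> 'o" and tupA :: "'a list \<Rightarrow> 'a"
  assumes "duoidal D lam om chi"
    and "inj tupO" and "inj tupA"
  shows "lax_monoidal_two_category (Cat_enriched D om)
    (\<lambda>n. pushforward (tens lam) (chi n) D \<circ>\<^sub>2 boxprod tupO tupA)
    (times_mult tupO tupA D lam chi)
    (times_unit tupO tupA D lam chi)"
proof -
  interpret duoidal_tuples D lam om chi tupO tupA
    using assms by (intro duoidal_tuples.intro tuple_coding.intro)
  show ?thesis by (rule lax_monoidal_CatD)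
qed

end
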